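(* Assume that the weights $\mathbf W$ satisfy Conditions 1 (given in the context). There exist a constant $F>0$ (independent of $n$) and a constant $A>0$ depending only on the distribution of $W$ such that, for every sequence $f_n=o(n^{1/3})$ with $f_n\ge F$, for all $n$ large enough, if $\mathrm{Exc}$ denotes the excess of the largest connected component of $G(\mathbf W,p_{f_n})$, then $$\mathbb P\left(\mathrm{Exc}\ge A f_n^3\right)\le A\exp\left(\frac{-f_n}{A}\right).$$
   Context: Model. For each $n\ge1$, $\mathbf W=(w_1,\dots,w_n)$ is a deterministic vector of weights (depending implicitly on $n$) with $0<w_n\le w_{n-1}\le\dots\le w_1$, and $\ell_n=\sum_{i=1}^n w_i$. For $p\in[0,+\infty]$, $G(\mathbf W,p)$ is the random graph on $\{1,\dots,n\}$ in which each edge $\{i,j\}$ is present with probability $1-e^{-w_iw_jp}$, independently of everything else. Conditions 1. There is a positive random variable $W$ such that: (i) the distribution of a uniformly chosen weight (uniform among $w_1,\dots,w_n$) converges weakly to $W$ as $n\to\infty$; (ii) $\mathbb E[W^3]<\infty$; (iii) $\mathbb E[W^2]=\mathbb E[W]$; (iv) $\ell_n=\mathbb E[W]n+o(n^{2/3})$; (v) $\sum_{k=1}^n w_k^2=\mathbb E[W^2]n+o(n^{2/3})$; (vi) $\sum_{k=1}^n w_k^3=\mathbb E[W^3]n+o(1)$; (vii) $\max_{i\le n}w_i=o(n^{1/3})$. Notation. $p_{f_n}=\dfrac{\ell_n^{1/3}+f_n}{\ell_n^{4/3}}$. The size of a connected component is its number of vertices. The excess (or surplus) of a connected component is the number of edges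 that have to be removed from it to make it a tree. *)

theory Defs
  imports "HOL-Probability.Probability" "HOL-Library.Landau_Symbols"
begin

text \<open>
  A graph is given by a vertex set and a set of edges, an edge being a two-element set of
  vertices. For a graph with edge set \<open>E\<close>, the subgraph induced on \<open>C\<close> has the edge set
  \<open>induced_edges E C\<close>.
\<close>

definition vertex_pairs :: "nat \<Rightarrow> nat set set" where
  "vertex_pairs n = {e. e \<subseteq> {1..n} \<and> card e = 2}"

definition adjacency :: "'v set set \<Rightarrow> ('v \<times> 'v) set" where
  "adjacency E = {(u, v). u \<noteq> v \<and> {u, v} \<in> E}"

definition induced_edges :: "'v set set \<Rightarrow> 'v set \<Rightarrow> 'v set set" where
  "induced_edges E C = {e \<in> E. e \<subseteq> C}"

definition graph_components :: "'v set \<Rightarrow> 'v set set \<Rightarrow> 'v set set" where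
  "graph_components V E = V // {(u, v). u \<in> V \<and> v \<in> V \<and> (u, v) \<in> (adjacency E)\<^sup>*}"

definition connected_graph :: "'v set \<Rightarrow> 'v set set \<Rightarrow> bool" where
  "connected_graph V E \<longleftrightarrow> V \<noteq> {} \<and> (\<forall>u\<in>V. \<forall>v\<in>V. (u, v) \<in> (adjacency E)\<^sup>*)"

text \<open>A cycle is listed by its distinct vertices; its last vertex is joined to its first.\<close>

definition is_cycle :: "'v set set \<Rightarrow> 'v list \<Rightarrow> bool" where
  "is_cycle E xs \<longleftrightarrow> 3 \<le> length xs \<and> distinct xs \<and>
     (\<forall>i < length xs. {xs ! i, xs ! (Suc i mod length xs)} \<in> E)"

definition is_tree :: "'v set \<Rightarrow> 'v set set \<Rightarrow> bool" where
  "is_tree V E \<longleftrightarrow> connected_graph V E \<and> (\<nexists>xs. is_cycle E xs)"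

definition excess :: "'v set set \<Rightarrow> 'v set \<Rightarrow> nat" where
  "excess E C = (LEAST k. \<exists>R \<subseteq> induced_edges E C. card R = k \<and> is_tree C (induced_edges E C - R))"

definition largest_components :: "nat \<Rightarrow> nat set set \<Rightarrow> nat set set" where
  "largest_components n E =
     {C \<in> graph_components {1..n} E. \<forall>D \<in> graph_components {1..n} E. card D \<le> card C}"

text \<open>
  The largest component need not be unique. In case of a tie we take the largest excess among the
  components of maximal size, so that an upper bound on the tail of this random variable holds
  for every way of breaking ties.
\<close>

definition largest_component_excess :: "nat \<Rightarrow> nat set set \<Rightarrow> nat" where
  "largest_component_excess n E = Max (excess E ` largest_components n E)"

text \<open>
  The law of the edge set of the random graph; for \<open>e = {i, j}\<close> with \<open>i \<noteq> j\<close> the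
  product over \<open>e\<close> is \<open>w i * w j\<close>.
\<close>

definition random_graph :: "nat \<Rightarrow> (nat \<Rightarrow> real) \<Rightarrow> real \<Rightarrow> nat set set pmf" where
  "random_graph n w p =
     map_pmf (\<lambda>b. {e \<in> vertex_pairs n. b e})
       (Pi_pmf (vertex_pairs n) False (\<lambda>e. bernoulli_pmf (1 - exp (- ((\<Prod>i\<in>e. w i) * p)))))"

text \<open>
  Weights form a triangular array: \<open>w n i\<close> is the \<open>i\<close>-th weight, \<open>1 \<le> i \<le> n\<close>, of the
  \<open>n\<close>-th weight vector. Values outside this range are irrelevant.
\<close>

definition weight_array :: "(nat \<Rightarrow> nat \<Rightarrow> real) \<Rightarrow> bool" where
  "weight_array w \<longleftrightarrow> (\<forall>n\<ge>1. (\<forall>i\<in>{1..n}. 0 < w n i) \<and> antimono_on {1..n} (w n))"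

definition total_weight :: "(nat \<Rightarrow> nat \<Rightarrow> real) \<Rightarrow> nat \<Rightarrow> real" where
  "total_weight w n = (\<Sum>i=1..n. w n i)"

text \<open>The measure \<open>\<mu>\<close> is the law of the limiting random variable \<open>W\<close>.\<close>

definition weight_conditions :: "real measure \<Rightarrow> (nat \<Rightarrow> nat \<Rightarrow> real) \<Rightarrow> bool" where
  "weight_conditions \<mu> w \<longleftrightarrow>
     real_distribution \<mu> \<and> (AE x in \<mu>. 0 < x) \<and>
     weak_conv_m (\<lambda>n. distr (uniform_count_measure {1..n}) borel (w n)) \<mu> \<and>
     integrable \<mu> (\<lambda>x. x ^ 3) \<and>
     (\<integral>x. x ^ 2 \<partial>\<mu>) = (\<integral>x. x \<partial>\<mu>) \<and>
     (\<lambda>n. total_weight w n - (\<integral>x. x \<partial>\<mu>) * real n) \<in> o(\<lambda>n. real n powr (2/3)) \<and>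
     (\<lambda>n. (\<Sum>k=1..n. w n k ^ 2) - (\<integral>x. x ^ 2 \<partial>\<mu>) * real n) \<in> o(\<lambda>n. real n powr (2/3)) \<and>
     (\<lambda>n. (\<Sum>k=1..n. w n k ^ 3) - (\<integral>x. x ^ 3 \<partial>\<mu>) * real n) \<in> o(\<lambda>n. 1) \<and>
     (\<lambda>n. Max (w n ` {1..n})) \<in> o(\<lambda>n. real n powr (1/3))"

definition edge_parameter :: "(nat \<Rightarrow> nat \<Rightarrow> real) \<Rightarrow> (nat \<Rightarrow> real) \<Rightarrow> nat \<Rightarrow> real" where
  "edge_parameter w f n = (total_weight w n powr (1/3) + f n) / total_weight w n powr (4/3)"

end

(*
  Put x = l^(1/3), where l is the total weight, so that p = (x + f) / x^4. Explore the component of a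
  set A of vertices one vertex at a time: revealing the edges between v in A and the other vertices
  replaces A by A - {v} together with the set B of new neighbours of v, and adds |B inter (A - {v})| to
  the surplus. Hence every bound "the expectation of a function of the reached weight t and the surplus X
  is at most phi(weight of A)" follows by induction on the vertex set from a one-step inequality for phi.
  Four such potentials are used.

  - An exponential moment of t shows that P(t >= B f x^2) <= exp (w(A) / x - 4 f^2), and one of X on the
    event t <= B f x^2 shows that a surplus of order f^3 has a probability of the same order. This settles
    the case n <= exp (f^2) by a union bound, and components of weight at least x^2 exp (-f) by
    starting from a random set A that hits each of them with probability of order exp (-f).
  - For lighter components a surplus of at least 2 is already unlikely: the factorial moments
    E[X exp (-eta t)] and E[X (X - 1) exp (-eta t)] are bounded by potentials containing
    1 - exp (-theta w(A)) with eta = c theta^2 / 8, which is a supersolution of the exploration with a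
    gain of 1 - exp (-eta w(v)) in every step.
*)

theory Submission
  imports Defs "HOL-Real_Asymp.Real_Asymp"
begin

section \<open>Random subsets with independent inclusions\<close>

text \<open>The obstacle is uniformity in n: f may stay bounded while n grows, so a union bound over
  vertices, which costs a factor n against exp (- 4 f^2), is affordable only for n <= exp (f^2). For
  light components the first factorial moment would not do either: at each dyadic scale of weights
  its bound contributes a quantity of order 1, with no decay. The second one contributes (theta
  x)^(-3), which sums geometrically; this is why surplus at least 2 is the threshold there. The
  graph is slightly supercritical, so the active weight grows by a relative \<epsilon> of order f /
  x per unit of explored weight and a linear potential is no supersolution. The concavity of 1 - exp
  (- theta w) supplies a loss of order c theta^2, which beats the growth \<epsilon> theta once theta
  is at least 8 \<epsilon> / c. Here c is a truncated third moment, since the quadratic gain in 1 -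
  exp (- theta w) is available only up to w of order 1. The same loss, as depletion of unexplored
  vertices, limits the reached weight to B f x^2. All components are treated together, and weights
  replace vertex counts throughout; ties and the size ordering are then covered
  automatically.\<close>

definition subset_mean :: "('a \<Rightarrow> real) \<Rightarrow> 'a set \<Rightarrow> ('a set \<Rightarrow> real) \<Rightarrow> real" where
  "subset_mean r P h = (\<Sum>S\<in>Pow P. (\<Prod>e\<in>S. r e) * (\<Prod>e\<in>P - S. 1 - r e) * h S)"

lemma subset_mean_empty [simp]: "subset_mean r {} h = h {}"
  by (simp add: subset_mean_def)

lemma subset_mean_insert:
  assumes "finite P" "e \<notin> P"
  shows "subset_mean r (insert e P) h =
    r e * subset_mean r P (\<lambda>S. h (insert e S)) + (1 - r e) * subset_mean r P h"
proof -
  let ?g = "\<lambda>Q S. (\<Prod>e\<in>S. r e) * (\<Prod>e\<in>Q - S. 1 - r e) * h S"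
  have inj: "inj_on (insert e) (Pow P)"
    using assms by (auto simp: inj_on_def)
  have disj: "Pow P \<inter> insert e ` Pow P = {}"
    using assms by auto
  have 1: "?g (insert e P) S = (1 - r e) * ?g P S" if "S \<in> Pow P" for S
  proof -
    have "insert e P - S = insert e (P - S)" "e \<notin> P - S"
      using that assms by auto
    then show ?thesis using assms by simp
  qed
  have 2: "?g (insert e P) (insert e S) =
      r e * ((\<Prod>e\<in>S. r e) * (\<Prod>e\<in>P - S. 1 - r e) * h (insert e S))" if "S \<in> Pow P" for S
  proof -
    have "insert e P - insert e S = P - S" "e \<notin> S" "finite S"
      using that assms by (auto intro: finite_subset)
    then show ?thesis by simp
  qed
  have "subset_mean r (insert e P) h =
      (\<Sum>S\<in>Pow P. ?g (insert e P) S) + (\<Sum>S\<in>insert e ` Pow P. ?g (insert e P) S)"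
    unfolding subset_mean_def Pow_insert
    by (rule sum.union_disjoint) (use assms disj in auto)
  also have "(\<Sum>S\<in>insert e ` Pow P. ?g (insert e P) S) = (\<Sum>S\<in>Pow P. ?g (insert e P) (insert e S))"
    by (subst sum.reindex[OF inj]) simp
  also have "(\<Sum>S\<in>Pow P. ?g (insert e P) S) = (1 - r e) * subset_mean r P h"
    unfolding subset_mean_def sum_distrib_left by (rule sum.cong[OF refl 1])
  also have "(\<Sum>S\<in>Pow P. ?g (insert e P) (insert e S)) = r e * subset_mean r P (\<lambda>S. h (insert e S))"
    unfolding subset_mean_def sum_distrib_left by (rule sum.cong[OF refl 2])
  finally show ?thesis by simp
qed

lemma subset_mean_cong:
  assumes "\<And>S. S \<subseteq> P \<Longrightarrow> h S = h' S"
  shows "subset_mean r P h = subset_mean r P h'"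
  unfolding subset_mean_def by (rule sum.cong) (use assms in auto)

lemma subset_mean_mono:
  assumes "\<And>e. e \<in> P \<Longrightarrow> 0 \<le> r e \<and> r e \<le> 1" "\<And>S. S \<subseteq> P \<Longrightarrow> h S \<le> h' S"
  shows "subset_mean r P h \<le> subset_mean r P h'"
  unfolding subset_mean_def
  by (intro sum_mono mult_left_mono mult_nonneg_nonneg prod_nonneg) (use assms in auto)

lemma subset_mean_add:
  "subset_mean r P (\<lambda>S. h S + h' S) = subset_mean r P h + subset_mean r P h'"
  by (simp add: subset_mean_def sum.distrib algebra_simps)

lemma subset_mean_cmult:
  "subset_mean r P (\<lambda>S. c * h S) = c * subset_mean r P h"
  by (simp add: subset_mean_def sum_distrib_left algebra_simps)

lemma subset_mean_multc:
  "subset_mean r P (\<lambda>S. h S * c) = subset_mean r P h * c"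
  by (simp add: subset_mean_def sum_distrib_left algebra_simps)

lemma subset_mean_sum:
  "subset_mean r P (\<lambda>S. \<Sum>i\<in>I. h i S) = (\<Sum>i\<in>I. subset_mean r P (h i))"
  unfolding subset_mean_def by (subst sum.swap) (simp add: sum_distrib_left)

lemma subset_mean_const [simp]:
  assumes "finite P"
  shows "subset_mean r P (\<lambda>S. c) = c"
  using assms by (induction P) (simp_all add: subset_mean_insert algebra_simps)

lemma subset_mean_nonneg:
  assumes "\<And>e. e \<in> P \<Longrightarrow> 0 \<le> r e \<and> r e \<le> 1" "\<And>S. S \<subseteq> P \<Longrightarrow> 0 \<le> h S"
  shows "0 \<le> subset_mean r P h"
  unfolding subset_mean_def
  by (intro sum_nonneg mult_nonneg_nonneg prod_nonneg) (use assms in auto)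

lemma subset_mean_swap:
  "subset_mean r P (\<lambda>S. subset_mean q Q (\<lambda>T. h S T)) = subset_mean q Q (\<lambda>T. subset_mean r P (\<lambda>S. h S T))"
  unfolding subset_mean_def
  by (simp add: sum_distrib_left sum.swap[of _ "Pow P" "Pow Q"] mult_ac)

lemma subset_mean_union:
  assumes "finite P" "finite Q" "P \<inter> Q = {}"
  shows "subset_mean r (P \<union> Q) h = subset_mean r P (\<lambda>S. subset_mean r Q (\<lambda>T. h (S \<union> T)))"
  using assms
proof (induction P arbitrary: h)
  case (insert e P)
  then have "subset_mean r (insert e (P \<union> Q)) h =
      r e * subset_mean r (P \<union> Q) (\<lambda>S. h (insert e S)) + (1 - r e) * subset_mean r (P \<union> Q) h"
    by (intro subset_mean_insert) auto
  with insert show ?case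
    by (simp add: subset_mean_insert)
qed simp

lemma subset_mean_image:
  assumes "finite P" "inj_on f P"
  shows "subset_mean r (f ` P) h = subset_mean (\<lambda>x. r (f x)) P (\<lambda>S. h (f ` S))"
  using assms
proof (induction P arbitrary: h)
  case (insert e P)
  then have "f e \<notin> f ` P" "inj_on f P" by auto
  with insert show ?case by (simp add: subset_mean_insert)
qed simp

lemma subset_mean_prod:
  assumes "finite P"
  shows "subset_mean r P (\<lambda>S. \<Prod>e\<in>P. if e \<in> S then \<alpha> e else \<beta> e) =
    (\<Prod>e\<in>P. r e * \<alpha> e + (1 - r e) * \<beta> e)"
  using assms
proof (induction P)
  case (insert e P)
  have "subset_mean r P (\<lambda>S. \<Prod>x\<in>insert e P. if x \<in> insert e S then \<alpha> x else \<beta> x) =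
      subset_mean r P (\<lambda>S. \<alpha> e * (\<Prod>x\<in>P. if x \<in> S then \<alpha> x else \<beta> x))"
    by (rule subset_mean_cong) (use insert in \<open>auto intro!: prod.cong\<close>)
  moreover have "subset_mean r P (\<lambda>S. \<Prod>x\<in>insert e P. if x \<in> S then \<alpha> x else \<beta> x) =
      subset_mean r P (\<lambda>S. \<beta> e * (\<Prod>x\<in>P. if x \<in> S then \<alpha> x else \<beta> x))"
    by (rule subset_mean_cong) (use insert in \<open>auto intro!: prod.cong\<close>)
  ultimately show ?case
    unfolding subset_mean_insert[OF insert.hyps] subset_mean_cmult insert.IH
    using insert.hyps by (simp add: algebra_simps)
qed simp

lemma subset_mean_linear:
  assumes "finite P"
  shows "subset_mean r P (\<lambda>S. \<Sum>e\<in>S. g e) = (\<Sum>e\<in>P. r e * g e)"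
  using assms
proof (induction P)
  case (insert e P)
  have "subset_mean r P (\<lambda>S. \<Sum>x\<in>insert e S. g x) = subset_mean r P (\<lambda>S. g e + (\<Sum>x\<in>S. g x))"
    by (rule subset_mean_cong) (use insert in \<open>auto dest: finite_subset intro!: sum.insert\<close>)
  with insert show ?case
    by (simp add: subset_mean_insert subset_mean_add algebra_simps)
qed simp

lemma subset_mean_square:
  assumes "finite P"
  shows "subset_mean r P (\<lambda>S. (\<Sum>e\<in>S. g e)\<^sup>2) =
    (\<Sum>e\<in>P. r e * g e)\<^sup>2 + (\<Sum>e\<in>P. r e * (1 - r e) * (g e)\<^sup>2)"
  using assms
proof (induction P)
  case (insert e P)
  have "subset_mean r P (\<lambda>S. (\<Sum>x\<in>insert e S. g x)\<^sup>2) =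
      subset_mean r P (\<lambda>S. (g e)\<^sup>2 + (2 * g e * (\<Sum>x\<in>S. g x) + (\<Sum>x\<in>S. g x)\<^sup>2))"
  proof (rule subset_mean_cong)
    fix S assume "S \<subseteq> P"
    then have "(\<Sum>x\<in>insert e S. g x) = g e + (\<Sum>x\<in>S. g x)"
      using insert by (intro sum.insert) (auto dest: finite_subset)
    then show "(\<Sum>x\<in>insert e S. g x)\<^sup>2 = (g e)\<^sup>2 + (2 * g e * (\<Sum>x\<in>S. g x) + (\<Sum>x\<in>S. g x)\<^sup>2)"
      by (simp add: power2_sum)
  qed
  also have "\<dots> = (g e)\<^sup>2 + (2 * g e * (\<Sum>x\<in>P. r x * g x) + subset_mean r P (\<lambda>S. (\<Sum>x\<in>S. g x)\<^sup>2))"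
    using insert by (simp add: subset_mean_add subset_mean_cmult subset_mean_linear)
  finally show ?case
    using insert by (simp add: subset_mean_insert algebra_simps power2_eq_square)
qed simp

text \<open>Bridge from the measure-theoretic model to finite sums: all later expectations are
  \<open>subset_mean\<close>, so integrability and measurability never arise. The induction reveals
  the status of one element at a time.\<close>

lemma prob_random_subset:
  assumes "finite P" "\<And>e. e \<in> P \<Longrightarrow> 0 \<le> r e \<and> r e \<le> 1"
  shows "measure_pmf.prob (map_pmf (\<lambda>b. {e \<in> P. b e}) (Pi_pmf P False (\<lambda>e. bernoulli_pmf (r e)))) A =
    subset_mean r P (indicator A)"
proof -
  let ?M = "\<lambda>P. map_pmf (\<lambda>b. {e \<in> P. b e}) (Pi_pmf P False (\<lambda>e. bernoulli_pmf (r e)))"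
  have "emeasure (?M P) A = ennreal (subset_mean r P (indicator A))"
    using assms
  proof (induction P arbitrary: A)
    case empty
    show ?case by (simp add: indicator_def)
  next
    case (insert e P)
    have "?M (insert e P) = bind_pmf (bernoulli_pmf (r e)) (\<lambda>c.
        map_pmf (\<lambda>b. {x \<in> insert e P. (b(e := c)) x}) (Pi_pmf P False (\<lambda>e. bernoulli_pmf (r e))))"
      using insert by (simp add: Pi_pmf_insert' map_bind_pmf map_pmf_def bind_assoc_pmf bind_return_pmf)
    also have "\<dots> = bind_pmf (bernoulli_pmf (r e)) (\<lambda>c. map_pmf (\<lambda>S. if c then insert e S else S) (?M P))"
      unfolding map_pmf_comp
      by (intro bind_pmf_cong refl map_pmf_cong) (use insert.hyps in auto)
    finally have eq: "?M (insert e P) = \<dots>" .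
    have r: "0 \<le> r e" "r e \<le> 1" "\<And>e. e \<in> P \<Longrightarrow> 0 \<le> r e \<and> r e \<le> 1"
      using insert.prems by auto
    have IH: "emeasure (?M P) A = ennreal (subset_mean r P (indicator A))" for A
      using insert.IH r(3) by blast
    have "emeasure (?M (insert e P)) A =
       emeasure (?M P) {S. insert e S \<in> A} * ennreal (r e) + emeasure (?M P) A * ennreal (1 - r e)"
      unfolding eq emeasure_bind_pmf
      by (subst nn_integral_bernoulli_pmf) (use r in \<open>auto simp: vimage_def\<close>)
    also have "\<dots> = ennreal (subset_mean r P (indicator {S. insert e S \<in> A}) * r e
        + subset_mean r P (indicator A) * (1 - r e))"
      unfolding IH using r subset_mean_nonneg[of P r "indicator A"]
        subset_mean_nonneg[of P r "indicator {S. insert e S \<in> A}"]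
      by (subst (1 2) ennreal_mult'[symmetric]) (auto simp: ennreal_plus)
    also have "subset_mean r P (indicator {S. insert e S \<in> A}) = subset_mean r P (\<lambda>S. indicator A (insert e S))"
      by (rule subset_mean_cong) (simp add: indicator_def)
    also have "subset_mean r P (\<lambda>S. indicator A (insert e S)) * r e + subset_mean r P (indicator A) * (1 - r e) =
        subset_mean r (insert e P) (indicator A)"
      using insert.hyps by (simp add: subset_mean_insert mult.commute)
    finally show ?case .
  qed
  then show ?thesis
    using subset_mean_nonneg[of P r "indicator A"] assms(2)
    by (simp add: measure_pmf.emeasure_eq_measure)
qed

section \<open>Reachability, surplus and excess\<close>

definition pairs :: "'v set \<Rightarrow> 'v set set" where
  "pairs V = {e. e \<subseteq> V \<and> card e = 2}"

definition star :: "'v \<Rightarrow> 'v set \<Rightarrow> 'v set set" where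
  "star v B = (\<lambda>u. {v, u}) ` B"

definition reach :: "'v set set \<Rightarrow> 'v set \<Rightarrow> 'v set" where
  "reach E A = (adjacency E)\<^sup>* `` A"

text \<open>Cyclomatic number of the reached subgraph after contracting \<open>A\<close> to a point:
  edges inside \<open>A\<close> count in full, and for a single vertex it is edges minus vertices
  plus one. Allowing sets makes it additive along the exploration. It is an \<open>int\<close> so
  that its sign is a theorem and not an effect of truncated subtraction.\<close>

definition surplus :: "'v set set \<Rightarrow> 'v set \<Rightarrow> int" where
  "surplus E A = int (card (induced_edges E (reach E A))) - int (card (reach E A - A))"

lemma finite_pairs: "finite V \<Longrightarrow> finite (pairs V)"
  by (simp add: pairs_def)

lemma sym_adjacency: "sym (adjacency E)"
  by (auto simp: adjacency_def sym_def insert_commute)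

lemma reach_refl: "A \<subseteq> reach E A"
  by (auto simp: reach_def)

lemma reach_step:
  assumes "x \<in> reach E A" "x \<noteq> y" "{x, y} \<in> E"
  shows "y \<in> reach E A"
proof -
  from assms(1) obtain a where a: "a \<in> A" "(a, x) \<in> (adjacency E)\<^sup>*"
    by (auto simp: reach_def)
  have "(x, y) \<in> adjacency E" using assms by (simp add: adjacency_def)
  with a show ?thesis unfolding reach_def by (meson ImageI rtrancl.rtrancl_into_rtrancl)
qed

lemma reach_least:
  assumes "A \<subseteq> R" "\<And>x y. x \<in> R \<Longrightarrow> x \<noteq> y \<Longrightarrow> {x, y} \<in> E \<Longrightarrow> y \<in> R"
  shows "reach E A \<subseteq> R"
proof
  fix y assume "y \<in> reach E A"
  then obtain a where "a \<in> A" "(a, y) \<in> (adjacency E)\<^sup>*" by (auto simp: reach_def)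
  from this(2,1) show "y \<in> R"
    by (induction rule: rtrancl_induct) (use assms in \<open>auto simp: adjacency_def\<close>)
qed

lemma reach_subset:
  assumes "E \<subseteq> pairs V" "A \<subseteq> V"
  shows "reach E A \<subseteq> V"
  by (rule reach_least) (use assms in \<open>auto simp: pairs_def\<close>)

lemma reach_empty [simp]: "reach E {} = {}"
  by (simp add: reach_def)

lemma surplus_empty [simp]: "E \<subseteq> pairs V \<Longrightarrow> surplus E {} = 0"
  by (auto simp: surplus_def induced_edges_def pairs_def)

text \<open>An edge from \<open>v\<close> to a vertex outside \<open>A\<close> is balanced by that
  vertex moving into the new starting set, so it changes nothing. An edge to another vertex of
  \<open>A\<close> discovers nothing and is a surplus edge.\<close>

lemma
  assumes V: "finite V" and A: "A \<subseteq> V" "v \<in> A"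
    and E0: "E0 \<subseteq> pairs (V - {v})" and B: "B \<subseteq> V - {v}"
  shows reach_explore:
      "reach (E0 \<union> star v B) A = insert v (reach E0 (A - {v} \<union> B))"
    and surplus_explore:
      "surplus (E0 \<union> star v B) A = int (card (B \<inter> (A - {v}))) + surplus E0 (A - {v} \<union> B)"
proof -
  let ?E = "E0 \<union> star v B" and ?A0 = "A - {v}"
  let ?R0 = "reach E0 (?A0 \<union> B)"
  have R0: "?R0 \<subseteq> V - {v}"
    by (rule reach_subset[OF E0]) (use A B in auto)
  have sub: "?A0 \<union> B \<subseteq> ?R0" by (rule reach_refl)
  have v: "v \<notin> e" if "e \<in> E0" for e using that E0 by (auto simp: pairs_def)
  show r: "reach ?E A = insert v ?R0"
  proof
    show "reach ?E A \<subseteq> insert v ?R0"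
    proof (rule reach_least)
      show "A \<subseteq> insert v ?R0" using sub by auto
    next
      fix x y assume xy: "x \<in> insert v ?R0" "x \<noteq> y" "{x, y} \<in> ?E"
      show "y \<in> insert v ?R0"
      proof (cases "{x, y} \<in> E0")
        case True
        with v[OF True] xy show ?thesis by (auto intro: reach_step)
      next
        case False
        with xy sub show ?thesis by (auto simp: star_def doubleton_eq_iff)
      qed
    qed
    have "v \<in> reach ?E A" using A reach_refl[of A ?E] by auto
    moreover have "?R0 \<subseteq> reach ?E A"
    proof (rule reach_least)
      show "?A0 \<union> B \<subseteq> reach ?E A"
      proof
        fix b assume "b \<in> ?A0 \<union> B"
        then show "b \<in> reach ?E A"
          using reach_refl[of A ?E] reach_step[OF \<open>v \<in> reach ?E A\<close>, of b] B
          by (auto simp: star_def)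
      qed
    qed (auto intro: reach_step)
    ultimately show "insert v ?R0 \<subseteq> reach ?E A" by simp
  qed
  have fin: "finite ?R0" "finite E0" "finite B"
    using V R0 E0 B finite_pairs[of "V - {v}"] by (auto dest: finite_subset)
  have "induced_edges ?E (insert v ?R0) = induced_edges E0 ?R0 \<union> star v B"
  proof -
    have "e \<subseteq> insert v ?R0 \<longleftrightarrow> e \<subseteq> ?R0" if "e \<in> E0" for e using v[OF that] by blast
    moreover have "e \<subseteq> insert v ?R0" if "e \<in> star v B" for e
      using that sub unfolding star_def by blast
    ultimately show ?thesis unfolding induced_edges_def by blast
  qed
  moreover have "induced_edges E0 ?R0 \<inter> star v B = {}"
    using v by (auto simp: induced_edges_def star_def)
  moreover have "card (star v B) = card B"
    unfolding star_def by (rule card_image) (auto simp: inj_on_def doubleton_eq_iff)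
  moreover have "finite (induced_edges E0 ?R0)" "finite (star v B)"
    using fin by (auto simp: induced_edges_def star_def)
  ultimately have e: "card (induced_edges ?E (insert v ?R0)) = card (induced_edges E0 ?R0) + card B"
    by (simp add: card_Un_disjoint)
  have "insert v ?R0 - A = (?R0 - (?A0 \<union> B)) \<union> (B - ?A0)"
    using A R0 sub by auto
  moreover have "card \<dots> = card (?R0 - (?A0 \<union> B)) + card (B - ?A0)"
    by (rule card_Un_disjoint) (use fin in auto)
  moreover have "card B = card (B \<inter> ?A0) + card (B - ?A0)"
    using fin by (metis card_Int_Diff)
  ultimately show "surplus ?E A = int (card (B \<inter> ?A0)) + surplus E0 (?A0 \<union> B)"
    unfolding surplus_def r e by simp
qed

lemma pairs_decompose:
  assumes "E \<subseteq> pairs V" "v \<in> V"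
  obtains E0 B where "E0 \<subseteq> pairs (V - {v})" "B \<subseteq> V - {v}" "E = E0 \<union> star v B"
proof
  let ?E0 = "{e \<in> E. v \<notin> e}" and ?B = "{u \<in> V - {v}. {v, u} \<in> E}"
  show "?E0 \<subseteq> pairs (V - {v})" using assms by (auto simp: pairs_def)
  show "?B \<subseteq> V - {v}" by auto
  have "e \<in> star v ?B" if e: "e \<in> E" "v \<in> e" for e
  proof -
    have "card e = 2" "e \<subseteq> V" using e assms by (auto simp: pairs_def)
    then obtain a b where "e = {a, b}" "a \<noteq> b" by (auto simp: card_2_iff)
    then obtain u where u: "e = {v, u}" "u \<noteq> v" using e by auto
    with e \<open>e \<subseteq> V\<close> show ?thesis by (auto simp: star_def)
  qed
  then show "E = ?E0 \<union> star v ?B" by (auto simp: star_def)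
qed

text \<open>Each exploration step adds a cardinality, and the surplus of the empty set is 0. For a
  connected edge set this says that there are at least as many edges as vertices minus one.\<close>

lemma surplus_nonneg:
  assumes "finite V" "E \<subseteq> pairs V" "A \<subseteq> V"
  shows "0 \<le> surplus E A"
  using assms
proof (induction V arbitrary: E A rule: finite_psubset_induct)
  case (psubset V)
  show ?case
  proof (cases "A = {}")
    case True
    with psubset.prems show ?thesis by simp
  next
    case False
    then obtain v where v: "v \<in> A" by auto
    then have "v \<in> V" using psubset.prems by auto
    then obtain E0 B
      where EB: "E0 \<subseteq> pairs (V - {v})" "B \<subseteq> V - {v}" "E = E0 \<union> star v B"
      by (rule pairs_decompose[OF psubset.prems(1)])
    have "0 \<le> surplus E0 (A - {v} \<union> B)"
      by (rule psubset.IH[of "V - {v}"]) (use v psubset.prems EB in auto)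
    with surplus_explore[OF psubset.hyps(1) psubset.prems(2) v EB(1,2)] EB(3)
    show ?thesis by simp
  qed
qed

text \<open>Both explorations can start at the same \<open>v\<close> in \<open>A\<close>; the larger
  set meets at least as many collisions in each step. This lets a random set that hits a component
  inherit the surplus of that component.\<close>

lemma surplus_mono:
  assumes "finite V" "E \<subseteq> pairs V" "A \<subseteq> A'" "A' \<subseteq> V"
  shows "surplus E A \<le> surplus E A'"
  using assms
proof (induction V arbitrary: E A A' rule: finite_psubset_induct)
  case (psubset V)
  show ?case
  proof (cases "A = {}")
    case True
    with psubset surplus_nonneg[of V E A'] show ?thesis by simp
  next
    case False
    then obtain v where v: "v \<in> A" by auto
    then have "v \<in> V" using psubset.prems by auto
    then obtain E0 B
      where EB: "E0 \<subseteq> pairs (V - {v})" "B \<subseteq> V - {v}" "E = E0 \<union> star v B"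
      by (rule pairs_decompose[OF psubset.prems(1)])
    have "surplus E0 (A - {v} \<union> B) \<le> surplus E0 (A' - {v} \<union> B)"
      by (rule psubset.IH[of "V - {v}"]) (use v psubset.prems EB in auto)
    moreover have "card (B \<inter> (A - {v})) \<le> card (B \<inter> (A' - {v}))"
      by (rule card_mono) (use psubset.prems EB psubset.hyps(1) in \<open>auto dest: finite_subset\<close>)
    moreover have "A \<subseteq> V" "v \<in> A'" using psubset.prems v by auto
    ultimately show ?thesis
      using surplus_explore[OF psubset.hyps(1) \<open>A \<subseteq> V\<close> v EB(1,2)]
        surplus_explore[OF psubset.hyps(1) psubset.prems(3) \<open>v \<in> A'\<close> EB(1,2)] EB(3)
      by simp
  qed
qed

section \<open>Excess of a component against the surplus seen from its vertices\<close>

lemma component_eq_reach: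
  assumes "E \<subseteq> pairs V" "C \<in> graph_components V E" "i \<in> C"
  shows "C = reach E {i}" "C \<subseteq> V"
proof -
  have symr: "sym ((adjacency E)\<^sup>*)" by (rule sym_rtrancl[OF sym_adjacency])
  obtain x where x: "x \<in> V" "C = {v \<in> V. (x, v) \<in> (adjacency E)\<^sup>*}"
    using assms(2) by (auto simp: graph_components_def quotient_def)
  then show "C \<subseteq> V" by auto
  have xi: "(x, i) \<in> (adjacency E)\<^sup>*" "i \<in> V" using x assms by auto
  have "reach E {i} \<subseteq> V" by (rule reach_subset[OF assms(1)]) (use xi in auto)
  then show "C = reach E {i}"
    using xi x symr unfolding reach_def
    by (auto dest: symD intro: rtrancl_trans)
qed

lemma connected_component:
  assumes "E \<subseteq> pairs V" "C \<in> graph_components V E" "i \<in> C"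
  shows "connected_graph C (induced_edges E C)"
proof -
  let ?F = "induced_edges E C"
  have C: "C = reach E {i}" by (rule component_eq_reach[OF assms])
  have i: "(i, u) \<in> (adjacency ?F)\<^sup>*" if "u \<in> C" for u
  proof -
    have "(i, u) \<in> (adjacency E)\<^sup>*" using that by (simp add: C reach_def)
    then show ?thesis
    proof (induction rule: rtrancl_induct)
      case (step y z)
      then have "y \<in> C" "z \<in> C" by (auto simp: C reach_def intro: rtrancl.rtrancl_into_rtrancl)
      with step have "(y, z) \<in> adjacency ?F" by (auto simp: adjacency_def induced_edges_def)
      with step show ?case by auto
    qed simp
  qed
  have "sym ((adjacency ?F)\<^sup>*)" by (rule sym_rtrancl[OF sym_adjacency])
  with i assms(3) show ?thesis
    unfolding connected_graph_def by (blast dest: symD intro: rtrancl_trans)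
qed

text \<open>The closing edge of the cycle can go, since the rest of the cycle still joins its two
  ends.\<close>

lemma connected_remove_cycle_edge:
  assumes "connected_graph C T" "is_cycle T xs"
  shows "\<exists>e\<in>T. connected_graph C (T - {e})"
proof
  define L where "L = length xs"
  have L: "3 \<le> L" "distinct xs" and xs: "\<And>i. i < L \<Longrightarrow> {xs ! i, xs ! (Suc i mod L)} \<in> T"
    using assms(2) by (auto simp: is_cycle_def L_def)
  define e where "e = {xs ! (L - 1), xs ! 0}"
  show "{xs ! (L - 1), xs ! 0} \<in> T" using xs[of "L - 1"] L by simp
  have inj: "xs ! i = xs ! j \<longleftrightarrow> i = j" if "i < L" "j < L" for i j
    using that L by (simp add: L_def nth_eq_iff_index_eq)
  let ?r = "(adjacency (T - {e}))\<^sup>*"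
  have sym: "sym ?r" by (rule sym_rtrancl[OF sym_adjacency])
  have path: "(xs ! 0, xs ! i) \<in> ?r" if "i < L" for i
    using that
  proof (induction i)
    case (Suc i)
    have "{xs ! i, xs ! Suc i} \<in> T" using xs[of i] Suc.prems by simp
    moreover have "{xs ! i, xs ! Suc i} \<noteq> e"
      using Suc.prems L by (auto simp: e_def doubleton_eq_iff inj)
    ultimately have "(xs ! i, xs ! Suc i) \<in> adjacency (T - {e})"
      using Suc.prems by (simp add: adjacency_def inj)
    with Suc show ?case by (meson Suc_lessD rtrancl.rtrancl_into_rtrancl)
  qed simp
  have "adjacency T \<subseteq> ?r"
  proof clarify
    fix u v assume uv: "(u, v) \<in> adjacency T"
    show "(u, v) \<in> ?r"
    proof (cases "{u, v} = e")
      case True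
      moreover have "(xs ! 0, xs ! (L - 1)) \<in> ?r" using path L by simp
      ultimately show ?thesis using sym by (auto simp: e_def doubleton_eq_iff dest: symD)
    next
      case False
      with uv show ?thesis by (auto simp: adjacency_def)
    qed
  qed
  then have "(adjacency T)\<^sup>* \<subseteq> ?r" by (simp add: rtrancl_subset_rtrancl)
  with assms(1) show "connected_graph C (T - {{xs ! (L - 1), xs ! 0}})"
    unfolding connected_graph_def e_def by blast
qed

text \<open>A connected edge set of least cardinality has no cycle, hence is a tree, and the edges
  outside it witness the excess. Its number of edges is bounded below by
  \<open>surplus_nonneg\<close>, which takes the place of the edge count for trees.\<close>

lemma excess_le_surplus:
  assumes "finite V" "E \<subseteq> pairs V" "C \<in> graph_components V E" "i \<in> C"
  shows "int (excess E C) \<le> surplus E {i}"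
proof -
  have C: "C = reach E {i}" "C \<subseteq> V" using component_eq_reach[OF assms(2-4)] by auto
  let ?F = "induced_edges E C"
  have fin: "finite ?F" "finite C"
    using assms finite_pairs[of V] C(2) by (auto simp: induced_edges_def dest: finite_subset)
  have "\<exists>T. is_arg_min card (\<lambda>T. T \<subseteq> ?F \<and> connected_graph C T) T"
    using connected_component[OF assms(2-4)]
    by (intro ex_is_arg_min_if_finite[where S = "{T. T \<subseteq> ?F \<and> connected_graph C T}", simplified])
      (use fin in auto)
  then obtain T where T: "T \<subseteq> ?F" "connected_graph C T"
    and min: "\<And>T'. T' \<subseteq> ?F \<Longrightarrow> connected_graph C T' \<Longrightarrow> card T \<le> card T'"
    by (auto simp: is_arg_min_linorder)
  have finT: "finite T" using T fin by (auto dest: finite_subset)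
  have "is_tree C T"
    unfolding is_tree_def
  proof (intro conjI notI T)
    assume "\<exists>xs. is_cycle T xs"
    then obtain e where e: "e \<in> T" "connected_graph C (T - {e})"
      using connected_remove_cycle_edge[OF T(2)] by blast
    then have "card T \<le> card (T - {e})" using T by (intro min) auto
    with e finT show False by (metis card_Diff1_less linorder_not_le)
  qed
  moreover have TC: "T \<subseteq> pairs C" using T assms(2) by (auto simp: induced_edges_def pairs_def)
  have "reach T {i} = C"
  proof
    show "reach T {i} \<subseteq> C" by (rule reach_subset[OF TC]) (use assms in auto)
    show "C \<subseteq> reach T {i}" using T(2) assms(4) by (auto simp: connected_graph_def reach_def)
  qed
  moreover have "induced_edges T C = T" using TC by (auto simp: induced_edges_def pairs_def)
  moreover have "0 \<le> surplus T {i}"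
    by (rule surplus_nonneg[OF fin(2) TC]) (use assms in auto)
  ultimately have "int (card (C - {i})) \<le> int (card T)" and tree: "is_tree C T"
    by (auto simp: surplus_def)
  moreover have "excess E C \<le> card (?F - T)"
    unfolding excess_def
    by (rule Least_le) (use tree T in \<open>auto intro!: exI[of _ "?F - T"] simp: double_diff\<close>)
  moreover have "card (?F - T) = card ?F - card T" "card T \<le> card ?F"
    using T fin finT by (auto simp: card_Diff_subset card_mono)
  ultimately show ?thesis
    unfolding surplus_def C(1)[symmetric] by linarith
qed

text \<open>The maximum runs over a finite nonempty set, so it is attained. The tail bound is later
  proved for the existence of any component of large excess.\<close>

lemma largest_component_excess_ge:
  assumes "1 \<le> n" "m \<le> real (largest_component_excess n E)"
  shows "\<exists>C \<in> graph_components {1..n} E. m \<le> real (excess E C)"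
proof -
  let ?G = "graph_components {1..n} E"
  have "finite ?G"
    unfolding graph_components_def quotient_def by simp
  moreover have "?G \<noteq> {}" using assms(1) by (auto simp: graph_components_def quotient_def)
  ultimately have "Max (card ` ?G) \<in> card ` ?G" "\<forall>D\<in>?G. card D \<le> Max (card ` ?G)"
    by auto
  then obtain C where "C \<in> ?G" "\<forall>D\<in>?G. card D \<le> card C" by auto
  then have "largest_components n E \<noteq> {}" "finite (largest_components n E)"
    using \<open>finite ?G\<close> by (auto simp: largest_components_def)
  then have "largest_component_excess n E \<in> excess E ` largest_components n E"
    unfolding largest_component_excess_def by (intro Max_in) auto
  with assms(2) show ?thesis by (auto simp: largest_components_def)
qed

section \<open>Exploration of the random graph\<close>

definition graph_mean :: "('v \<Rightarrow> real) \<Rightarrow> real \<Rightarrow> 'v set \<Rightarrow> ('v set set \<Rightarrow> real) \<Rightarrow> real" where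
  "graph_mean w p V h = subset_mean (\<lambda>e. 1 - exp (- ((\<Prod>i\<in>e. w i) * p))) (pairs V) h"

lemma pairs_split:
  assumes "v \<in> V"
  shows "pairs V = pairs (V - {v}) \<union> star v (V - {v})" "pairs (V - {v}) \<inter> star v (V - {v}) = {}"
proof -
  have "star v (V - {v}) \<subseteq> pairs V" "pairs (V - {v}) \<subseteq> pairs V"
    using assms by (auto simp: star_def pairs_def)
  moreover have "pairs V \<subseteq> pairs (V - {v}) \<union> star v (V - {v})"
  proof -
    obtain E0 B where "E0 \<subseteq> pairs (V - {v})" "B \<subseteq> V - {v}" "pairs V = E0 \<union> star v B"
      by (rule pairs_decompose[OF subset_refl assms])
    moreover from this(2) have "star v B \<subseteq> star v (V - {v})" by (auto simp: star_def)
    ultimately show ?thesis by blast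
  qed
  ultimately show "pairs V = pairs (V - {v}) \<union> star v (V - {v})" by blast
  show "pairs (V - {v}) \<inter> star v (V - {v}) = {}" by (auto simp: pairs_def star_def)
qed

lemma subset_mean_cong_prob:
  assumes "\<And>e. e \<in> P \<Longrightarrow> r e = r' e"
  shows "subset_mean r P h = subset_mean r' P h"
  unfolding subset_mean_def
  by (intro sum.cong refl arg_cong2[where f = "(*)"] prod.cong) (use assms in auto)

lemma graph_mean_split:
  assumes "finite V" "v \<in> V"
  shows "graph_mean w p V h = subset_mean (\<lambda>u. 1 - exp (- (w v * w u * p))) (V - {v})
    (\<lambda>B. graph_mean w p (V - {v}) (\<lambda>E. h (E \<union> star v B)))"
proof -
  let ?r = "\<lambda>e. 1 - exp (- ((\<Prod>i\<in>e. w i) * p))"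
  have inj: "inj_on (\<lambda>u. {v, u}) (V - {v})" by (auto simp: inj_on_def doubleton_eq_iff)
  have "graph_mean w p V h =
      subset_mean ?r (pairs (V - {v})) (\<lambda>E. subset_mean ?r (star v (V - {v})) (\<lambda>S. h (E \<union> S)))"
    unfolding graph_mean_def pairs_split(1)[OF assms(2)]
    by (rule subset_mean_union[OF finite_pairs _ pairs_split(2)[OF assms(2)]])
      (use assms in \<open>auto simp: star_def\<close>)
  also have "\<dots> = subset_mean ?r (star v (V - {v})) (\<lambda>S. graph_mean w p (V - {v}) (\<lambda>E. h (E \<union> S)))"
    unfolding graph_mean_def by (rule subset_mean_swap)
  also have "\<dots> = subset_mean (\<lambda>u. ?r {v, u}) (V - {v}) (\<lambda>B. graph_mean w p (V - {v}) (\<lambda>E. h (E \<union> star v B)))"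
    unfolding star_def using assms inj by (subst subset_mean_image) auto
  also have "\<dots> = subset_mean (\<lambda>u. 1 - exp (- (w v * w u * p))) (V - {v})
      (\<lambda>B. graph_mean w p (V - {v}) (\<lambda>E. h (E \<union> star v B)))"
    by (rule subset_mean_cong_prob) auto
  finally show ?thesis .
qed

lemma subset_mean_split:
  assumes "finite P" "A \<subseteq> P"
  shows "subset_mean r P (\<lambda>B. h (B \<inter> A) (B - A)) = subset_mean r A (\<lambda>S. subset_mean r (P - A) (\<lambda>T. h S T))"
proof -
  have "P = A \<union> (P - A)" using assms by auto
  then have "subset_mean r P (\<lambda>B. h (B \<inter> A) (B - A)) =
      subset_mean r A (\<lambda>S. subset_mean r (P - A) (\<lambda>T. h ((S \<union> T) \<inter> A) ((S \<union> T) - A)))"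
    using subset_mean_union[of A "P - A" r "\<lambda>B. h (B \<inter> A) (B - A)"] assms
    by (auto dest: finite_subset)
  also have "\<dots> = subset_mean r A (\<lambda>S. subset_mean r (P - A) (\<lambda>T. h S T))"
    by (intro subset_mean_cong arg_cong2[where f = h]) auto
  finally show ?thesis .
qed

text \<open>The sets \<open>B \<inter> A\<close> and \<open>B - A\<close> are independent, and every
  factor is a product over single vertices. One formula serves the three exponential potentials:
  \<open>d = 1\<close> with a nontrivial \<open>g\<close> for the reached weight,
  \<open>d = 1 + k\<close> for the surplus, negative \<open>c\<close> for the Laplace
  transform.\<close>

lemma subset_mean_exp_weight:
  fixes w :: "'a \<Rightarrow> real"
  assumes "finite P" "A \<subseteq> P"
  shows "subset_mean r P (\<lambda>B. exp (c * sum w (A \<union> B)) * d ^ card (B \<inter> A) * (\<Prod>u\<in>P - (A \<union> B). g u)) =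
    exp (c * sum w A) * (\<Prod>u\<in>A. 1 + r u * (d - 1)) *
      (\<Prod>u\<in>P - A. r u * exp (c * w u) + (1 - r u) * g u)"
proof -
  have fin: "finite A" using assms finite_subset by auto
  have "subset_mean r P (\<lambda>B. exp (c * sum w (A \<union> B)) * d ^ card (B \<inter> A) * (\<Prod>u\<in>P - (A \<union> B). g u)) =
      subset_mean r P (\<lambda>B. exp (c * sum w A) * ((\<lambda>S T. d ^ card S * (exp (c * sum w T) * (\<Prod>u\<in>(P - A) - T. g u))) (B \<inter> A) (B - A)))"
  proof (rule subset_mean_cong)
    fix B assume "B \<subseteq> P"
    then have "finite B" using assms finite_subset by auto
    then have "sum w (A \<union> B) = sum w A + sum w (B - A)"
      using fin by (subst sum.union_disjoint[symmetric]) auto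
    moreover have "P - (A \<union> B) = P - A - (B - A)" by auto
    ultimately show "exp (c * sum w (A \<union> B)) * d ^ card (B \<inter> A) * (\<Prod>u\<in>P - (A \<union> B). g u) =
        exp (c * sum w A) * ((\<lambda>S T. d ^ card S * (exp (c * sum w T) * (\<Prod>u\<in>(P - A) - T. g u))) (B \<inter> A) (B - A))"
      by (simp add: exp_add algebra_simps)
  qed
  also have "\<dots> = exp (c * sum w A) * (subset_mean r A (\<lambda>S. d ^ card S) *
      subset_mean r (P - A) (\<lambda>T. exp (c * sum w T) * (\<Prod>u\<in>(P - A) - T. g u)))"
    unfolding subset_mean_cmult
      subset_mean_split[OF assms, where h = "\<lambda>S T. d ^ card S * (exp (c * sum w T) * (\<Prod>u\<in>(P - A) - T. g u))"]
      subset_mean_multc ..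
  also have "subset_mean r A (\<lambda>S. d ^ card S) = subset_mean r A (\<lambda>S. \<Prod>u\<in>A. if u \<in> S then d else 1)"
    by (rule subset_mean_cong) (use fin in \<open>simp add: prod.If_cases Int_absorb1 Int_def[symmetric]\<close>)
  also have "subset_mean r (P - A) (\<lambda>T. exp (c * sum w T) * (\<Prod>u\<in>(P - A) - T. g u)) =
      subset_mean r (P - A) (\<lambda>T. \<Prod>u\<in>P - A. if u \<in> T then exp (c * w u) else g u)"
  proof (rule subset_mean_cong)
    fix T assume T: "T \<subseteq> P - A"
    then have "finite T" using assms by (meson finite_Diff finite_subset)
    then have "exp (c * sum w T) = (\<Prod>u\<in>T. exp (c * w u))"
      by (simp add: sum_distrib_left exp_sum)
    moreover have "(P - A) \<inter> {u. u \<in> T} = T" "(P - A) \<inter> - {u. u \<in> T} = P - A - T" using T by auto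
    ultimately show "exp (c * sum w T) * (\<Prod>u\<in>(P - A) - T. g u) =
        (\<Prod>u\<in>P - A. if u \<in> T then exp (c * w u) else g u)"
      using assms by (simp add: prod.If_cases)
  qed
  finally show ?thesis
    using assms fin by (simp add: subset_mean_prod algebra_simps)
qed

locale weighted_vertices =
  fixes U :: "'v set" and w :: "'v \<Rightarrow> real" and p :: real
  assumes finite_U: "finite U" and w_pos: "\<And>u. u \<in> U \<Longrightarrow> 0 < w u" and p_nonneg: "0 \<le> p"
begin

abbreviation "G \<equiv> graph_mean w p"

abbreviation "q v \<equiv> (\<lambda>u. 1 - exp (- (w v * w u * p)))"

lemma q_bounds:
  assumes "v \<in> U" "u \<in> U"
  shows "0 \<le> q v u" "q v u \<le> 1" "q v u \<le> w v * w u * p"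
proof -
  have "0 \<le> w v * w u * p" using assms w_pos p_nonneg by (simp add: less_imp_le)
  then show "0 \<le> q v u" by simp
  show "q v u \<le> 1" by simp
  show "q v u \<le> w v * w u * p" using exp_ge_add_one_self[of "- (w v * w u * p)"] by linarith
qed

lemma edge_prob_bounds:
  assumes "V \<subseteq> U" "e \<in> pairs V"
  shows "0 \<le> 1 - exp (- ((\<Prod>i\<in>e. w i) * p)) \<and> 1 - exp (- ((\<Prod>i\<in>e. w i) * p)) \<le> 1"
proof -
  have "0 \<le> (\<Prod>i\<in>e. w i)" using assms w_pos by (intro prod_nonneg) (force simp: pairs_def)
  then show ?thesis using p_nonneg by simp
qed

lemma graph_mean_mono:
  assumes "V \<subseteq> U" "\<And>E. E \<subseteq> pairs V \<Longrightarrow> h E \<le> h' E"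
  shows "G V h \<le> G V h'"
  unfolding graph_mean_def using assms edge_prob_bounds by (intro subset_mean_mono) auto

lemma graph_mean_const [simp]: "V \<subseteq> U \<Longrightarrow> G V (\<lambda>E. c) = c"
  unfolding graph_mean_def using finite_U finite_pairs finite_subset by (metis subset_mean_const)

lemma sum_mono_U:
  assumes "V \<subseteq> U" "\<And>u. u \<in> U \<Longrightarrow> 0 \<le> g u"
  shows "sum g V \<le> (sum g U :: real)"
  by (rule sum_mono2) (use assms finite_U in auto)

text \<open>With \<open>\<Phi>\<close> arbitrary, this is the only recursion needed; each moment
  bound inserts its potential and checks a one-step inequality.\<close>

lemma graph_mean_explore:
  assumes "V \<subseteq> U" "A \<subseteq> V" "v \<in> A"
  shows "G V (\<lambda>E. \<Phi> (sum w (reach E A)) (surplus E A)) =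
    subset_mean (q v) (V - {v}) (\<lambda>B. G (V - {v}) (\<lambda>E.
      \<Phi> (w v + sum w (reach E (A - {v} \<union> B))) (int (card (B \<inter> (A - {v}))) + surplus E (A - {v} \<union> B))))"
proof -
  have fin: "finite V" using assms finite_U finite_subset by auto
  have v: "v \<in> V" using assms by auto
  show ?thesis
    unfolding graph_mean_split[OF fin v]
    unfolding graph_mean_def
  proof (intro subset_mean_cong)
    fix B E assume B: "B \<subseteq> V - {v}" and E: "E \<subseteq> pairs (V - {v})"
    have R: "reach E (A - {v} \<union> B) \<subseteq> V - {v}" by (rule reach_subset[OF E]) (use assms B in auto)
    then have "v \<notin> reach E (A - {v} \<union> B)" "finite (reach E (A - {v} \<union> B))"
      using fin by (auto dest: finite_subset)
    then show "\<Phi> (sum w (reach (E \<union> star v B) A)) (surplus (E \<union> star v B) A) =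
        \<Phi> (w v + sum w (reach E (A - {v} \<union> B)))
          (int (card (B \<inter> (A - {v}))) + surplus E (A - {v} \<union> B))"
      using reach_explore[OF fin assms(2,3) E B] surplus_explore[OF fin assms(2,3) E B] by simp
  qed
qed

lemma graph_mean_explore_le:
  assumes "V \<subseteq> U" "A \<subseteq> V" "v \<in> A"
    and "\<And>B. B \<subseteq> V - {v} \<Longrightarrow> G (V - {v}) (\<lambda>E.
      \<Phi> (w v + sum w (reach E (A - {v} \<union> B))) (int (card (B \<inter> (A - {v}))) + surplus E (A - {v} \<union> B))) \<le> h B"
  shows "G V (\<lambda>E. \<Phi> (sum w (reach E A)) (surplus E A)) \<le> subset_mean (q v) (V - {v}) h"
  unfolding graph_mean_explore[OF assms(1-3)]
proof (rule subset_mean_mono)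
  fix u assume "u \<in> V - {v}"
  then show "0 \<le> q v u \<and> q v u \<le> 1" using q_bounds[of v u] assms by auto
qed (use assms in auto)

section \<open>Exponential bounds for the reached weight and the surplus\<close>

lemma reach_weight_nonneg:
  assumes "V \<subseteq> U" "E \<subseteq> pairs V" "A \<subseteq> V"
  shows "sum w A \<le> sum w (reach E A)" "0 \<le> sum w (reach E A)"
proof -
  have R: "reach E A \<subseteq> V" "A \<subseteq> reach E A" using reach_subset[OF assms(2,3)] reach_refl[of A E] by auto
  have "finite (reach E A)" using R assms finite_U finite_subset by metis
  then show "sum w A \<le> sum w (reach E A)" "0 \<le> sum w (reach E A)"
    using R assms w_pos by (auto intro!: sum_mono2 sum_nonneg simp: less_imp_le subset_iff)
qed

text \<open>A Chernoff bound: to reach weight \<open>r\<close>, the vertices found by the time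
  weight \<open>r\<close> is explored must make up \<open>r\<close> together with \<open>A\<close>.
  A vertex \<open>u\<close> outside \<open>A\<close> is found with probability
  \<open>1 - exp (- (p * w u * r))\<close>, and the factor of \<open>u\<close> is the exponential
  moment of its contribution.\<close>

lemma reach_weight_tail:
  assumes "0 \<le> \<theta>" "V \<subseteq> U" "A \<subseteq> V" "0 \<le> r"
  shows "G V (\<lambda>E. of_bool (r \<le> sum w (reach E A))) \<le>
    exp (\<theta> * (sum w A - r)) * (\<Prod>u\<in>V - A. 1 + (exp (\<theta> * w u) - 1) * (1 - exp (- (p * w u * r))))"
  using assms(2-)
proof (induction "card V" arbitrary: V A r rule: less_induct)
  case (less V)
  let ?g = "\<lambda>r u. 1 + (exp (\<theta> * w u) - 1) * (1 - exp (- (p * w u * r)))"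
  have fin: "finite V" using less.prems finite_U finite_subset by auto
  have g1: "1 \<le> ?g r u" if "u \<in> U" "0 \<le> r" for u r
    using that assms(1) w_pos[of u] p_nonneg by (auto intro!: mult_nonneg_nonneg)
  show ?case
  proof (cases "r \<le> sum w A")
    case True
    have "G V (\<lambda>E. of_bool (r \<le> sum w (reach E A))) \<le> G V (\<lambda>E. 1)"
      by (rule graph_mean_mono) (use less.prems in auto)
    also have "G V (\<lambda>E. 1) = 1 * 1" using less.prems by simp
    also have "\<dots> \<le> exp (\<theta> * (sum w A - r)) * (\<Prod>u\<in>V - A. ?g r u)"
      by (rule mult_mono) (use True assms(1) less.prems g1 in \<open>auto intro!: prod_ge_1\<close>)
    finally show ?thesis .
  next
    case False
    show ?thesis
    proof (cases "A = {}")
      case True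
      have "G V (\<lambda>E. of_bool (r \<le> sum w (reach E A))) = 0"
        using True False less.prems by simp
      also have "0 \<le> exp (\<theta> * (sum w A - r)) * (\<Prod>u\<in>V - A. ?g r u)"
        \<comment> \<open>With nothing left to explore and \<open>r > 0\<close> the event is
          impossible, so only nonnegativity of the bound matters.\<close>
        using g1 less.prems by (intro mult_nonneg_nonneg prod_nonneg) (auto intro: order_trans[OF zero_le_one])
      finally show ?thesis .
    next
      case ne: False
      then obtain v where v: "v \<in> A" by auto
      let ?A0 = "A - {v}" and ?P = "V - {v}"
      have finA: "finite A" using less.prems fin finite_subset by auto
      have wA: "sum w A = w v + sum w ?A0" using v finA by (simp add: sum.remove)
      have "0 \<le> sum w ?A0" using less.prems w_pos by (intro sum_nonneg) (auto simp: less_imp_le subset_iff)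
      with False wA have r: "0 \<le> r - w v" by linarith
      have "G V (\<lambda>E. of_bool (r \<le> sum w (reach E A))) \<le>
          subset_mean (q v) ?P (\<lambda>B. exp (\<theta> * (w v - r)) *
            (exp (\<theta> * sum w (?A0 \<union> B)) * 1 ^ card (B \<inter> ?A0) * (\<Prod>u\<in>?P - (?A0 \<union> B). ?g (r - w v) u)))"
      proof (rule graph_mean_explore_le[where \<Phi> = "\<lambda>t x. of_bool (r \<le> t)"])
        fix B assume B: "B \<subseteq> ?P"
        have "G ?P (\<lambda>E. of_bool (r \<le> w v + sum w (reach E (?A0 \<union> B)))) =
            G ?P (\<lambda>E. of_bool (r - w v \<le> sum w (reach E (?A0 \<union> B))))"
          by (simp add: algebra_simps)
        also have "\<dots> \<le> exp (\<theta> * (sum w (?A0 \<union> B) - (r - w v))) * (\<Prod>u\<in>?P - (?A0 \<union> B). ?g (r - w v) u)"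
        proof (rule less.hyps)
          show "card ?P < card V" using v less.prems fin by (intro card_Diff1_less) auto
        qed (use less.prems B r in auto)
        finally have *: "G ?P (\<lambda>E. of_bool (r \<le> w v + sum w (reach E (?A0 \<union> B)))) \<le> \<dots>" .
        have e: "exp (\<theta> * (sum w (?A0 \<union> B) - (r - w v))) = exp (\<theta> * (w v - r)) * exp (\<theta> * sum w (?A0 \<union> B))"
          by (simp add: exp_add[symmetric] algebra_simps)
        show "G ?P (\<lambda>E. of_bool (r \<le> w v + sum w (reach E (?A0 \<union> B)))) \<le>
            exp (\<theta> * (w v - r)) *
            (exp (\<theta> * sum w (?A0 \<union> B)) * 1 ^ card (B \<inter> ?A0) * (\<Prod>u\<in>?P - (?A0 \<union> B). ?g (r - w v) u))"
          using * unfolding e by (simp only: power_one mult_1_right mult.assoc)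
      qed (use less.prems v in auto)
      also have "\<dots> = exp (\<theta> * (w v - r)) * (exp (\<theta> * sum w ?A0) * (\<Prod>u\<in>?A0. 1 + q v u * (1 - 1)) *
          (\<Prod>u\<in>?P - ?A0. q v u * exp (\<theta> * w u) + (1 - q v u) * ?g (r - w v) u))"
        unfolding subset_mean_cmult
        by (subst subset_mean_exp_weight) (use fin less.prems in auto)
      also have "\<dots> = exp (\<theta> * (sum w A - r)) * (\<Prod>u\<in>?P - ?A0. q v u * exp (\<theta> * w u) + (1 - q v u) * ?g (r - w v) u)"
        by (simp add: wA right_diff_distrib distrib_left exp_add exp_diff divide_simps)
      also have "(\<Prod>u\<in>?P - ?A0. q v u * exp (\<theta> * w u) + (1 - q v u) * ?g (r - w v) u) = (\<Prod>u\<in>V - A. ?g r u)"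
      proof (rule prod.cong)
        show "?P - ?A0 = V - A" using v by auto
        fix u
        \<comment> \<open>Avoiding weight \<open>r\<close> means avoiding \<open>v\<close> and then
          the remaining weight \<open>r - w v\<close>; hence the one-step relation for this
          potential is an equality.\<close>
        have "exp (- (p * w u * r)) = exp (- (w v * w u * p)) * exp (- (p * w u * (r - w v)))"
          by (simp add: exp_add[symmetric] algebra_simps)
        then show "q v u * exp (\<theta> * w u) + (1 - q v u) * ?g (r - w v) u = ?g r u"
          by (simp add: algebra_simps)
      qed
      finally show ?thesis .
    qed
  qed
qed

lemma exp_quadratic_bound: "0 \<le> x \<Longrightarrow> x \<le> 1 \<Longrightarrow> exp x - 1 \<le> x + x\<^sup>2" for x :: real
  using exp_bound[of x] by linarith

text \<open>While weight at most \<open>r\<close> is explored, active weight \<open>a\<close> meets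
  about \<open>p * a * r\<close> collisions, each worth a factor \<open>1 + k\<close>; this is the
  term linear in \<open>sum w A\<close>. The term \<open>r * g\<close> collects the growth of the
  active weight: its drift \<open>\<epsilon>\<close> and the second-order term of the exponential.
  Restricting to reached weight at most \<open>r\<close> keeps the slope bounded.\<close>

lemma surplus_exp_moment:
  assumes k: "0 \<le> k" "\<And>u. u \<in> U \<Longrightarrow> k * p * T * w u \<le> 1"
    and eps: "p * (\<Sum>u\<in>U. (w u)\<^sup>2) \<le> 1 + \<epsilon>" "0 \<le> \<epsilon>"
    and g: "g = k * p * T * \<epsilon> + k\<^sup>2 * p ^ 3 * T\<^sup>2 * (\<Sum>u\<in>U. (w u) ^ 3)"
    and V: "V \<subseteq> U" "A \<subseteq> V" and r: "r \<le> T"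
  shows "G V (\<lambda>E. (1 + k) ^ nat (surplus E A) * of_bool (sum w (reach E A) \<le> r)) \<le>
    exp (k * p * sum w A * r + r * g)"
  using V r
proof (induction "card V" arbitrary: V A r rule: less_induct)
  case (less V)
  have fin: "finite V" using less.prems finite_U finite_subset by auto
  show ?case
  proof (cases "A = {}")
    case True
    have T0: "r * g \<ge> 0" if "0 \<le> r"
    proof -
      have "0 \<le> g" unfolding g using k eps p_nonneg that less.prems w_pos
        by (intro add_nonneg_nonneg mult_nonneg_nonneg sum_nonneg) (auto simp: less_imp_le)
      with that show ?thesis by simp
    qed
    have "G V (\<lambda>E. (1 + k) ^ nat (surplus E A) * of_bool (sum w (reach E A) \<le> r)) \<le> G V (\<lambda>E. of_bool (0 \<le> r))"
      by (rule graph_mean_mono) (use less.prems True in auto)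
    also have "\<dots> \<le> exp (k * p * sum w A * r + r * g)"
      using True less.prems T0 by (auto split: if_splits)
    finally show ?thesis .
  next
    case False
    then obtain v where v: "v \<in> A" by auto
    let ?A0 = "A - {v}" and ?P = "V - {v}"
    have vU: "v \<in> U" and wv: "0 < w v" using v less.prems w_pos by auto
    have finA: "finite A" using less.prems fin finite_subset by auto
    have wA: "sum w A = w v + sum w ?A0" using v finA by (simp add: sum.remove)
    show ?thesis
    proof (cases "w v \<le> r")
      case False
      have "G V (\<lambda>E. (1 + k) ^ nat (surplus E A) * of_bool (sum w (reach E A) \<le> r)) \<le> G V (\<lambda>E. 0)"
      \<comment> \<open>A vertex heavier than the remaining budget makes the event empty.\<close>
      proof (rule graph_mean_mono)
        fix E assume "E \<subseteq> pairs V"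
        then have "sum w A \<le> sum w (reach E A)" using reach_weight_nonneg less.prems by auto
        moreover have "0 \<le> sum w ?A0"
          using less.prems w_pos by (intro sum_nonneg) (auto simp: less_imp_le subset_iff)
        ultimately show "(1 + k) ^ nat (surplus E A) * of_bool (sum w (reach E A) \<le> r) \<le> 0"
          using False wA by auto
      qed (use less.prems in auto)
      also have "\<dots> \<le> exp (k * p * sum w A * r + r * g)" using less.prems by simp
      finally show ?thesis .
    next
      case True
      define c where "c = k * p * (r - w v)"
      have r0: "0 \<le> r - w v" "0 \<le> r" "0 \<le> T" using True wv less.prems by auto
      have c0: "0 \<le> c" using k p_nonneg r0 by (simp add: c_def)
      have cw: "c * w u \<le> k * p * T * w u" "c * w u \<le> 1" "0 \<le> c * w u" if "u \<in> U" for u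
      proof -
        have "c \<le> k * p * T" unfolding c_def
          by (rule mult_left_mono) (use less.prems wv k p_nonneg in auto)
        then show "c * w u \<le> k * p * T * w u" using w_pos[OF that] by simp
        with k(2)[OF that] show "c * w u \<le> 1" by linarith
        show "0 \<le> c * w u" using c0 w_pos[OF that] by simp
      qed
      have "G V (\<lambda>E. (1 + k) ^ nat (surplus E A) * of_bool (sum w (reach E A) \<le> r)) \<le>
          subset_mean (q v) ?P (\<lambda>B. exp ((r - w v) * g) *
            (exp (c * sum w (?A0 \<union> B)) * (1 + k) ^ card (B \<inter> ?A0) * (\<Prod>u\<in>?P - (?A0 \<union> B). 1)))"
      proof (rule graph_mean_explore_le[where \<Phi> = "\<lambda>t x. (1 + k) ^ nat x * of_bool (t \<le> r)"])
        fix B assume B: "B \<subseteq> ?P"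
        have "G ?P (\<lambda>E. (1 + k) ^ nat (int (card (B \<inter> ?A0)) + surplus E (?A0 \<union> B)) * of_bool (w v + sum w (reach E (?A0 \<union> B)) \<le> r)) \<le>
            G ?P (\<lambda>E. (1 + k) ^ card (B \<inter> ?A0) * ((1 + k) ^ nat (surplus E (?A0 \<union> B)) * of_bool (sum w (reach E (?A0 \<union> B)) \<le> r - w v)))"
        proof (rule graph_mean_mono)
          fix E assume "E \<subseteq> pairs ?P"
          then have "0 \<le> surplus E (?A0 \<union> B)"
            by (rule surplus_nonneg[rotated]) (use fin B less.prems in auto)
          then show "(1 + k) ^ nat (int (card (B \<inter> ?A0)) + surplus E (?A0 \<union> B)) * of_bool (w v + sum w (reach E (?A0 \<union> B)) \<le> r) \<le>
            (1 + k) ^ card (B \<inter> ?A0) * ((1 + k) ^ nat (surplus E (?A0 \<union> B)) * of_bool (sum w (reach E (?A0 \<union> B)) \<le> r - w v))"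
            by (simp add: nat_add_distrib power_add)
        qed (use less.prems in auto)
        also have "\<dots> = (1 + k) ^ card (B \<inter> ?A0) * G ?P (\<lambda>E. (1 + k) ^ nat (surplus E (?A0 \<union> B)) * of_bool (sum w (reach E (?A0 \<union> B)) \<le> r - w v))"
          unfolding graph_mean_def subset_mean_cmult ..
        also have "\<dots> \<le> (1 + k) ^ card (B \<inter> ?A0) * exp (k * p * sum w (?A0 \<union> B) * (r - w v) + (r - w v) * g)"
        proof (rule mult_left_mono[OF less.hyps])
          show "card ?P < card V" using v less.prems fin by (intro card_Diff1_less) auto
        qed (use less.prems wv B k(1) in auto)
        also have "\<dots> = exp ((r - w v) * g) * (exp (c * sum w (?A0 \<union> B)) * (1 + k) ^ card (B \<inter> ?A0) * (\<Prod>u\<in>?P - (?A0 \<union> B). 1))"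
          by (simp add: exp_add c_def mult_ac)
        finally show "G ?P (\<lambda>E. (1 + k) ^ nat (int (card (B \<inter> ?A0)) + surplus E (?A0 \<union> B)) * of_bool (w v + sum w (reach E (?A0 \<union> B)) \<le> r)) \<le> \<dots>" .
      qed (use less.prems v in auto)
      also have "\<dots> = exp ((r - w v) * g) * (exp (c * sum w ?A0) * (\<Prod>u\<in>?A0. 1 + q v u * (1 + k - 1)) *
          (\<Prod>u\<in>?P - ?A0. q v u * exp (c * w u) + (1 - q v u) * 1))"
        unfolding subset_mean_cmult
        by (subst subset_mean_exp_weight) (use fin less.prems in auto)
      also have "\<dots> \<le> exp ((r - w v) * g) * (exp (c * sum w ?A0) * exp (\<Sum>u\<in>?A0. w v * w u * p * k) *
          exp (\<Sum>u\<in>?P - ?A0. w v * w u * p * (c * w u + (c * w u)\<^sup>2)))"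
      proof (intro mult_left_mono mult_mono)
        show "(\<Prod>u\<in>?A0. 1 + q v u * (1 + k - 1)) \<le> exp (\<Sum>u\<in>?A0. w v * w u * p * k)"
          unfolding exp_sum[OF finite_Diff[OF finA]]
        proof (intro prod_mono conjI)
          fix u assume "u \<in> ?A0"
          then have u: "u \<in> U" using less.prems by auto
          show "0 \<le> 1 + q v u * (1 + k - 1)" using q_bounds[OF vU u] k(1) by simp
          have "1 + q v u * (1 + k - 1) \<le> 1 + w v * w u * p * k"
            using mult_right_mono[OF q_bounds(3)[OF vU u] k(1)] by simp
          also have "\<dots> \<le> exp (w v * w u * p * k)" by (rule exp_ge_add_one_self)
          finally show "1 + q v u * (1 + k - 1) \<le> exp (w v * w u * p * k)" .
        qed
        show "(\<Prod>u\<in>?P - ?A0. q v u * exp (c * w u) + (1 - q v u) * 1) \<le>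
            exp (\<Sum>u\<in>?P - ?A0. w v * w u * p * (c * w u + (c * w u)\<^sup>2))"
          unfolding exp_sum[OF finite_Diff[OF finite_Diff[OF fin]]]
        proof (intro prod_mono conjI)
          fix u assume "u \<in> ?P - ?A0"
          then have u: "u \<in> U" using less.prems by auto
          show "0 \<le> q v u * exp (c * w u) + (1 - q v u) * 1" using q_bounds[OF vU u] by simp
          have "q v u * exp (c * w u) + (1 - q v u) * 1 = 1 + q v u * (exp (c * w u) - 1)"
            by (simp add: algebra_simps)
          also have "\<dots> \<le> 1 + w v * w u * p * (c * w u + (c * w u)\<^sup>2)"
            by (intro add_left_mono mult_mono)
              (use q_bounds[OF vU u] cw[OF u] exp_quadratic_bound[of "c * w u"] in auto)
          also have "\<dots> \<le> exp (w v * w u * p * (c * w u + (c * w u)\<^sup>2))" by (rule exp_ge_add_one_self)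
          finally show "q v u * exp (c * w u) + (1 - q v u) * 1 \<le> \<dots>" .
        qed
        show "0 \<le> (\<Prod>u\<in>?P - ?A0. q v u * exp (c * w u) + (1 - q v u) * 1)"
          using q_bounds[OF vU] less.prems by (intro prod_nonneg) auto
      qed auto
      also have "\<dots> = exp ((r - w v) * g + c * sum w ?A0 + w v * p * k * sum w ?A0 +
          (\<Sum>u\<in>?P - ?A0. w v * w u * p * (c * w u + (c * w u)\<^sup>2)))"
        by (simp add: exp_add sum_distrib_left mult_ac)
      also have "\<dots> \<le> exp (k * p * sum w A * r + r * g)"
      proof -
        let ?S2 = "\<Sum>u\<in>U. (w u)\<^sup>2" and ?S3 = "\<Sum>u\<in>U. (w u) ^ 3"
        \<comment> \<open>The slope drops from \<open>k * p * r\<close> to \<open>c\<close>, which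
          releases exactly \<open>k * p * w v\<close> per unit of the old active weight, the price
          of collisions with \<open>A - {v}\<close>. What remains is to pay for the newly found
          vertices, by the slope times \<open>w v\<close> and by \<open>w v * g\<close>.\<close>
        have cT: "c \<le> k * p * r" unfolding c_def by (rule mult_left_mono) (use wv k p_nonneg in auto)
        have kr: "k * p * r \<le> k * p * T" by (rule mult_left_mono) (use less.prems k p_nonneg in auto)
        have "(\<Sum>u\<in>?P - ?A0. w v * w u * p * (c * w u + (c * w u)\<^sup>2)) \<le>
            (\<Sum>u\<in>U. w v * w u * p * (c * w u + (c * w u)\<^sup>2))"
          by (rule sum_mono_U) (use less.prems wv p_nonneg w_pos c0 in \<open>auto simp: less_imp_le\<close>)
        also have "\<dots> = w v * (c * (p * ?S2) + c\<^sup>2 * p * ?S3)"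
          by (simp add: sum_distrib_left sum.distrib[symmetric] algebra_simps power2_eq_square power3_eq_cube)
        also have "\<dots> \<le> w v * ((k * p * r) * (1 + \<epsilon>) + (k * p * T)\<^sup>2 * p * ?S3)"
          using cT kr c0 k(1) r0 eps wv p_nonneg w_pos
          by (intro mult_left_mono add_mono mult_mono mult_right_mono power_mono mult_nonneg_nonneg sum_nonneg)
            (auto simp: less_imp_le)
        also have "\<dots> = w v * (k * p * r) + w v * ((k * p * r) * \<epsilon>) + w v * ((k * p * T)\<^sup>2 * p * ?S3)"
          by (simp add: algebra_simps)
        also have "\<dots> \<le> w v * (k * p * r) + w v * ((k * p * T) * \<epsilon>) + w v * ((k * p * T)\<^sup>2 * p * ?S3)"
          using mult_left_mono[OF mult_right_mono[OF kr eps(2)], of "w v"] wv by simp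
        also have "\<dots> = w v * (k * p * r) + w v * g"
          by (simp add: g algebra_simps power2_eq_square power3_eq_cube)
        finally have "(\<Sum>u\<in>?P - ?A0. w v * w u * p * (c * w u + (c * w u)\<^sup>2)) \<le> w v * (k * p * r) + w v * g" .
        then show ?thesis
          by (simp add: wA c_def algebra_simps)
      qed
      finally show ?thesis .
    qed
  qed
qed

lemma surplus_reach_real_nonneg:
  assumes "V \<subseteq> U" "E \<subseteq> pairs V" "A \<subseteq> V"
  shows "0 \<le> real_of_int (surplus E A)" "0 \<le> real_of_int (surplus E A) * (real_of_int (surplus E A) - 1)"
proof -
  have s: "0 \<le> surplus E A"
    by (rule surplus_nonneg[OF finite_subset[OF assms(1) finite_U] assms(2,3)])
  then show "0 \<le> real_of_int (surplus E A)" by simp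
  have "surplus E A = 0 \<or> 1 \<le> surplus E A" using s by linarith
  then show "0 \<le> real_of_int (surplus E A) * (real_of_int (surplus E A) - 1)" by auto
qed

section \<open>Discounted factorial moments of the surplus\<close>

context
  fixes \<theta> \<eta> \<epsilon> :: real
  assumes drift: "p * (\<Sum>u\<in>U. w u * (1 - exp (- (\<theta> * w u)))) \<le> \<theta> - \<eta>"
    and theta_nonneg: "0 \<le> \<theta>" and eta_pos: "0 < \<eta>"
    and eps: "p * (\<Sum>u\<in>U. (w u)\<^sup>2) \<le> 1 + \<epsilon>" "0 \<le> \<epsilon>"
begin

text \<open>The hypothesis \<open>drift\<close> bounds the mean of
  \<open>exp (- (\<theta> * w))\<close> over the new vertices below by
  \<open>exp (- (w v * (\<theta> - \<eta>)))\<close>. The discount supplies the missing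
  \<open>\<eta> * w v\<close>, so that the exponentials recombine to that of the full
  \<open>A\<close>; the gain \<open>1 - exp (- (\<eta> * w v))\<close> pays for additive errors
  elsewhere.\<close>

lemma laplace_drift:
  assumes "V \<subseteq> U" "A \<subseteq> V" "v \<in> A"
  shows "exp (- (\<eta> * w v)) * subset_mean (q v) (V - {v}) (\<lambda>B. 1 - exp (- (\<theta> * sum w (A - {v} \<union> B)))) \<le>
    (1 - exp (- (\<theta> * sum w A))) - (1 - exp (- (\<eta> * w v)))"
proof -
  let ?A0 = "A - {v}" and ?P = "V - {v}"
  have fin: "finite V" "finite A" using assms finite_U by (meson finite_subset)+
  have vU: "v \<in> U" and wv: "0 < w v" using assms w_pos by auto
  have wA: "sum w A = w v + sum w ?A0" using assms(3) fin by (simp add: sum.remove)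
  have "exp (- (w v * (\<theta> - \<eta>))) \<le> exp (- (\<Sum>u\<in>?P - ?A0. w v * w u * p * (1 - exp (- (\<theta> * w u)))))"
  proof -
    have "(\<Sum>u\<in>?P - ?A0. w v * w u * p * (1 - exp (- (\<theta> * w u)))) \<le>
        (\<Sum>u\<in>U. w v * w u * p * (1 - exp (- (\<theta> * w u))))"
      by (rule sum_mono_U) (use assms wv w_pos theta_nonneg p_nonneg in \<open>auto simp: less_imp_le\<close>)
    also have "\<dots> = w v * (p * (\<Sum>u\<in>U. w u * (1 - exp (- (\<theta> * w u)))))"
      by (simp add: sum_distrib_left mult_ac)
    also have "\<dots> \<le> w v * (\<theta> - \<eta>)" by (rule mult_left_mono[OF drift]) (use wv in auto)
    finally show ?thesis by simp
  qed
  also have "\<dots> = (\<Prod>u\<in>?P - ?A0. exp (- (w v * w u * p * (1 - exp (- (\<theta> * w u))))))"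
    using fin by (simp add: sum_negf[symmetric] exp_sum)
  also have "\<dots> \<le> (\<Prod>u\<in>?P - ?A0. q v u * exp (- \<theta> * w u) + (1 - q v u) * 1)"
  proof (intro prod_mono conjI)
    fix u assume "u \<in> ?P - ?A0"
    then have u: "u \<in> U" using assms by auto
    let ?z = "1 - exp (- (\<theta> * w u))" and ?y = "w v * w u * p"
    have z: "0 \<le> ?z" "?z \<le> 1" using theta_nonneg w_pos[OF u] by auto
    \<comment> \<open>Convexity between 0 and \<open>- ?y\<close>: the right-hand side is
      \<open>1 - ?z + ?z * exp (- ?y)\<close>, because \<open>exp (- (\<theta> * w u))\<close> is
      \<open>1 - ?z\<close>.\<close>
    have "convex_on UNIV exp" using exp_convex by blast
    then have "exp ((1 - ?z) *\<^sub>R 0 + ?z *\<^sub>R (- ?y)) \<le> (1 - ?z) * exp 0 + ?z * exp (- ?y)"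
      using z by (intro convex_onD) auto
    then show "exp (- (?y * ?z)) \<le> q v u * exp (- \<theta> * w u) + (1 - q v u) * 1"
      by (simp add: algebra_simps)
  qed auto
  finally have *: "exp (- (w v * (\<theta> - \<eta>))) \<le> (\<Prod>u\<in>?P - ?A0. q v u * exp (- \<theta> * w u) + (1 - q v u) * 1)" .
  have "subset_mean (q v) ?P (\<lambda>B. 1 - exp (- (\<theta> * sum w (?A0 \<union> B)))) =
      subset_mean (q v) ?P (\<lambda>B. 1 + (-1) * (exp (- \<theta> * sum w (?A0 \<union> B)) * 1 ^ card (B \<inter> ?A0) * (\<Prod>u\<in>?P - (?A0 \<union> B). 1)))"
    by simp
  also have "\<dots> = 1 - subset_mean (q v) ?P (\<lambda>B. exp (- \<theta> * sum w (?A0 \<union> B)) * 1 ^ card (B \<inter> ?A0) * (\<Prod>u\<in>?P - (?A0 \<union> B). 1))"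
    using fin by (subst subset_mean_add, subst subset_mean_cmult) simp
  also have "\<dots> = 1 - exp (- \<theta> * sum w ?A0) * (\<Prod>u\<in>?P - ?A0. q v u * exp (- \<theta> * w u) + (1 - q v u) * 1)"
    by (subst subset_mean_exp_weight) (use fin assms in auto)
  also have "\<dots> \<le> 1 - exp (- \<theta> * sum w ?A0) * exp (- (w v * (\<theta> - \<eta>)))"
    using * by simp
  finally have "exp (- (\<eta> * w v)) * subset_mean (q v) ?P (\<lambda>B. 1 - exp (- (\<theta> * sum w (?A0 \<union> B)))) \<le>
      exp (- (\<eta> * w v)) * (1 - exp (- \<theta> * sum w ?A0) * exp (- (w v * (\<theta> - \<eta>))))"
    by simp
  also have "\<dots> = (1 - exp (- (\<theta> * sum w A))) - (1 - exp (- (\<eta> * w v)))"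
    by (simp add: wA algebra_simps exp_add[symmetric])
  finally show ?thesis .
qed

text \<open>Collisions are decided by edges to \<open>A0\<close> and new weight by edges to the
  other vertices; these are independent, so the mixed moment factorizes. The last summand of the
  bound for the squared weight is the variance of the new weight.\<close>

lemma exploration_moments:
  assumes "V \<subseteq> U" "A \<subseteq> V" "v \<in> A"
  defines "A0 \<equiv> A - {v}" and "P \<equiv> V - {v}"
  shows "subset_mean (q v) P (\<lambda>B. real (card (B \<inter> A0))) \<le> p * w v * sum w A0"
    and "subset_mean (q v) P (\<lambda>B. real (card (B \<inter> A0)) * (real (card (B \<inter> A0)) - 1)) \<le> (p * w v * sum w A0)\<^sup>2"
    and "subset_mean (q v) P (\<lambda>B. sum w (A0 \<union> B)) \<le> sum w A + w v * \<epsilon>"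
    and "subset_mean (q v) P (\<lambda>B. (sum w (A0 \<union> B))\<^sup>2) \<le>
      (sum w A + w v * \<epsilon>)\<^sup>2 + w v * (p * (\<Sum>u\<in>U. w u ^ 3))"
    and "subset_mean (q v) P (\<lambda>B. real (card (B \<inter> A0)) * sum w (A0 \<union> B)) \<le>
      p * w v * sum w A0 * (sum w A + w v * \<epsilon>)"
proof -
  have fin: "finite V" "finite A" using assms(1,2) finite_U by (meson finite_subset)+
  have finP: "finite P" "finite A0" and A0P: "A0 \<subseteq> P" using fin assms(2) by (auto simp: P_def A0_def)
  have vU: "v \<in> U" and wv: "0 < w v" using assms(1-3) w_pos by auto
  have PU: "P \<subseteq> U" using assms(1) by (auto simp: P_def)
  have wA: "sum w A = w v + sum w A0" unfolding A0_def using assms(3) fin by (simp add: sum.remove)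
  have A0_nonneg: "0 \<le> sum w A0" using A0P PU w_pos by (intro sum_nonneg) (auto simp: less_imp_le subset_iff)
  have w_split: "sum w (A0 \<union> B) = sum w A0 + sum w (B - A0)" if "B \<subseteq> P" for B
  proof -
    have "finite B" using that finP finite_subset by auto
    then show ?thesis using finP by (subst sum.union_disjoint[symmetric]) auto
  qed
  note split = subset_mean_split[OF finP(1) A0P]
  have m1: "subset_mean (q v) A0 (\<lambda>S. real (card S)) = (\<Sum>u\<in>A0. q v u)"
    using subset_mean_linear[OF finP(2), of "q v" "\<lambda>_. 1"] by simp
  have qA: "(\<Sum>u\<in>A0. q v u) \<le> p * w v * sum w A0"
  proof -
    have "(\<Sum>u\<in>A0. q v u) \<le> (\<Sum>u\<in>A0. w v * w u * p)"
      by (rule sum_mono) (use q_bounds(3)[OF vU] A0P PU in auto)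
    then show ?thesis by (simp add: sum_distrib_left mult_ac)
  qed
  have qA0: "0 \<le> (\<Sum>u\<in>A0. q v u)" using q_bounds(1)[OF vU] A0P PU by (intro sum_nonneg) auto
  have Y: "(\<Sum>u\<in>P - A0. q v u * w u) \<le> w v * (1 + \<epsilon>)" "0 \<le> (\<Sum>u\<in>P - A0. q v u * w u)"
  proof -
    have "(\<Sum>u\<in>P - A0. q v u * w u) \<le> (\<Sum>u\<in>P - A0. w v * w u * p * w u)"
      by (intro sum_mono mult_right_mono) (use q_bounds(3)[OF vU] PU w_pos in \<open>auto simp: less_imp_le subset_iff\<close>)
    also have "\<dots> \<le> (\<Sum>u\<in>U. w v * w u * p * w u)"
      by (rule sum_mono_U) (use PU wv w_pos p_nonneg in \<open>auto simp: less_imp_le\<close>)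
    also have "\<dots> = w v * (p * (\<Sum>u\<in>U. (w u)\<^sup>2))" by (simp add: sum_distrib_left power2_eq_square mult_ac)
    also have "\<dots> \<le> w v * (1 + \<epsilon>)" by (rule mult_left_mono[OF eps(1)]) (use wv in auto)
    finally show "(\<Sum>u\<in>P - A0. q v u * w u) \<le> w v * (1 + \<epsilon>)" .
    show "0 \<le> (\<Sum>u\<in>P - A0. q v u * w u)"
      using q_bounds(1)[OF vU] PU w_pos by (intro sum_nonneg mult_nonneg_nonneg) (auto simp: less_imp_le subset_iff)
  qed
  have YV: "(\<Sum>u\<in>P - A0. q v u * (1 - q v u) * (w u)\<^sup>2) \<le> w v * (p * (\<Sum>u\<in>U. w u ^ 3))"
  proof -
    have "(\<Sum>u\<in>P - A0. q v u * (1 - q v u) * (w u)\<^sup>2) \<le> (\<Sum>u\<in>P - A0. (w v * w u * p) * 1 * (w u)\<^sup>2)"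
    proof (intro sum_mono mult_right_mono mult_mono)
      fix u assume "u \<in> P - A0"
      then have u: "u \<in> U" using PU by auto
      show "q v u \<le> w v * w u * p" "0 \<le> w v * w u * p" "1 - q v u \<le> 1" "0 \<le> 1 - q v u"
        using q_bounds[OF vU u] by auto
    qed auto
    also have "\<dots> \<le> (\<Sum>u\<in>U. (w v * w u * p) * 1 * (w u)\<^sup>2)"
      by (rule sum_mono_U) (use PU wv w_pos p_nonneg in \<open>auto simp: less_imp_le\<close>)
    finally show ?thesis by (simp add: sum_distrib_left power2_eq_square power3_eq_cube mult_ac)
  qed
  show "subset_mean (q v) P (\<lambda>B. real (card (B \<inter> A0))) \<le> p * w v * sum w A0"
    using split[of _ "\<lambda>S T. real (card S)"] finP m1 qA by simp
  show "subset_mean (q v) P (\<lambda>B. real (card (B \<inter> A0)) * (real (card (B \<inter> A0)) - 1)) \<le> (p * w v * sum w A0)\<^sup>2"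
  proof -
    have "subset_mean (q v) A0 (\<lambda>S. real (card S) * (real (card S) - 1)) =
        subset_mean (q v) A0 (\<lambda>S. (\<Sum>u\<in>S. 1)\<^sup>2 + (- 1) * real (card S))"
      by (simp add: power2_eq_square algebra_simps)
    also have "\<dots> = (\<Sum>u\<in>A0. q v u)\<^sup>2 + (\<Sum>u\<in>A0. q v u * (1 - q v u)) - (\<Sum>u\<in>A0. q v u)"
      unfolding subset_mean_add subset_mean_cmult m1 subset_mean_square[OF finP(2)] by simp
    also have "\<dots> \<le> (\<Sum>u\<in>A0. q v u)\<^sup>2"
    proof -
      have "(\<Sum>u\<in>A0. q v u * (1 - q v u)) \<le> (\<Sum>u\<in>A0. q v u * 1)"
        by (intro sum_mono mult_left_mono) (use q_bounds[OF vU] A0P PU in auto)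
      then show ?thesis by simp
    qed
    also have "\<dots> \<le> (p * w v * sum w A0)\<^sup>2" by (rule power_mono[OF qA qA0])
    finally show ?thesis using split[of _ "\<lambda>S T. real (card S) * (real (card S) - 1)"] finP by simp
  qed
  have mY: "subset_mean (q v) (P - A0) (\<lambda>T. sum w A0 + sum w T) = sum w A0 + (\<Sum>u\<in>P - A0. q v u * w u)"
    using finP by (simp add: subset_mean_add subset_mean_linear)
  have mY_le: "subset_mean (q v) (P - A0) (\<lambda>T. sum w A0 + sum w T) \<le> sum w A + w v * \<epsilon>"
    unfolding mY using Y by (simp add: wA algebra_simps)
  show "subset_mean (q v) P (\<lambda>B. sum w (A0 \<union> B)) \<le> sum w A + w v * \<epsilon>"
    using split[of _ "\<lambda>S T. sum w A0 + sum w T"] mY_le finP w_split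
    by (simp cong: subset_mean_cong)
  show "subset_mean (q v) P (\<lambda>B. real (card (B \<inter> A0)) * sum w (A0 \<union> B)) \<le>
      p * w v * sum w A0 * (sum w A + w v * \<epsilon>)"
  proof -
    have "subset_mean (q v) P (\<lambda>B. real (card (B \<inter> A0)) * sum w (A0 \<union> B)) =
        subset_mean (q v) P (\<lambda>B. real (card (B \<inter> A0)) * (sum w A0 + sum w (B - A0)))"
      by (rule subset_mean_cong) (simp add: w_split)
    also have "\<dots> = (\<Sum>u\<in>A0. q v u) * subset_mean (q v) (P - A0) (\<lambda>T. sum w A0 + sum w T)"
      unfolding split[of _ "\<lambda>S T. real (card S) * (sum w A0 + sum w T)"] subset_mean_cmult subset_mean_multc m1 ..
    also have "\<dots> \<le> p * w v * sum w A0 * (sum w A + w v * \<epsilon>)"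
      by (rule mult_mono[OF qA mY_le]) (use A0_nonneg wv p_nonneg mY Y in auto)
    finally show ?thesis .
  qed
  show "subset_mean (q v) P (\<lambda>B. (sum w (A0 \<union> B))\<^sup>2) \<le>
      (sum w A + w v * \<epsilon>)\<^sup>2 + w v * (p * (\<Sum>u\<in>U. w u ^ 3))"
  proof -
    let ?m = "\<Sum>u\<in>P - A0. q v u * w u"
    have "subset_mean (q v) P (\<lambda>B. (sum w (A0 \<union> B))\<^sup>2) = subset_mean (q v) P (\<lambda>B. (sum w A0 + sum w (B - A0))\<^sup>2)"
      by (rule subset_mean_cong) (simp add: w_split)
    also have "\<dots> = subset_mean (q v) (P - A0) (\<lambda>T. (sum w A0)\<^sup>2 + (2 * sum w A0 * sum w T + (sum w T)\<^sup>2))"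
      unfolding split[of _ "\<lambda>S T. (sum w A0 + sum w T)\<^sup>2"] using finP by (simp add: power2_sum algebra_simps)
    also have "\<dots> = (sum w A0)\<^sup>2 + (2 * sum w A0 * ?m + (?m\<^sup>2 + (\<Sum>u\<in>P - A0. q v u * (1 - q v u) * (w u)\<^sup>2)))"
      using finP by (simp add: subset_mean_add subset_mean_cmult subset_mean_linear subset_mean_square)
    also have "\<dots> = (sum w A0 + ?m)\<^sup>2 + (\<Sum>u\<in>P - A0. q v u * (1 - q v u) * (w u)\<^sup>2)"
      by (simp add: power2_sum)
    also have "\<dots> \<le> (sum w A + w v * \<epsilon>)\<^sup>2 + w v * (p * (\<Sum>u\<in>U. w u ^ 3))"
    proof (intro add_mono YV)
      show "(sum w A0 + ?m)\<^sup>2 \<le> (sum w A + w v * \<epsilon>)\<^sup>2"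
      proof (rule power_mono)
        show "sum w A0 + ?m \<le> sum w A + w v * \<epsilon>" using Y(1) by (simp add: wA distrib_left)
        show "0 \<le> sum w A0 + ?m" using Y(2) A0_nonneg by simp
      qed
    qed
    finally show ?thesis .
  qed
qed

text \<open>Discounting the linear term releases about
  \<open>\<eta> * w v * (p / \<eta>) * sum w A\<close>, which pays for the expected collisions. The
  growth \<open>w v * \<epsilon>\<close> of the active weight is paid for by the gain in
  \<open>laplace_drift\<close>, whence the coefficient \<open>\<epsilon> / \<eta>\<close>.\<close>

lemma surplus_laplace_first_moment:
  assumes "V \<subseteq> U" "A \<subseteq> V"
  shows "G V (\<lambda>E. real_of_int (surplus E A) * exp (- (\<eta> * sum w (reach E A)))) \<le>
    p / \<eta> * (sum w A + \<epsilon> / \<eta> * (1 - exp (- (\<theta> * sum w A))))"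
  using assms
proof (induction "card V" arbitrary: V A rule: less_induct)
  case (less V)
  show ?case
  proof (cases "A = {}")
    case True
    have "G V (\<lambda>E. real_of_int (surplus E A) * exp (- (\<eta> * sum w (reach E A)))) = G V (\<lambda>E. 0)"
      unfolding graph_mean_def by (rule subset_mean_cong) (simp add: True)
    then show ?thesis using True less.prems by simp
  next
    case False
    then obtain v where v: "v \<in> A" by auto
    let ?A0 = "A - {v}" and ?P = "V - {v}"
    have fin: "finite V" "finite A" using less.prems finite_U by (meson finite_subset)+
    have vU: "v \<in> U" and wv: "0 < w v" using v less.prems w_pos by auto
    have wA: "sum w A = w v + sum w ?A0" using v fin by (simp add: sum.remove)
    have PU: "?P \<subseteq> U" using less.prems by auto
    have A0_nonneg: "0 \<le> sum w ?A0" using less.prems w_pos by (intro sum_nonneg) (auto simp: less_imp_le subset_iff)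
    define D where "D = exp (- (\<eta> * w v))"
    have D: "0 < D" "D * exp (\<eta> * w v) = 1" by (auto simp: D_def exp_add[symmetric])
    define \<alpha> where "\<alpha> = p / \<eta>"
    define \<beta> where "\<beta> = \<epsilon> / \<eta>"
    have ab: "0 \<le> \<alpha>" "0 \<le> \<beta>" "\<alpha> * \<eta> = p" "\<beta> * \<eta> = \<epsilon>"
      using p_nonneg eta_pos eps by (auto simp: \<alpha>_def \<beta>_def)
    let ?Q = "\<lambda>a. 1 - exp (- (\<theta> * a))"
    have "G V (\<lambda>E. real_of_int (surplus E A) * exp (- (\<eta> * sum w (reach E A)))) \<le>
      subset_mean (q v) ?P (\<lambda>B. D * (real (card (B \<inter> ?A0)) +
        (\<alpha> * sum w (?A0 \<union> B) + \<alpha> * \<beta> * ?Q (sum w (?A0 \<union> B)))))"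
    proof (rule graph_mean_explore_le[where \<Phi> = "\<lambda>t x. real_of_int x * exp (- (\<eta> * t))"])
      fix B assume B: "B \<subseteq> ?P"
      have sub: "?A0 \<union> B \<subseteq> ?P" using B less.prems by auto
      let ?c = "real (card (B \<inter> ?A0))"
      have "G ?P (\<lambda>E. real_of_int (int (card (B \<inter> ?A0)) + surplus E (?A0 \<union> B)) *
            exp (- (\<eta> * (w v + sum w (reach E (?A0 \<union> B)))))) \<le>
          G ?P (\<lambda>E. D * (?c + real_of_int (surplus E (?A0 \<union> B)) * exp (- (\<eta> * sum w (reach E (?A0 \<union> B))))))"
      proof (rule graph_mean_mono[OF PU])
        fix E assume E: "E \<subseteq> pairs ?P"
        let ?t = "sum w (reach E (?A0 \<union> B))"
        have "0 \<le> ?t" using reach_weight_nonneg[OF PU E sub] by auto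
        then have "?c * exp (- (\<eta> * ?t)) \<le> ?c * 1" using eta_pos by (intro mult_left_mono) auto
        then have "D * (?c * exp (- (\<eta> * ?t)) + real_of_int (surplus E (?A0 \<union> B)) * exp (- (\<eta> * ?t))) \<le>
            D * (?c + real_of_int (surplus E (?A0 \<union> B)) * exp (- (\<eta> * ?t)))"
          using D by simp
        moreover have "exp (- (\<eta> * (w v + ?t))) = D * exp (- (\<eta> * ?t))"
          by (simp add: D_def exp_add[symmetric] algebra_simps)
        ultimately show "real_of_int (int (card (B \<inter> ?A0)) + surplus E (?A0 \<union> B)) * exp (- (\<eta> * (w v + ?t))) \<le>
            D * (?c + real_of_int (surplus E (?A0 \<union> B)) * exp (- (\<eta> * ?t)))"
          by (simp add: algebra_simps)
      qed
      also have "\<dots> = D * (?c + G ?P (\<lambda>E. real_of_int (surplus E (?A0 \<union> B)) * exp (- (\<eta> * sum w (reach E (?A0 \<union> B))))))"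
        unfolding graph_mean_def subset_mean_cmult subset_mean_add using fin by (simp add: finite_pairs)
      also have "\<dots> \<le> D * (?c + \<alpha> * (sum w (?A0 \<union> B) + \<beta> * ?Q (sum w (?A0 \<union> B))))"
      proof (intro mult_left_mono add_left_mono)
        show "G ?P (\<lambda>E. real_of_int (surplus E (?A0 \<union> B)) * exp (- (\<eta> * sum w (reach E (?A0 \<union> B))))) \<le>
            \<alpha> * (sum w (?A0 \<union> B) + \<beta> * ?Q (sum w (?A0 \<union> B)))"
          unfolding \<alpha>_def \<beta>_def
        proof (rule less.hyps[OF _ PU sub])
          show "card ?P < card V" using v less.prems fin by (intro card_Diff1_less) auto
        qed
      qed (use D in auto)
      finally show "G ?P (\<lambda>E. real_of_int (int (card (B \<inter> ?A0)) + surplus E (?A0 \<union> B)) *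
            exp (- (\<eta> * (w v + sum w (reach E (?A0 \<union> B)))))) \<le>
          D * (?c + (\<alpha> * sum w (?A0 \<union> B) + \<alpha> * \<beta> * ?Q (sum w (?A0 \<union> B))))"
        by (simp add: algebra_simps)
    qed (use less.prems v in auto)
    also have "\<dots> = D * (subset_mean (q v) ?P (\<lambda>B. real (card (B \<inter> ?A0))) +
        (\<alpha> * subset_mean (q v) ?P (\<lambda>B. sum w (?A0 \<union> B)))) +
        \<alpha> * \<beta> * (D * subset_mean (q v) ?P (\<lambda>B. ?Q (sum w (?A0 \<union> B))))"
      unfolding subset_mean_cmult subset_mean_add by (simp add: algebra_simps)
    also have "\<dots> \<le> D * (p * w v * sum w ?A0 + \<alpha> * (sum w A + w v * \<epsilon>)) +
        \<alpha> * \<beta> * (?Q (sum w A) - (1 - D))"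
      by (intro add_mono mult_left_mono exploration_moments less.prems v
          laplace_drift[OF less.prems v, folded D_def]) (use D ab in auto)
    also have "\<dots> \<le> \<alpha> * (sum w A + \<beta> * ?Q (sum w A))"
    proof -
      let ?a = "sum w A" and ?X = "exp (\<eta> * w v)"
      have X: "\<eta> * w v \<le> ?X - 1" using exp_ge_add_one_self[of "\<eta> * w v"] by linarith
      have "p * w v * sum w ?A0 + \<alpha> * (w v * \<epsilon>) \<le> (\<alpha> * ?a + \<alpha> * \<beta>) * (\<eta> * w v)"
      \<comment> \<open>After cancellation both costs are at most proportional to
        \<open>\<eta> * w v\<close>, and \<open>D * (?X - 1)\<close> is \<open>1 - D\<close>, the
        loss by discounting.\<close>
      proof -
        have "p * w v * sum w ?A0 \<le> p * w v * ?a" using wA wv p_nonneg by (intro mult_left_mono) auto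
        moreover have "(\<alpha> * ?a + \<alpha> * \<beta>) * (\<eta> * w v) = (\<alpha> * \<eta>) * w v * ?a + \<alpha> * (w v * (\<beta> * \<eta>))"
          by (simp add: algebra_simps)
        ultimately show ?thesis using ab by simp
      qed
      also have "\<dots> \<le> (\<alpha> * ?a + \<alpha> * \<beta>) * (?X - 1)"
        by (rule mult_left_mono[OF X]) (use ab wA A0_nonneg wv in auto)
      finally have "D * (p * w v * sum w ?A0 + \<alpha> * (w v * \<epsilon>)) \<le> D * ((\<alpha> * ?a + \<alpha> * \<beta>) * (?X - 1))"
        using D by (intro mult_left_mono) auto
      also have "\<dots> = (\<alpha> * ?a + \<alpha> * \<beta>) * (D * ?X - D)" by (simp add: algebra_simps)
      finally show ?thesis unfolding D(2) by (simp add: algebra_simps)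
    qed
    finally show ?thesis unfolding \<alpha>_def \<beta>_def .
  qed
qed

text \<open>With \<open>c\<close> collisions in a step, \<open>(c + X) * (c + X - 1)\<close> is
  \<open>c * (c - 1) + 2 * c * X + X * (X - 1)\<close>, so the first-moment bound enters through the
  cross term. The square of the weight pays for collisions, its linear companion for the drift, and
  the bounded term for the variance of new weight and for squared drift.\<close>

lemma surplus_laplace_second_moment:
  assumes "V \<subseteq> U" "A \<subseteq> V"
  shows "G V (\<lambda>E. real_of_int (surplus E A) * (real_of_int (surplus E A) - 1) * exp (- (\<eta> * sum w (reach E A)))) \<le>
    8 * (p / \<eta>)\<^sup>2 * ((sum w A)\<^sup>2 + 3 * (\<epsilon> / \<eta>) * sum w A +
      (p * (\<Sum>u\<in>U. w u ^ 3) / \<eta> + 3 * (\<epsilon> / \<eta>)\<^sup>2) * (1 - exp (- (\<theta> * sum w A))))"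
  using assms
proof (induction "card V" arbitrary: V A rule: less_induct)
  case (less V)
  show ?case
  proof (cases "A = {}")
    case True
    have "G V (\<lambda>E. real_of_int (surplus E A) * (real_of_int (surplus E A) - 1) * exp (- (\<eta> * sum w (reach E A)))) = G V (\<lambda>E. 0)"
      unfolding graph_mean_def by (rule subset_mean_cong) (simp add: True)
    then show ?thesis using True less.prems by simp
  next
    case False
    then obtain v where v: "v \<in> A" by auto
    let ?A0 = "A - {v}" and ?P = "V - {v}"
    have fin: "finite V" "finite A" using less.prems finite_U by (meson finite_subset)+
    have vU: "v \<in> U" and wv: "0 < w v" using v less.prems w_pos by auto
    have wA: "sum w A = w v + sum w ?A0" using v fin by (simp add: sum.remove)
    have PU: "?P \<subseteq> U" using less.prems by auto
    have A0_nonneg: "0 \<le> sum w ?A0" using less.prems w_pos by (intro sum_nonneg) (auto simp: less_imp_le subset_iff)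
    have S3: "0 \<le> (\<Sum>u\<in>U. w u ^ 3)" using w_pos by (intro sum_nonneg) (auto simp: less_imp_le)
    define D where "D = exp (- (\<eta> * w v))"
    have D: "0 < D" "D \<le> 1" "D * exp (\<eta> * w v) = 1"
      using eta_pos wv by (auto simp: D_def exp_add[symmetric])
    define \<alpha> where "\<alpha> = p / \<eta>"
    define \<beta> where "\<beta> = \<epsilon> / \<eta>"
    define s where "s = p * (\<Sum>u\<in>U. w u ^ 3) / \<eta>"
    have abs_eq: "\<alpha> * \<eta> = p" "\<beta> * \<eta> = \<epsilon>" "s * \<eta> = p * (\<Sum>u\<in>U. w u ^ 3)"
      using eta_pos by (auto simp: \<alpha>_def \<beta>_def s_def)
    have ab: "0 \<le> \<alpha>" "0 \<le> \<beta>" "0 \<le> s"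
      using p_nonneg eta_pos eps S3 by (auto simp: \<alpha>_def \<beta>_def s_def)
    let ?Q = "\<lambda>a. 1 - exp (- (\<theta> * a))"
    let ?\<kappa> = "8 * \<alpha>\<^sup>2"
    let ?\<mu> = "s + 3 * \<beta>\<^sup>2"
    let ?c = "\<lambda>B. real (card (B \<inter> ?A0))"
    let ?W = "\<lambda>B. sum w (?A0 \<union> B)"
    have "G V (\<lambda>E. real_of_int (surplus E A) * (real_of_int (surplus E A) - 1) * exp (- (\<eta> * sum w (reach E A)))) \<le>
      subset_mean (q v) ?P (\<lambda>B. D * (?c B * (?c B - 1) + (2 * \<alpha> * (?c B * ?W B) + 2 * \<alpha> * \<beta> * ?c B +
        (?\<kappa> * (?W B)\<^sup>2 + (?\<kappa> * 3 * \<beta> * ?W B + ?\<kappa> * ?\<mu> * ?Q (?W B))))))"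
    proof (rule graph_mean_explore_le[where \<Phi> = "\<lambda>t x. real_of_int x * (real_of_int x - 1) * exp (- (\<eta> * t))"])
      fix B assume B: "B \<subseteq> ?P"
      have sub: "?A0 \<union> B \<subseteq> ?P" using B less.prems by auto
      let ?X = "\<lambda>E. real_of_int (surplus E (?A0 \<union> B))"
      let ?e = "\<lambda>E. exp (- (\<eta> * sum w (reach E (?A0 \<union> B))))"
      have ccm: "0 \<le> ?c B * (?c B - 1)" by (cases "card (B \<inter> ?A0)") auto
      have "G ?P (\<lambda>E. real_of_int (int (card (B \<inter> ?A0)) + surplus E (?A0 \<union> B)) *
            (real_of_int (int (card (B \<inter> ?A0)) + surplus E (?A0 \<union> B)) - 1) *
            exp (- (\<eta> * (w v + sum w (reach E (?A0 \<union> B)))))) \<le>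
          G ?P (\<lambda>E. D * (?c B * (?c B - 1) + (2 * ?c B * (?X E * ?e E) + ?X E * (?X E - 1) * ?e E)))"
      proof (rule graph_mean_mono[OF PU])
        fix E assume E: "E \<subseteq> pairs ?P"
        let ?t = "sum w (reach E (?A0 \<union> B))"
        have "0 \<le> ?t" using reach_weight_nonneg[OF PU E sub] by auto
        then have "?c B * (?c B - 1) * ?e E \<le> ?c B * (?c B - 1) * 1"
          using eta_pos by (intro mult_left_mono[OF _ ccm]) auto
        then have "D * (?c B * (?c B - 1) * ?e E + (2 * ?c B * (?X E * ?e E) + ?X E * (?X E - 1) * ?e E)) \<le>
            D * (?c B * (?c B - 1) + (2 * ?c B * (?X E * ?e E) + ?X E * (?X E - 1) * ?e E))"
          using D by simp
        moreover have "exp (- (\<eta> * (w v + ?t))) = D * ?e E"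
          by (simp add: D_def exp_add[symmetric] algebra_simps)
        moreover have "real_of_int (int (card (B \<inter> ?A0)) + surplus E (?A0 \<union> B)) *
            (real_of_int (int (card (B \<inter> ?A0)) + surplus E (?A0 \<union> B)) - 1) * (D * ?e E) =
          D * (?c B * (?c B - 1) * ?e E + (2 * ?c B * (?X E * ?e E) + ?X E * (?X E - 1) * ?e E))"
          by (simp add: algebra_simps)
        ultimately show "real_of_int (int (card (B \<inter> ?A0)) + surplus E (?A0 \<union> B)) *
            (real_of_int (int (card (B \<inter> ?A0)) + surplus E (?A0 \<union> B)) - 1) * exp (- (\<eta> * (w v + ?t))) \<le>
            D * (?c B * (?c B - 1) + (2 * ?c B * (?X E * ?e E) + ?X E * (?X E - 1) * ?e E))"
          by metis
      qed
      also have "\<dots> = D * (?c B * (?c B - 1) + (2 * ?c B * G ?P (\<lambda>E. ?X E * ?e E) + G ?P (\<lambda>E. ?X E * (?X E - 1) * ?e E)))"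
        unfolding graph_mean_def subset_mean_cmult subset_mean_add using fin by (simp add: finite_pairs)
      also have "\<dots> \<le> D * (?c B * (?c B - 1) + (2 * ?c B * (\<alpha> * (?W B + \<beta>)) +
          ?\<kappa> * ((?W B)\<^sup>2 + 3 * \<beta> * ?W B + ?\<mu> * ?Q (?W B))))"
      proof (intro mult_left_mono add_left_mono add_mono)
        \<comment> \<open>The bounded part of the first-moment potential is replaced by 1, which
          leaves a cross term affine in the active weight.\<close>
        have "G ?P (\<lambda>E. ?X E * ?e E) \<le> \<alpha> * (?W B + \<beta> * ?Q (?W B))"
          unfolding \<alpha>_def \<beta>_def by (rule surplus_laplace_first_moment[OF PU sub])
        also have "\<dots> \<le> \<alpha> * (?W B + \<beta> * 1)"
          using ab by (intro mult_left_mono add_left_mono) auto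
        finally show "G ?P (\<lambda>E. ?X E * ?e E) \<le> \<alpha> * (?W B + \<beta>)" by simp
        show "G ?P (\<lambda>E. ?X E * (?X E - 1) * ?e E) \<le> ?\<kappa> * ((?W B)\<^sup>2 + 3 * \<beta> * ?W B + ?\<mu> * ?Q (?W B))"
          unfolding \<alpha>_def \<beta>_def s_def
        proof (rule less.hyps[OF _ PU sub])
          show "card ?P < card V" using v less.prems fin by (intro card_Diff1_less) auto
        qed
      qed (use D in auto)
      also have "\<dots> = D * (?c B * (?c B - 1) + (2 * \<alpha> * (?c B * ?W B) + 2 * \<alpha> * \<beta> * ?c B +
        (?\<kappa> * (?W B)\<^sup>2 + (?\<kappa> * 3 * \<beta> * ?W B + ?\<kappa> * ?\<mu> * ?Q (?W B)))))"
        by (simp add: algebra_simps)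
      finally show "G ?P (\<lambda>E. real_of_int (int (card (B \<inter> ?A0)) + surplus E (?A0 \<union> B)) *
            (real_of_int (int (card (B \<inter> ?A0)) + surplus E (?A0 \<union> B)) - 1) *
            exp (- (\<eta> * (w v + sum w (reach E (?A0 \<union> B)))))) \<le> \<dots>" .
    qed (use less.prems v in auto)
    also have "\<dots> = D * (subset_mean (q v) ?P (\<lambda>B. ?c B * (?c B - 1)) +
        (2 * \<alpha> * subset_mean (q v) ?P (\<lambda>B. ?c B * ?W B) + 2 * \<alpha> * \<beta> * subset_mean (q v) ?P ?c +
        (?\<kappa> * subset_mean (q v) ?P (\<lambda>B. (?W B)\<^sup>2) + ?\<kappa> * 3 * \<beta> * subset_mean (q v) ?P ?W))) +
        ?\<kappa> * ?\<mu> * (D * subset_mean (q v) ?P (\<lambda>B. ?Q (?W B)))"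
      unfolding subset_mean_cmult subset_mean_add by (simp add: algebra_simps)
    also have "\<dots> \<le> D * ((p * w v * sum w ?A0)\<^sup>2 +
        (2 * \<alpha> * (p * w v * sum w ?A0 * (sum w A + w v * \<epsilon>)) + 2 * \<alpha> * \<beta> * (p * w v * sum w ?A0) +
        (?\<kappa> * ((sum w A + w v * \<epsilon>)\<^sup>2 + w v * (p * (\<Sum>u\<in>U. w u ^ 3))) + ?\<kappa> * 3 * \<beta> * (sum w A + w v * \<epsilon>)))) +
        ?\<kappa> * ?\<mu> * (?Q (sum w A) - (1 - D))"
      by (intro add_mono mult_left_mono exploration_moments less.prems v
          laplace_drift[OF less.prems v, folded D_def]) (use D ab in auto)
    also have "\<dots> \<le> ?\<kappa> * ((sum w A)\<^sup>2 + 3 * \<beta> * sum w A + ?\<mu> * ?Q (sum w A))"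
    proof -
      let ?a = "sum w A" and ?a' = "sum w ?A0"
      define y where "y = \<eta> * w v"
      have y: "0 \<le> y" using eta_pos wv by (simp add: y_def)
      \<comment> \<open>The quadratic term is needed here: squared collisions and squared drift are
        of order \<open>y\<close> squared, and \<open>y\<close> need not be small.\<close>
      have X: "y + y\<^sup>2 / 2 \<le> exp y - 1" using exp_lower_Taylor_quadratic[OF y] by linarith
      have pv: "p * w v = \<alpha> * y" "w v * \<epsilon> = \<beta> * y" "w v * (p * (\<Sum>u\<in>U. w u ^ 3)) = s * y"
        using abs_eq by (auto simp: y_def mult_ac)
      have a: "0 \<le> ?a'" "?a' \<le> ?a" using wA wv A0_nonneg by auto
      have "(y * ?a')\<^sup>2 + (2 * (y * ?a' * (?a + \<beta> * y)) + 2 * \<beta> * (y * ?a') +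
          (8 * ((?a + \<beta> * y)\<^sup>2 + s * y) + 8 * 3 * \<beta> * (?a + \<beta> * y)))
          \<le> (y * ?a)\<^sup>2 + (2 * (y * ?a * (?a + \<beta> * y)) + 2 * \<beta> * (y * ?a) +
          (8 * ((?a + \<beta> * y)\<^sup>2 + s * y) + 8 * 3 * \<beta> * (?a + \<beta> * y)))"
        by (intro add_mono mult_left_mono mult_right_mono power_mono order_refl) (use a ab y in auto)
      also have "\<dots> \<le> 8 * (?a\<^sup>2 + 3 * \<beta> * ?a) + 8 * (?a\<^sup>2 + 3 * \<beta> * ?a + ?\<mu>) * (y + y\<^sup>2 / 2)"
      proof -
        \<comment> \<open>The constants 8 and 3 in the potential are large enough for every
          coefficient of this difference to be nonnegative.\<close>
        have "8 * (?a\<^sup>2 + 3 * \<beta> * ?a) + 8 * (?a\<^sup>2 + 3 * \<beta> * ?a + ?\<mu>) * (y + y\<^sup>2 / 2) -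
            ((y * ?a)\<^sup>2 + (2 * (y * ?a * (?a + \<beta> * y)) + 2 * \<beta> * (y * ?a) +
            (8 * ((?a + \<beta> * y)\<^sup>2 + s * y) + 8 * 3 * \<beta> * (?a + \<beta> * y)))) =
            6 * (y * ?a\<^sup>2) + 6 * (y * \<beta> * ?a) + 3 * (y\<^sup>2 * ?a\<^sup>2) + 10 * (y\<^sup>2 * \<beta> * ?a) + 4 * (y\<^sup>2 * s) + 4 * (y\<^sup>2 * \<beta>\<^sup>2)"
          by (simp add: power2_eq_square field_simps)
        moreover have "0 \<le> \<dots>" using y ab a by simp
        ultimately show ?thesis by linarith
      qed
      also have "\<dots> \<le> 8 * (?a\<^sup>2 + 3 * \<beta> * ?a) + 8 * (?a\<^sup>2 + 3 * \<beta> * ?a + ?\<mu>) * (exp y - 1)"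
        by (intro add_left_mono mult_left_mono X) (use a ab in auto)
      finally have *: "(y * ?a')\<^sup>2 + (2 * (y * ?a' * (?a + \<beta> * y)) + 2 * \<beta> * (y * ?a') +
          (8 * ((?a + \<beta> * y)\<^sup>2 + s * y) + 8 * 3 * \<beta> * (?a + \<beta> * y))) \<le> \<dots>" .
      have "D * ((\<alpha> * y * ?a')\<^sup>2 +
        (2 * \<alpha> * (\<alpha> * y * ?a' * (?a + \<beta> * y)) + 2 * \<alpha> * \<beta> * (\<alpha> * y * ?a') +
        (?\<kappa> * ((?a + \<beta> * y)\<^sup>2 + s * y) + ?\<kappa> * 3 * \<beta> * (?a + \<beta> * y)))) =
        D * \<alpha>\<^sup>2 * ((y * ?a')\<^sup>2 + (2 * (y * ?a' * (?a + \<beta> * y)) + 2 * \<beta> * (y * ?a') +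
          (8 * ((?a + \<beta> * y)\<^sup>2 + s * y) + 8 * 3 * \<beta> * (?a + \<beta> * y))))"
        by (simp add: power2_eq_square algebra_simps)
      also have "\<dots> \<le> D * \<alpha>\<^sup>2 * (8 * (?a\<^sup>2 + 3 * \<beta> * ?a) + 8 * (?a\<^sup>2 + 3 * \<beta> * ?a + ?\<mu>) * (exp y - 1))"
        by (rule mult_left_mono[OF *]) (use D in auto)
      also have "\<dots> = ?\<kappa> * (D * exp y * (?a\<^sup>2 + 3 * \<beta> * ?a + ?\<mu>) - D * ?\<mu>)"
        by (simp add: algebra_simps)
      also have "\<dots> = ?\<kappa> * (?a\<^sup>2 + 3 * \<beta> * ?a + ?\<mu> * (1 - D))"
        unfolding D(3)[folded y_def] by (simp add: algebra_simps)
      finally show ?thesis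
        unfolding pv by (simp add: algebra_simps)
    qed
    finally show ?thesis unfolding \<alpha>_def \<beta>_def s_def .
  qed
qed

end

end

section \<open>Tail bounds in the critical window\<close>

lemma exp_minus_le_linear:
  fixes t :: real
  assumes "0 \<le> t" "t \<le> 1"
  shows "exp (- t) \<le> 1 - t / 2"
proof -
  have "exp (- t) \<le> 1 / (1 + t)"
    using exp_ge_add_one_self[of t] assms by (simp add: exp_minus divide_simps)
  also have "\<dots> \<le> 1 - t / 2"
    using assms mult_left_mono[of t 1 t] by (simp add: field_simps)
  finally show ?thesis .
qed

lemma exp_minus_ge_quadratic:
  fixes y :: real
  assumes "0 \<le> y" "y \<le> 1"
  shows "1 - y + y\<^sup>2 / 4 \<le> exp (- y)"
proof -
  let ?g = "\<lambda>y::real. exp (- y) - (1 - y + y\<^sup>2 / 4)"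
  have "?g 0 \<le> ?g y"
  proof (rule DERIV_nonneg_imp_nondecreasing[OF assms(1)])
    fix t :: real assume t: "0 \<le> t" "t \<le> y"
    have "0 \<le> - exp (- t) + 1 - t / 2" using exp_minus_le_linear[of t] t assms by simp
    moreover have "(?g has_real_derivative (- exp (- t) + 1 - t / 2)) (at t)"
      by (auto intro!: derivative_eq_intros)
    ultimately show "\<exists>d. (?g has_real_derivative d) (at t) \<and> 0 \<le> d" by blast
  qed
  then show ?thesis by simp
qed

text \<open>A quadratic gain in \<open>t * u\<close> is false for large \<open>u\<close>. For
  \<open>u > 1\<close> convexity reduces to \<open>u * (1 - exp (- t))\<close>, where the gain is
  only linear in \<open>u\<close>; this is the origin of \<open>min u 1\<close>.\<close>

lemma one_minus_exp_le:
  fixes t u :: real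
  assumes t: "0 \<le> t" "t \<le> 1" and u: "0 < u"
  shows "1 - exp (- (t * u)) \<le> t * u - t\<^sup>2 * (u * min u 1) / 4"
proof (cases "u \<le> 1")
  case True
  have "t * u \<le> 1" using t u True by (simp add: mult_le_one)
  then have "1 - t * u + (t * u)\<^sup>2 / 4 \<le> exp (- (t * u))"
    by (intro exp_minus_ge_quadratic) (use t u in auto)
  then show ?thesis using True by (simp add: min_def power2_eq_square algebra_simps)
next
  case False
  have "exp ((1 - 1 / u) *\<^sub>R 0 + (1 / u) *\<^sub>R (- (t * u))) \<le> (1 - 1 / u) * exp 0 + (1 / u) * exp (- (t * u))"
    by (intro convex_onD[OF exp_convex]) (use False in auto)
  then have "exp (- t) \<le> 1 - 1 / u + exp (- (t * u)) / u" using u by simp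
  then have "u * exp (- t) \<le> u * (1 - 1 / u + exp (- (t * u)) / u)" using u by (intro mult_left_mono) auto
  also have "\<dots> = u - 1 + exp (- (t * u))" using u by (simp add: distrib_left right_diff_distrib)
  finally have "u * exp (- t) \<le> u - 1 + exp (- (t * u))" .
  moreover have "u * (1 - t + t\<^sup>2 / 4) \<le> u * exp (- t)"
    using exp_minus_ge_quadratic[OF t] u by simp
  ultimately show ?thesis using False by (simp add: min_def algebra_simps)
qed

text \<open>The facts about one fixed n that the asymptotic conditions provide. The error
  \<open>x ^ 2\<close> in the second moment matches o(n^(2/3)), \<open>f_le_x\<close> makes
  \<open>p * T\<close> at most 1 for the threshold \<open>T\<close> below, and
  \<open>sum_min\<close> is the nondegeneracy that makes exploration lose mass.\<close>

locale near_critical = weighted_vertices U w p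
  for U :: "'v set" and w :: "'v \<Rightarrow> real" and p :: real +
  fixes x f S c :: real
  assumes x_ge_1: "1 \<le> x" and f_ge_1: "1 \<le> f" and f_le_x: "2 * ((16 + 8 * S) / c) * f \<le> x"
    and c_pos: "0 < c" and c_le_1: "c \<le> 1" and S_pos: "0 < S"
    and p_eq: "p = (x + f) / x ^ 4"
    and sum1: "sum w U = x ^ 3"
    and sum2: "(\<Sum>u\<in>U. (w u)\<^sup>2) \<le> x ^ 3 + x ^ 2"
    and sum3: "(\<Sum>u\<in>U. w u ^ 3) \<le> S * x ^ 3"
    and w_le_x: "\<And>u. u \<in> U \<Longrightarrow> w u \<le> x"
    and sum_min: "c * x ^ 3 \<le> (\<Sum>u\<in>U. (w u)\<^sup>2 * min (w u) 1)"
begin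

text \<open>Chosen so that \<open>3 + 2 * S - c * B / 4\<close> equals -1: depletion then beats the
  drift and the second-order term at reached weight \<open>T\<close>.\<close>

definition B :: real where "B = (16 + 8 * S) / c"
definition T :: real where "T = B * f * x\<^sup>2"
text \<open>The product of \<open>1 + f / x\<close> from \<open>p\<close> and
  \<open>1 + 1 / x\<close> from the second moment is at most \<open>1 + \<epsilon>\<close>.\<close>

definition \<epsilon> :: real where "\<epsilon> = 3 * f / x"
text \<open>With \<open>k = 1 / (2 * B * f)\<close> and \<open>m = surplus_const * f ^ 3\<close>,
  the Markov exponent \<open>k * m / 2\<close> is \<open>(3 * B + 2 * S * B + 4) * f ^ 2\<close>: it
  absorbs the growth of the moment and leaves 4 f^2.\<close>

definition surplus_const :: real where "surplus_const = 4 * B * (3 * B + 2 * S * B + 4)"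

lemma x_pos: "0 < x" using x_ge_1 by linarith

lemma B_ge: "16 \<le> B"
proof -
  have "16 * c \<le> 16 + 8 * S" using c_le_1 S_pos by linarith
  then show ?thesis using c_pos by (simp add: B_def pos_le_divide_eq)
qed

lemma f_le: "2 * B * f \<le> x" "f \<le> x"
proof -
  show *: "2 * B * f \<le> x" using f_le_x by (simp add: B_def)
  have "1 * f \<le> 2 * B * f" using B_ge f_ge_1 by (intro mult_right_mono) auto
  with * show "f \<le> x" by linarith
qed

lemma p_bounds: "1 \<le> p * x ^ 3" "p * x ^ 3 \<le> 2"
proof -
  have "p * x ^ 3 = 1 + f / x" using x_pos by (simp add: p_eq field_simps power_numeral_reduce)
  then show "1 \<le> p * x ^ 3" "p * x ^ 3 \<le> 2" using x_pos f_ge_1 f_le(2) by auto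
qed

lemma eps_nonneg: "0 \<le> \<epsilon>" using x_pos f_ge_1 by (simp add: \<epsilon>_def)

lemma sum2_eps: "p * (\<Sum>u\<in>U. (w u)\<^sup>2) \<le> 1 + \<epsilon>"
proof -
  have "p * (\<Sum>u\<in>U. (w u)\<^sup>2) \<le> p * (x ^ 3 + x ^ 2)" by (rule mult_left_mono[OF sum2 p_nonneg])
  also have "\<dots> = (1 + f / x) * (1 + 1 / x)" using x_pos by (simp add: p_eq field_simps power_numeral_reduce)
  also have "\<dots> = 1 + f / x + (1 / x + f / x * (1 / x))" by (simp add: algebra_simps)
  also have "\<dots> \<le> 1 + f / x + (f / x + f / x * 1)"
    using x_ge_1 f_ge_1 by (intro add_mono mult_left_mono divide_right_mono order_refl) auto
  finally show ?thesis by (simp add: \<epsilon>_def)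
qed

lemma sum2_le: "(\<Sum>u\<in>U. (w u)\<^sup>2) \<le> 2 * x ^ 3"
proof -
  have "x ^ 2 \<le> x ^ 3" using x_ge_1 by (intro power_increasing) auto
  with sum2 show ?thesis by linarith
qed

lemma p_sum3: "p * (\<Sum>u\<in>U. w u ^ 3) \<le> 2 * S"
proof -
  have "p * (\<Sum>u\<in>U. w u ^ 3) \<le> p * (S * x ^ 3)" by (rule mult_left_mono[OF sum3 p_nonneg])
  also have "\<dots> = S * (p * x ^ 3)" by simp
  also have "\<dots> \<le> S * 2" using p_bounds S_pos by (intro mult_left_mono) auto
  finally show ?thesis by simp
qed

lemma sum_one_minus_exp:
  assumes "0 \<le> t" "t \<le> 1"
  shows "(\<Sum>u\<in>U. w u * (1 - exp (- (t * w u)))) \<le> t * (\<Sum>u\<in>U. (w u)\<^sup>2) - t\<^sup>2 * (c * x ^ 3) / 4"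
proof -
  have "(\<Sum>u\<in>U. w u * (1 - exp (- (t * w u)))) \<le> (\<Sum>u\<in>U. w u * (t * w u - t\<^sup>2 * (w u * min (w u) 1) / 4))"
    using one_minus_exp_le[OF assms w_pos] w_pos by (intro sum_mono mult_left_mono) (auto simp: less_imp_le)
  also have "\<dots> = t * (\<Sum>u\<in>U. (w u)\<^sup>2) - t\<^sup>2 * (\<Sum>u\<in>U. (w u)\<^sup>2 * min (w u) 1) / 4"
    by (simp add: sum_distrib_left sum_divide_distrib sum_subtractf[symmetric] power2_eq_square algebra_simps)
  also have "\<dots> \<le> t * (\<Sum>u\<in>U. (w u)\<^sup>2) - t\<^sup>2 * (c * x ^ 3) / 4"
    using mult_left_mono[OF sum_min, of "t\<^sup>2"] by simp
  finally show ?thesis .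
qed

lemma pT_bounds: "p * T = p * x ^ 3 * (B * f / x)" "B * f / x \<le> p * T" "p * T \<le> 2 * B * f / x" "p * T \<le> 1"
proof -
  have Bf: "0 \<le> B * f / x" using B_ge f_ge_1 x_pos by simp
  show eq: "p * T = p * x ^ 3 * (B * f / x)" using x_pos by (simp add: T_def power2_eq_square power3_eq_cube)
  show "B * f / x \<le> p * T" unfolding eq using mult_right_mono[OF p_bounds(1) Bf] by simp
  show *: "p * T \<le> 2 * B * f / x" unfolding eq using mult_right_mono[OF p_bounds(2) Bf] by simp
  have "2 * B * f / x \<le> 1" using f_le(1) x_pos by simp
  with * show "p * T \<le> 1" by linarith
qed

lemma T_nonneg: "0 \<le> T" using B_ge f_ge_1 by (simp add: T_def)

text \<open>Take \<open>1 / x\<close> as the exponential parameter, the largest scale on which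
  \<open>exp_quadratic_bound\<close> covers all weights. The terms \<open>T / x\<close> cancel;
  drift contributes 3 B f^2, second order at most 2 B S f^2, and depletion removes c B^2 f^2 /
  4.\<close>

lemma reach_weight_tail_critical:
  assumes A: "A \<subseteq> U"
  shows "G U (\<lambda>E. of_bool (T \<le> sum w (reach E A))) \<le> exp (sum w A / x - 4 * f\<^sup>2)"
proof -
  let ?t = "p * T"
  have t: "0 \<le> ?t" "?t \<le> 1" using T_nonneg p_nonneg pT_bounds by auto
  have ex: "exp (1 / x * u) - 1 \<le> 1 / x * u + (1 / x * u)\<^sup>2" if "0 < u" "u \<le> x" for u
    by (rule exp_quadratic_bound) (use that in auto)
  have "G U (\<lambda>E. of_bool (T \<le> sum w (reach E A))) \<le>
      exp (1 / x * (sum w A - T)) * (\<Prod>u\<in>U - A. 1 + (exp (1 / x * w u) - 1) * (1 - exp (- (p * w u * T))))"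
    by (rule reach_weight_tail) (use A T_nonneg x_pos in auto)
  also have "\<dots> \<le> exp (1 / x * (sum w A - T)) *
      (\<Prod>u\<in>U - A. exp ((1 / x * w u + (1 / x * w u)\<^sup>2) * (1 - exp (- (?t * w u)))))"
  proof (intro mult_left_mono prod_mono conjI)
    fix u assume "u \<in> U - A"
    then have u: "0 < w u" "w u \<le> x" using w_pos w_le_x by auto
    have z: "0 \<le> 1 - exp (- (p * w u * T))" using u p_nonneg T_nonneg by simp
    have e: "0 \<le> exp (1 / x * w u) - 1" using u x_pos by simp
    show "0 \<le> 1 + (exp (1 / x * w u) - 1) * (1 - exp (- (p * w u * T)))"
      using mult_nonneg_nonneg[OF e z] by linarith
    have "1 + (exp (1 / x * w u) - 1) * (1 - exp (- (p * w u * T))) \<le>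
        1 + (1 / x * w u + (1 / x * w u)\<^sup>2) * (1 - exp (- (p * w u * T)))"
      using mult_right_mono[OF ex[OF u] z] by simp
    also have "\<dots> \<le> exp ((1 / x * w u + (1 / x * w u)\<^sup>2) * (1 - exp (- (p * w u * T))))"
      by (rule exp_ge_add_one_self)
    finally show "1 + (exp (1 / x * w u) - 1) * (1 - exp (- (p * w u * T))) \<le>
        exp ((1 / x * w u + (1 / x * w u)\<^sup>2) * (1 - exp (- (?t * w u))))"
      by (simp add: mult_ac)
  qed auto
  also have "\<dots> = exp (1 / x * (sum w A - T) +
      (\<Sum>u\<in>U - A. (1 / x * w u + (1 / x * w u)\<^sup>2) * (1 - exp (- (?t * w u)))))"
    using finite_U by (simp add: exp_add exp_sum)
  also have "\<dots> \<le> exp (sum w A / x - 4 * f\<^sup>2)"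
  proof -
    let ?S2 = "\<Sum>u\<in>U. (w u)\<^sup>2" and ?S3 = "\<Sum>u\<in>U. w u ^ 3"
    have "(\<Sum>u\<in>U - A. (1 / x * w u + (1 / x * w u)\<^sup>2) * (1 - exp (- (?t * w u)))) \<le>
        (\<Sum>u\<in>U. (1 / x * w u + (1 / x * w u)\<^sup>2) * (1 - exp (- (?t * w u))))"
      by (rule sum_mono_U) (use t w_pos x_pos in \<open>auto simp: less_imp_le\<close>)
    also have "\<dots> \<le> (\<Sum>u\<in>U. 1 / x * (w u * (1 - exp (- (?t * w u)))) + (1 / x)\<^sup>2 * ?t * w u ^ 3)"
    proof (rule sum_mono)
      fix u assume "u \<in> U"
      have "1 - exp (- (?t * w u)) \<le> ?t * w u" using exp_ge_add_one_self[of "- (?t * w u)"] by linarith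
      from mult_left_mono[OF this, of "(1 / x * w u)\<^sup>2"]
      show "(1 / x * w u + (1 / x * w u)\<^sup>2) * (1 - exp (- (?t * w u))) \<le>
          1 / x * (w u * (1 - exp (- (?t * w u)))) + (1 / x)\<^sup>2 * ?t * w u ^ 3"
        by (simp add: power2_eq_square power3_eq_cube algebra_simps)
    qed
    also have "\<dots> = 1 / x * (\<Sum>u\<in>U. w u * (1 - exp (- (?t * w u)))) + (1 / x)\<^sup>2 * ?t * ?S3"
      by (simp add: sum.distrib sum_distrib_left)
    also have "\<dots> \<le> 1 / x * (?t * ?S2 - ?t\<^sup>2 * (c * x ^ 3) / 4) + (1 / x)\<^sup>2 * (2 * B * f / x) * (S * x ^ 3)"
      using x_pos t pT_bounds(3) sum3 sum_one_minus_exp[OF t] w_pos B_ge f_ge_1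
      by (intro add_mono mult_left_mono mult_mono) (auto intro!: sum_nonneg simp: less_imp_le)
    also have "\<dots> = T / x * (p * ?S2) - ?t\<^sup>2 * (c * x\<^sup>2) / 4 + 2 * B * S * f"
      using x_pos by (simp add: field_simps power_numeral_reduce)
    also have "\<dots> \<le> T / x * (1 + \<epsilon>) - (B * f / x)\<^sup>2 * (c * x\<^sup>2) / 4 + 2 * B * S * f"
      using T_nonneg x_pos sum2_eps c_pos pT_bounds(2) B_ge f_ge_1
      by (intro add_mono diff_mono divide_right_mono mult_left_mono mult_right_mono power_mono order_refl) auto
    also have "\<dots> = T / x + 3 * B * f\<^sup>2 - c * B\<^sup>2 * f\<^sup>2 / 4 + 2 * B * S * f"
      using x_pos by (simp add: T_def \<epsilon>_def field_simps power_numeral_reduce)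
    also have "\<dots> \<le> T / x + 3 * B * f\<^sup>2 - c * B\<^sup>2 * f\<^sup>2 / 4 + 2 * B * S * f\<^sup>2"
      using f_ge_1 B_ge S_pos self_le_power[of f 2] by simp
    also have "\<dots> = T / x + B * f\<^sup>2 * (3 + 2 * S - c * B / 4)"
      by (simp add: power2_eq_square algebra_simps)
    also have "3 + 2 * S - c * B / 4 = - 1" using c_pos by (simp add: B_def field_simps)
    finally have "(\<Sum>u\<in>U - A. (1 / x * w u + (1 / x * w u)\<^sup>2) * (1 - exp (- (?t * w u)))) \<le> T / x - B * f\<^sup>2"
      by simp
    moreover have "4 * f\<^sup>2 \<le> B * f\<^sup>2" using B_ge by (intro mult_right_mono) auto
    ultimately show ?thesis by (simp add: diff_divide_distrib)
  qed
  finally show ?thesis .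
qed

text \<open>Either the reached weight is at least \<open>T\<close>, or Markov applies to the
  exponential moment of the surplus. The value of \<open>k\<close> makes \<open>k * p * T\<close> at
  most \<open>1 / x\<close>, so both contributions depend on the starting set only through
  \<open>sum w A / x\<close>.\<close>

lemma surplus_tail_critical:
  assumes A: "A \<subseteq> U"
  shows "G U (\<lambda>E. of_bool (surplus_const * f ^ 3 \<le> real_of_int (surplus E A))) \<le> 2 * exp (sum w A / x - 4 * f\<^sup>2)"
proof -
  define k where "k = 1 / (2 * B * f)"
  define m where "m = surplus_const * f ^ 3"
  have k: "0 < k" "k \<le> 1"
  proof -
    have "1 * 1 \<le> (2 * B) * f" using B_ge f_ge_1 by (intro mult_mono) auto
    then have *: "0 < 2 * B * f" "1 \<le> 2 * B * f" by linarith+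
    show "0 < k" unfolding k_def by (rule divide_pos_pos[OF zero_less_one *(1)])
    show "k \<le> 1" unfolding k_def using divide_le_eq_1_pos[OF *(1)] *(2) by blast
  qed
  have kpT: "k * p * T \<le> 1 / x" 
  proof -
    have "k * (p * T) \<le> k * (2 * B * f / x)" using pT_bounds k by (intro mult_left_mono) auto
    also have "\<dots> = 1 / x" using B_ge f_ge_1 by (simp add: k_def)
    finally show ?thesis by (simp add: mult.assoc)
  qed
  define g where "g = k * p * T * \<epsilon> + k\<^sup>2 * p ^ 3 * T\<^sup>2 * (\<Sum>u\<in>U. (w u) ^ 3)"
  have moment: "G U (\<lambda>E. (1 + k) ^ nat (surplus E A) * of_bool (sum w (reach E A) \<le> T)) \<le>
      exp (k * p * sum w A * T + T * g)"
  proof (rule surplus_exp_moment[where T = T and \<epsilon> = \<epsilon> and g = g])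
    fix u assume u: "u \<in> U"
    have "k * p * T * w u \<le> 1 / x * w u" using kpT w_pos[OF u] by (intro mult_right_mono) auto
    also have "\<dots> \<le> 1" using w_le_x[OF u] x_pos by simp
    finally show "k * p * T * w u \<le> 1" .
  qed (use A k sum2_eps eps_nonneg g_def in auto)
  have Tg: "T * g \<le> (3 * B + 2 * S * B) * f\<^sup>2"
  proof -
    define z where "z = p * (\<Sum>u\<in>U. (w u) ^ 3)"
    have z: "0 \<le> z" "z \<le> 2 * S"
      using p_sum3 p_nonneg w_pos by (auto simp: z_def less_imp_le intro!: mult_nonneg_nonneg sum_nonneg)
    have "T * g = T * \<epsilon> * (k * p * T) + T * (k * p * T)\<^sup>2 * z"
      by (simp add: g_def z_def power2_eq_square power3_eq_cube algebra_simps)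
    also have "\<dots> \<le> T * \<epsilon> * (1 / x) + T * (1 / x)\<^sup>2 * (2 * S)"
      using kpT z T_nonneg eps_nonneg k p_nonneg
      by (intro add_mono mult_left_mono mult_mono power_mono) auto
    also have "\<dots> = 3 * B * f\<^sup>2 + 2 * S * B * f"
      using x_pos by (simp add: T_def \<epsilon>_def field_simps power_numeral_reduce)
    also have "\<dots> \<le> 3 * B * f\<^sup>2 + 2 * S * B * f\<^sup>2"
      using f_ge_1 B_ge S_pos self_le_power[of f 2] by simp
    finally show ?thesis by (simp add: algebra_simps)
  qed
  have kA: "k * p * sum w A * T \<le> sum w A / x"
  proof -
    have "0 \<le> sum w A" using A w_pos by (intro sum_nonneg) (auto simp: less_imp_le subset_iff)
    from mult_right_mono[OF kpT this] show ?thesis by (simp add: mult_ac)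
  qed
  have km: "k * m / 2 = (3 * B + 2 * S * B + 4) * f\<^sup>2"
    using B_ge f_ge_1 by (simp add: k_def m_def surplus_const_def field_simps power_numeral_reduce)
  have point: "of_bool (m \<le> real_of_int (surplus E A)) \<le>
      of_bool (T \<le> sum w (reach E A)) +
      exp (- (k * m / 2)) * ((1 + k) ^ nat (surplus E A) * of_bool (sum w (reach E A) \<le> T))" for E
  proof (cases "m \<le> real_of_int (surplus E A) \<and> \<not> T \<le> sum w (reach E A)")
    case True
    have "exp (k / 2) \<le> 1 + k"
    proof -
      have "exp (k / 2) \<le> 1 + (k / 2) + (k / 2)\<^sup>2" using k by (intro exp_bound) auto
      also have "(k / 2)\<^sup>2 \<le> k / 2" using k by (simp add: power2_eq_square field_simps)
      finally show ?thesis by simp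
    qed
    then have "exp (k / 2) ^ nat (surplus E A) \<le> (1 + k) ^ nat (surplus E A)" by (rule power_mono) simp
    moreover have "exp (k * m / 2) \<le> exp (k / 2) ^ nat (surplus E A)"
    proof -
      have "m \<le> real (nat (surplus E A))" using True by linarith
      from mult_left_mono[OF this, of "k / 2"] have "k * m / 2 \<le> real (nat (surplus E A)) * (k / 2)" using k by simp
      then show ?thesis by (simp add: exp_of_nat_mult[symmetric])
    qed
    ultimately have "exp (k * m / 2) \<le> (1 + k) ^ nat (surplus E A)" by linarith
    then have "exp (- (k * m / 2)) * exp (k * m / 2) \<le> exp (- (k * m / 2)) * (1 + k) ^ nat (surplus E A)"
      by (intro mult_left_mono) auto
    moreover have "exp (- (k * m / 2)) * exp (k * m / 2) = 1" by (simp add: exp_add[symmetric])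
    ultimately have "1 \<le> exp (- (k * m / 2)) * (1 + k) ^ nat (surplus E A)" by simp
    then show ?thesis using True by simp
  next
    case False
    then show ?thesis using k by auto
  qed
  have "G U (\<lambda>E. of_bool (m \<le> real_of_int (surplus E A))) \<le>
      G U (\<lambda>E. of_bool (T \<le> sum w (reach E A)) +
      exp (- (k * m / 2)) * ((1 + k) ^ nat (surplus E A) * of_bool (sum w (reach E A) \<le> T)))"
    by (rule graph_mean_mono) (use point in auto)
  also have "\<dots> = G U (\<lambda>E. of_bool (T \<le> sum w (reach E A))) +
      exp (- (k * m / 2)) * G U (\<lambda>E. (1 + k) ^ nat (surplus E A) * of_bool (sum w (reach E A) \<le> T))"
    unfolding graph_mean_def subset_mean_add subset_mean_cmult ..
  also have "\<dots> \<le> exp (sum w A / x - 4 * f\<^sup>2) + exp (- (k * m / 2)) * exp (k * p * sum w A * T + T * g)"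
    by (intro add_mono reach_weight_tail_critical A mult_left_mono moment) auto
  also have "exp (- (k * m / 2)) * exp (k * p * sum w A * T + T * g) \<le> exp (sum w A / x - 4 * f\<^sup>2)"
    using Tg kA unfolding km exp_add[symmetric] by (simp add: algebra_simps)
  finally show ?thesis unfolding m_def by simp
qed

section \<open>From starting sets to components\<close>

definition excess_in_component :: "real \<Rightarrow> (real \<Rightarrow> bool) \<Rightarrow> 'v set set \<Rightarrow> bool" where
  "excess_in_component m P E \<longleftrightarrow> (\<exists>C \<in> graph_components U E. P (sum w C) \<and> m \<le> real (excess E C))"

text \<open>The surplus bound holds at every vertex of the component; both the hitting argument and
  the weighted counting of vertices rely on this.\<close>

lemma excess_in_componentE:
  assumes "E \<subseteq> pairs U" "excess_in_component m P E"
  obtains C where "C \<subseteq> U" "C \<noteq> {}" "P (sum w C)" "\<And>i. i \<in> C \<Longrightarrow> reach E {i} = C"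
    "\<And>i. i \<in> C \<Longrightarrow> m \<le> real_of_int (surplus E {i})"
proof -
  obtain C where C: "C \<in> graph_components U E" "P (sum w C)" "m \<le> real (excess E C)"
    using assms(2) by (auto simp: excess_in_component_def)
  then obtain i where i: "i \<in> C" by (auto simp: graph_components_def quotient_def)
  show thesis
  proof (rule that[of C])
    show "C \<subseteq> U" by (rule component_eq_reach(2)[OF assms(1) C(1) i])
    show "C \<noteq> {}" using i by auto
    fix j assume j: "j \<in> C"
    show "reach E {j} = C" using component_eq_reach(1)[OF assms(1) C(1) j] by simp
    show "m \<le> real_of_int (surplus E {j})"
      using excess_le_surplus[OF finite_U assms(1) C(1) j] C(3) by linarith
  qed (use C in auto)
qed

lemma excess_union_bound:
  "G U (\<lambda>E. of_bool (excess_in_component (surplus_const * f ^ 3) (\<lambda>_. True) E)) \<le>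
    real (card U) * (2 * exp (1 - 4 * f\<^sup>2))"
proof -
  let ?m = "surplus_const * f ^ 3"
  have "G U (\<lambda>E. of_bool (excess_in_component ?m (\<lambda>_. True) E)) \<le>
      G U (\<lambda>E. \<Sum>i\<in>U. of_bool (?m \<le> real_of_int (surplus E {i})))"
  proof (rule graph_mean_mono)
    fix E assume E: "E \<subseteq> pairs U"
    show "of_bool (excess_in_component ?m (\<lambda>_. True) E) \<le> (\<Sum>i\<in>U. of_bool (?m \<le> real_of_int (surplus E {i})) :: real)"
    proof (cases "excess_in_component ?m (\<lambda>_. True) E")
      case True
      then obtain C where "C \<subseteq> U" "C \<noteq> {}" "\<And>i. i \<in> C \<Longrightarrow> ?m \<le> real_of_int (surplus E {i})"
        by (rule excess_in_componentE[OF E]) blast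
      then obtain i where i: "i \<in> U" "?m \<le> real_of_int (surplus E {i})" by blast
      then have "(1 :: real) = (\<Sum>j\<in>{i}. of_bool (?m \<le> real_of_int (surplus E {j})))" by simp
      also have "\<dots> \<le> (\<Sum>i\<in>U. of_bool (?m \<le> real_of_int (surplus E {i})))"
        by (rule sum_mono2) (use i finite_U in auto)
      finally show ?thesis using True by simp
    qed (auto intro: sum_nonneg)
  qed simp
  also have "\<dots> = (\<Sum>i\<in>U. G U (\<lambda>E. of_bool (?m \<le> real_of_int (surplus E {i}))))"
    unfolding graph_mean_def subset_mean_sum ..
  also have "\<dots> \<le> (\<Sum>i\<in>U. 2 * exp (1 - 4 * f\<^sup>2))"
  proof (rule sum_mono)
    fix i assume i: "i \<in> U"
    have "w i / x \<le> 1" using w_le_x[OF i] x_pos by simp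
    then have "2 * exp (sum w {i} / x - 4 * f\<^sup>2) \<le> 2 * exp (1 - 4 * f\<^sup>2)" by simp
    with surplus_tail_critical[of "{i}"] i
    show "G U (\<lambda>E. of_bool (?m \<le> real_of_int (surplus E {i}))) \<le> 2 * exp (1 - 4 * f\<^sup>2)"
      by (meson empty_subsetI insert_subset order_trans)
  qed
  finally show ?thesis by simp
qed

text \<open>
  A vertex set drawn at random with intensity \<open>w / x\<^sup>2\<close> hits every component of weight at least
  \<open>x\<^sup>2 * exp (- f)\<close> with probability at least \<open>exp (- f) / 2\<close>, and its weight is of order \<open>x\<close>. Exploring
  the graph from this set costs a factor \<open>exp f\<close> instead of the number of vertices.
\<close>

lemma excess_large_components:
  "G U (\<lambda>E. of_bool (excess_in_component (surplus_const * f ^ 3) (\<lambda>t. x\<^sup>2 * exp (- f) \<le> t) E)) \<le>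
    4 * exp (4 + f - 4 * f\<^sup>2)"
proof -
  let ?m = "surplus_const * f ^ 3"
  let ?Ev = "\<lambda>E. of_bool (excess_in_component ?m (\<lambda>t. x\<^sup>2 * exp (- f) \<le> t) E) :: real"
  define r where "r u = 1 - exp (- (w u / x\<^sup>2))" for u
  have r: "0 \<le> r u" "r u \<le> 1" "r u \<le> w u / x\<^sup>2" if "u \<in> U" for u
    using w_pos[OF that] x_pos exp_ge_add_one_self[of "- (w u / x\<^sup>2)"] unfolding r_def
    by (simp, simp, linarith)
  have hit: "exp (- f) / 2 \<le> subset_mean r U (\<lambda>S. of_bool (S \<inter> C \<noteq> {}))"
    if C: "C \<subseteq> U" "x\<^sup>2 * exp (- f) \<le> sum w C" for C
  proof -
    \<comment> \<open>The product is 1 if \<open>S\<close> misses \<open>C\<close> and 0 otherwise,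
      so independence gives the probability of missing \<open>C\<close> exactly.\<close>
    have "subset_mean r U (\<lambda>S. of_bool (S \<inter> C \<noteq> {})) =
        subset_mean r U (\<lambda>S. 1 + (- 1) * (\<Prod>u\<in>U. if u \<in> S then of_bool (u \<notin> C) else 1))"
    proof (rule subset_mean_cong)
      fix S assume S: "S \<subseteq> U"
      show "of_bool (S \<inter> C \<noteq> {}) = 1 + (- 1) * (\<Prod>u\<in>U. if u \<in> S then of_bool (u \<notin> C) else 1 :: real)"
      proof (cases "S \<inter> C = {}")
        case True
        then have "(\<Prod>u\<in>U. if u \<in> S then of_bool (u \<notin> C) else 1 :: real) = 1"
          by (intro prod.neutral) auto
        with True show ?thesis by simp
      next
        case False
        then obtain u where "u \<in> S" "u \<in> C" by auto
        then have "(\<Prod>u\<in>U. if u \<in> S then of_bool (u \<notin> C) else 1 :: real) = 0"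
          using S finite_U by (intro prod_zero) auto
        with False show ?thesis by simp
      qed
    qed
    also have "\<dots> = 1 - (\<Prod>u\<in>U. r u * of_bool (u \<notin> C) + (1 - r u) * 1)"
      unfolding subset_mean_add subset_mean_cmult subset_mean_prod[OF finite_U] using finite_U by simp
    also have "(\<Prod>u\<in>U. r u * of_bool (u \<notin> C) + (1 - r u) * 1) = (\<Prod>u\<in>C. 1 - r u)"
      using C finite_U by (intro prod.mono_neutral_cong_right) auto
    also have "\<dots> = exp (- (sum w C / x\<^sup>2))"
      using finite_subset[OF C(1) finite_U] by (simp add: r_def exp_sum[symmetric] sum_negf sum_divide_distrib)
    finally have eq: "subset_mean r U (\<lambda>S. of_bool (S \<inter> C \<noteq> {})) = 1 - exp (- (sum w C / x\<^sup>2))" .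
    let ?y = "exp (- f)"
    have y: "0 < ?y" "?y \<le> 1" using f_ge_1 by auto
    have "?y \<le> sum w C / x\<^sup>2" using C(2) x_pos by (simp add: field_simps)
    then have "exp (- (sum w C / x\<^sup>2)) \<le> exp (- ?y)" by simp
    also have "\<dots> \<le> 1 - ?y / 2" using y by (intro exp_minus_le_linear) auto
    finally show ?thesis unfolding eq by simp
  qed
  have "exp (- f) / 2 * G U ?Ev = G U (\<lambda>E. exp (- f) / 2 * ?Ev E)"
    unfolding graph_mean_def subset_mean_cmult ..
  also have "\<dots> \<le> G U (\<lambda>E. subset_mean r U (\<lambda>S. of_bool (?m \<le> real_of_int (surplus E S))))"
  proof (rule graph_mean_mono)
    fix E assume E: "E \<subseteq> pairs U"
    show "exp (- f) / 2 * ?Ev E \<le> subset_mean r U (\<lambda>S. of_bool (?m \<le> real_of_int (surplus E S)))"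
    proof (cases "excess_in_component ?m (\<lambda>t. x\<^sup>2 * exp (- f) \<le> t) E")
      case True
      then obtain C where C: "C \<subseteq> U" "x\<^sup>2 * exp (- f) \<le> sum w C" "\<And>i. i \<in> C \<Longrightarrow> ?m \<le> real_of_int (surplus E {i})"
        by (rule excess_in_componentE[OF E]) blast
      have "exp (- f) / 2 \<le> subset_mean r U (\<lambda>S. of_bool (S \<inter> C \<noteq> {}))" by (rule hit[OF C(1,2)])
      also have "\<dots> \<le> subset_mean r U (\<lambda>S. of_bool (?m \<le> real_of_int (surplus E S)))"
      proof (rule subset_mean_mono)
        fix S assume S: "S \<subseteq> U"
        have "?m \<le> real_of_int (surplus E S)" if "i \<in> S" "i \<in> C" for i
        proof -
          have "surplus E {i} \<le> surplus E S" by (rule surplus_mono[OF finite_U E]) (use that S in auto)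
          with C(3)[OF that(2)] show ?thesis by linarith
        qed
        then show "of_bool (S \<inter> C \<noteq> {}) \<le> (of_bool (?m \<le> real_of_int (surplus E S)) :: real)" by auto
      qed (use r in auto)
      finally show ?thesis using True by simp
    next
      case False
      then show ?thesis using r by (simp add: subset_mean_nonneg)
    qed
  qed simp
  also have "\<dots> = subset_mean r U (\<lambda>S. G U (\<lambda>E. of_bool (?m \<le> real_of_int (surplus E S))))"
    unfolding graph_mean_def by (rule subset_mean_swap)
  \<comment> \<open>The two sources of randomness are independent, so the tail bound is applied for
    fixed \<open>S\<close> and then averaged. The factor \<open>exp (sum w S / x)\<close> is written
    as a product over \<open>U\<close>; its mean is at most \<open>exp 4\<close>, as
    \<open>S\<close> has intensity \<open>w / x\<^sup>2\<close> and the squared weights sum to at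
    most \<open>2 * x ^ 3\<close>.\<close>
  also have "\<dots> \<le> subset_mean r U (\<lambda>S. 2 * exp (- 4 * f\<^sup>2) * (\<Prod>u\<in>U. if u \<in> S then exp (w u / x) else 1))"
  proof (rule subset_mean_mono)
    fix S assume S: "S \<subseteq> U"
    have "(\<Prod>u\<in>U. if u \<in> S then exp (w u / x) else 1) = (\<Prod>u\<in>S. exp (w u / x))"
      using S finite_U by (simp add: prod.If_cases Int_absorb1 Int_def[symmetric])
    also have "\<dots> = exp (sum w S / x)"
      using finite_subset[OF S finite_U] by (simp add: exp_sum sum_divide_distrib)
    finally have e: "(\<Prod>u\<in>U. if u \<in> S then exp (w u / x) else 1) = exp (sum w S / x)" .
    show "G U (\<lambda>E. of_bool (?m \<le> real_of_int (surplus E S))) \<le>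
        2 * exp (- 4 * f\<^sup>2) * (\<Prod>u\<in>U. if u \<in> S then exp (w u / x) else 1)"
      using surplus_tail_critical[OF S] unfolding e by (simp add: exp_add[symmetric] mult.assoc)
  qed (use r in auto)
  also have "\<dots> = 2 * exp (- 4 * f\<^sup>2) * (\<Prod>u\<in>U. r u * exp (w u / x) + (1 - r u) * 1)"
    unfolding subset_mean_cmult subset_mean_prod[OF finite_U] ..
  also have "\<dots> \<le> 2 * exp (- 4 * f\<^sup>2) * exp 4"
  proof (rule mult_left_mono)
    have "(\<Prod>u\<in>U. r u * exp (w u / x) + (1 - r u) * 1) \<le> (\<Prod>u\<in>U. exp (2 / x ^ 3 * (w u)\<^sup>2))"
    proof (intro prod_mono conjI)
      fix u assume u: "u \<in> U"
      show "0 \<le> r u * exp (w u / x) + (1 - r u) * 1" using r[OF u] by simp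
      have z: "0 \<le> w u / x" "w u / x \<le> 1" using w_pos[OF u] w_le_x[OF u] x_pos by auto
      have "(w u / x)\<^sup>2 \<le> w u / x"
        using z mult_left_mono[of "w u / x" 1 "w u / x"] by (simp add: power2_eq_square)
      then have "exp (w u / x) - 1 \<le> 2 * (w u / x)" using exp_quadratic_bound[OF z] by linarith
      then have "r u * (exp (w u / x) - 1) \<le> w u / x\<^sup>2 * (2 * (w u / x))"
        using r[OF u] z by (intro mult_mono) auto
      then have "r u * exp (w u / x) + (1 - r u) * 1 \<le> 1 + 2 / x ^ 3 * (w u)\<^sup>2"
        by (simp add: power2_eq_square power3_eq_cube algebra_simps)
      also have "\<dots> \<le> exp (2 / x ^ 3 * (w u)\<^sup>2)" by (rule exp_ge_add_one_self)
      finally show "r u * exp (w u / x) + (1 - r u) * 1 \<le> exp (2 / x ^ 3 * (w u)\<^sup>2)" .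
    qed
    also have "\<dots> = exp (2 / x ^ 3 * (\<Sum>u\<in>U. (w u)\<^sup>2))"
      using finite_U by (simp add: exp_sum[symmetric] sum_distrib_left)
    also have "\<dots> \<le> exp 4"
    proof -
      have "2 / x ^ 3 * (\<Sum>u\<in>U. (w u)\<^sup>2) \<le> 2 / x ^ 3 * (2 * x ^ 3)"
        by (rule mult_left_mono[OF sum2_le]) (use x_pos in auto)
      then show ?thesis using x_pos by simp
    qed
    finally show "(\<Prod>u\<in>U. r u * exp (w u / x) + (1 - r u) * 1) \<le> exp 4" .
  qed simp
  finally have "exp (- f) / 2 * G U ?Ev \<le> 2 * exp (- 4 * f\<^sup>2) * exp 4" .
  then have "2 * exp f * (exp (- f) / 2 * G U ?Ev) \<le> 2 * exp f * (2 * exp (- 4 * f\<^sup>2) * exp 4)"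
    by (intro mult_left_mono) auto
  have inv: "exp f * exp (- f) = 1" by (simp add: exp_minus)
  have "G U ?Ev = (exp f * exp (- f)) * G U ?Ev" unfolding inv by simp
  also have "\<dots> = 2 * exp f * (exp (- f) / 2 * G U ?Ev)" by simp
  also have "\<dots> \<le> 2 * exp f * (2 * exp (- 4 * f\<^sup>2) * exp 4)" by fact
  also have "\<dots> = 4 * (exp f * exp (- 4 * f\<^sup>2) * exp 4)" by simp
  also have "\<dots> = 4 * exp (4 + f - 4 * f\<^sup>2)" unfolding exp_add[symmetric] by (simp add: algebra_simps)
  finally show ?thesis .
qed

end

section \<open>Components of small weight\<close>

text \<open>The function \<open>4 * exp 1 * z * exp (- z)\<close> is at least 1 on the interval from
  1/4 to 1, and multiplying by 4 cannot jump over that interval. The alternative records that the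
  scales ran out first. The ratio is 4 because doubling theta quadruples eta.\<close>

lemma dyadic_scales_cover:
  fixes y :: real
  assumes "0 \<le> y" "y \<le> 1"
  shows "1 \<le> (\<Sum>j\<le>m. 4 * exp 1 * (4 ^ j * y) * exp (- (4 ^ j * y))) \<or> 4 ^ m * y < 1 / 4"
proof -
  let ?h = "\<lambda>z::real. 4 * exp 1 * z * exp (- z)"
  have pos: "0 \<le> ?h z" if "0 \<le> z" for z using that by simp
  have one: "1 \<le> ?h z" if "1 / 4 \<le> z" "z \<le> 1" for z
  proof -
    have "1 = 4 * exp 1 * (1 / 4) * exp (- 1 :: real)" by (simp add: exp_minus)
    also have "\<dots> \<le> ?h z" using that by (intro mult_mono) auto
    finally show ?thesis .
  qed
  show ?thesis
  proof (induction m)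
    case 0
    show ?case using one[of y] assms by auto
  next
    case (Suc m)
    have sum0: "0 \<le> (\<Sum>j\<le>m. ?h (4 ^ j * y))" using assms by (intro sum_nonneg) simp
    show ?case
    proof (cases "4 ^ m * y < 1 / 4")
      case True
      then have "4 ^ Suc m * y \<le> 1" by simp
      show ?thesis
      proof (cases "4 ^ Suc m * y < 1 / 4")
        case False
        with \<open>4 ^ Suc m * y \<le> 1\<close> have "1 \<le> ?h (4 ^ Suc m * y)" by (intro one) auto
        with sum0 have "1 \<le> (\<Sum>j\<le>m. ?h (4 ^ j * y)) + ?h (4 ^ Suc m * y)" by linarith
        then show ?thesis unfolding sum.atMost_Suc by blast
      qed blast
    next
      case False
      with Suc have "1 \<le> (\<Sum>j\<le>m. ?h (4 ^ j * y))" by blast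
      moreover have "0 \<le> ?h (4 ^ Suc m * y)" by (rule pos) (use assms in simp)
      ultimately have "1 \<le> (\<Sum>j\<le>m. ?h (4 ^ j * y)) + ?h (4 ^ Suc m * y)" by linarith
      then show ?thesis unfolding sum.atMost_Suc by blast
    qed
  qed
qed

context near_critical
begin

text \<open>Coefficient of \<open>w i / \<theta>\<close> in the second-moment bound: 3 from the
  linear drift term, 3 from squared drift and \<open>16 * S / c\<close> from the variance.\<close>

definition N :: real where "N = 6 + 16 * S / c"

lemma N_ge: "6 \<le> N" using S_pos c_pos by (simp add: N_def)

text \<open>Depletion provides \<open>c * \<theta>\<^sup>2 / 4\<close>; half of it absorbs the
  supercritical drift \<open>\<theta> * \<epsilon>\<close>, the other half remains as eta.\<close>

lemma drift_critical:
  assumes \<theta>: "0 < \<theta>" "\<theta> \<le> 1" "8 * \<epsilon> \<le> c * \<theta>"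
  shows "p * (\<Sum>u\<in>U. w u * (1 - exp (- (\<theta> * w u)))) \<le> \<theta> - c * \<theta>\<^sup>2 / 8"
proof -
  have "p * (\<Sum>u\<in>U. w u * (1 - exp (- (\<theta> * w u)))) \<le> p * (\<theta> * (\<Sum>u\<in>U. (w u)\<^sup>2) - \<theta>\<^sup>2 * (c * x ^ 3) / 4)"
    using \<theta> by (intro mult_left_mono sum_one_minus_exp p_nonneg) auto
  also have "\<dots> = \<theta> * (p * (\<Sum>u\<in>U. (w u)\<^sup>2)) - c * \<theta>\<^sup>2 / 4 * (p * x ^ 3)" by (simp add: algebra_simps)
  also have "\<dots> \<le> \<theta> * (1 + \<epsilon>) - c * \<theta>\<^sup>2 / 4 * 1"
    using \<theta> c_pos p_bounds sum2_eps by (intro diff_mono mult_left_mono) auto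
  also have "\<theta> * (1 + \<epsilon>) \<le> \<theta> + c * \<theta>\<^sup>2 / 8"
    using mult_left_mono[OF \<theta>(3), of \<theta>] \<theta> by (simp add: power2_eq_square algebra_simps)
  finally show ?thesis by simp
qed

abbreviation laplace_second_moment :: "real \<Rightarrow> 'v \<Rightarrow> real" where
  "laplace_second_moment \<eta> i \<equiv> G U (\<lambda>E. real_of_int (surplus E {i}) * (real_of_int (surplus E {i}) - 1) *
     exp (- (\<eta> * sum w (reach E {i}))))"

lemma laplace_second_moment_le:
  assumes \<theta>: "0 < \<theta>" "\<theta> \<le> 1" "8 * \<epsilon> \<le> c * \<theta>" and i: "i \<in> U"
  shows "laplace_second_moment (c * \<theta>\<^sup>2 / 8) i \<le>
    2048 / (c\<^sup>2 * \<theta> ^ 4 * x ^ 6) * ((w i)\<^sup>2 + N / \<theta> * w i)"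
proof -
  define \<eta> where "\<eta> = c * \<theta>\<^sup>2 / 8"
  have \<eta>: "0 < \<eta>" using \<theta> c_pos by (simp add: \<eta>_def)
  have wi: "0 < w i" by (rule w_pos[OF i])
  define \<beta> where "\<beta> = \<epsilon> / \<eta>"
  define s where "s = p * (\<Sum>u\<in>U. w u ^ 3) / \<eta>"
  have \<beta>: "0 \<le> \<beta>" "\<beta> \<le> 1 / \<theta>"
  proof -
    show "0 \<le> \<beta>" using eps_nonneg \<eta> by (simp add: \<beta>_def)
    have "\<epsilon> \<le> c * \<theta> / 8" using \<theta>(3) by simp
    then have "\<beta> \<le> (c * \<theta> / 8) / \<eta>" unfolding \<beta>_def using \<eta> by (intro divide_right_mono) auto
    also have "\<dots> = 1 / \<theta>" using \<theta> c_pos by (simp add: \<eta>_def power2_eq_square)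
    finally show "\<beta> \<le> 1 / \<theta>" .
  qed
  have s: "0 \<le> s" "s \<le> 16 * S / (c * \<theta>\<^sup>2)"
  proof -
    show "0 \<le> s" unfolding s_def using p_nonneg w_pos \<eta> by (auto simp: less_imp_le intro!: divide_nonneg_pos mult_nonneg_nonneg sum_nonneg)
    have "s \<le> 2 * S / \<eta>" unfolding s_def using p_sum3 \<eta> by (intro divide_right_mono) auto
    also have "\<dots> = 16 * S / (c * \<theta>\<^sup>2)" by (simp add: \<eta>_def)
    finally show "s \<le> 16 * S / (c * \<theta>\<^sup>2)" .
  qed
  have p\<eta>: "0 \<le> p / \<eta>" "p / \<eta> \<le> 16 / (c * \<theta>\<^sup>2 * x ^ 3)"
  proof -
    show "0 \<le> p / \<eta>" using p_nonneg \<eta> by simp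
    have "p \<le> 2 / x ^ 3" using p_bounds(2) x_pos by (simp add: pos_le_divide_eq)
    then have "p / \<eta> \<le> (2 / x ^ 3) / \<eta>" using \<eta> by (intro divide_right_mono) auto
    also have "\<dots> = 16 / (c * \<theta>\<^sup>2 * x ^ 3)" by (simp add: \<eta>_def)
    finally show "p / \<eta> \<le> 16 / (c * \<theta>\<^sup>2 * x ^ 3)" .
  qed
  have Q: "0 \<le> 1 - exp (- (\<theta> * w i))" "1 - exp (- (\<theta> * w i)) \<le> \<theta> * w i"
    using \<theta> wi exp_ge_add_one_self[of "- (\<theta> * w i)"] by (simp, linarith)
  have "laplace_second_moment \<eta> i \<le> 8 * (p / \<eta>)\<^sup>2 * ((sum w {i})\<^sup>2 + 3 * (\<epsilon> / \<eta>) * sum w {i} +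
      (p * (\<Sum>u\<in>U. w u ^ 3) / \<eta> + 3 * (\<epsilon> / \<eta>)\<^sup>2) * (1 - exp (- (\<theta> * sum w {i}))))"
    by (rule surplus_laplace_second_moment)
      (use i \<theta> \<eta> drift_critical[OF \<theta>] sum2_eps eps_nonneg in \<open>auto simp: \<eta>_def\<close>)
  also have "\<dots> = 8 * (p / \<eta>)\<^sup>2 * ((w i)\<^sup>2 + 3 * \<beta> * w i + (s + 3 * \<beta>\<^sup>2) * (1 - exp (- (\<theta> * w i))))"
    by (simp add: \<beta>_def s_def)
  also have "\<dots> \<le> 8 * (16 / (c * \<theta>\<^sup>2 * x ^ 3))\<^sup>2 *
      ((w i)\<^sup>2 + 3 * (1 / \<theta>) * w i + (16 * S / (c * \<theta>\<^sup>2) + 3 * (1 / \<theta>)\<^sup>2) * (\<theta> * w i))"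
    using p\<eta> \<beta> s Q wi S_pos c_pos \<theta> by (intro mult_mono add_mono mult_left_mono power_mono order_refl) auto
  also have "\<dots> = 2048 / (c\<^sup>2 * \<theta> ^ 4 * x ^ 6) * ((w i)\<^sup>2 + N / \<theta> * w i)"
  proof -
    have "8 * (16 / (c * \<theta>\<^sup>2 * x ^ 3))\<^sup>2 = 2048 / (c\<^sup>2 * \<theta> ^ 4 * x ^ 6)"
      by (simp add: power_divide power_mult_distrib power_mult[symmetric])
    moreover have "3 * (1 / \<theta>) * w i + (16 * S / (c * \<theta>\<^sup>2) + 3 * (1 / \<theta>)\<^sup>2) * (\<theta> * w i) = N / \<theta> * w i"
      using \<theta> c_pos by (simp add: N_def field_simps power2_eq_square)
    ultimately show ?thesis by (simp only: add.assoc)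
  qed
  finally show ?thesis unfolding \<eta>_def .
qed

text \<open>Up to constants, eta times the weighted sum estimates the number of components with
  surplus at least 2 and weight of order 1 / eta. The cubic decay in \<open>\<theta> * x\<close> is
  what makes the sum over scales converge.\<close>

lemma weighted_laplace_second_moment_le:
  assumes \<theta>: "0 < \<theta>" "\<theta> \<le> 1" "8 * \<epsilon> \<le> c * \<theta>"
  shows "c * \<theta>\<^sup>2 / 8 * (\<Sum>i\<in>U. w i * laplace_second_moment (c * \<theta>\<^sup>2 / 8) i) \<le>
    256 * (S + 2 * N) / (c * (\<theta> * x) ^ 3)"
proof -
  let ?K = "2048 / (c\<^sup>2 * \<theta> ^ 4 * x ^ 6)"
  have K: "0 \<le> ?K" using \<theta> x_pos by simp
  have "(\<Sum>i\<in>U. w i * laplace_second_moment (c * \<theta>\<^sup>2 / 8) i) \<le> (\<Sum>i\<in>U. w i * (?K * ((w i)\<^sup>2 + N / \<theta> * w i)))"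
    using laplace_second_moment_le[OF \<theta>] w_pos by (intro sum_mono mult_left_mono) (auto simp: less_imp_le)
  also have "\<dots> = ?K * ((\<Sum>i\<in>U. w i ^ 3) + N / \<theta> * (\<Sum>i\<in>U. (w i)\<^sup>2))"
    by (simp add: sum_distrib_left sum.distrib[symmetric] sum_divide_distrib power2_eq_square power3_eq_cube algebra_simps)
  also have "\<dots> \<le> ?K * (S * x ^ 3 / \<theta> + N / \<theta> * (2 * x ^ 3))"
  proof (intro mult_left_mono[OF _ K] add_mono)
    have "S * x ^ 3 * 1 \<le> S * x ^ 3 * (1 / \<theta>)" using \<theta> S_pos x_pos by (intro mult_left_mono) auto
    with sum3 show "(\<Sum>i\<in>U. w i ^ 3) \<le> S * x ^ 3 / \<theta>" by simp
    show "N / \<theta> * (\<Sum>i\<in>U. (w i)\<^sup>2) \<le> N / \<theta> * (2 * x ^ 3)"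
      using sum2_le N_ge \<theta> by (intro mult_left_mono) auto
  qed
  finally have "c * \<theta>\<^sup>2 / 8 * (\<Sum>i\<in>U. w i * laplace_second_moment (c * \<theta>\<^sup>2 / 8) i) \<le>
      c * \<theta>\<^sup>2 / 8 * (?K * (S * x ^ 3 / \<theta> + N / \<theta> * (2 * x ^ 3)))"
    using c_pos by (intro mult_left_mono) auto
  also have "\<dots> = 256 * (S + 2 * N) / (c * (\<theta> * x) ^ 3)"
    using \<theta> c_pos x_pos by (simp add: field_simps power_numeral_reduce)
  finally show ?thesis .
qed

lemma unweighted_laplace_second_moment_le:
  assumes "8 * \<epsilon> \<le> c"
  shows "(\<Sum>i\<in>U. laplace_second_moment (c / 8) i) \<le> 2048 * (2 + N) / (c\<^sup>2 * x ^ 3)"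
proof -
  have "(\<Sum>i\<in>U. laplace_second_moment (c / 8) i) \<le> (\<Sum>i\<in>U. 2048 / (c\<^sup>2 * x ^ 6) * ((w i)\<^sup>2 + N * w i))"
    using laplace_second_moment_le[of 1] assms by (intro sum_mono) simp
  also have "\<dots> = 2048 / (c\<^sup>2 * x ^ 6) * ((\<Sum>i\<in>U. (w i)\<^sup>2) + N * sum w U)"
    by (simp only: sum_distrib_left[symmetric] sum.distrib)
  also have "\<dots> \<le> 2048 / (c\<^sup>2 * x ^ 6) * (2 * x ^ 3 + N * x ^ 3)"
    using sum2_le sum1 x_pos by (intro mult_left_mono) auto
  also have "\<dots> = 2048 * (2 + N) / (c\<^sup>2 * x ^ 3)"
    using c_pos x_pos by (simp add: field_simps power_numeral_reduce)
  finally show ?thesis .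
qed

text \<open>
  A component of weight \<open>y\<close> is counted by its vertices with weights \<open>w i / y\<close>, where \<open>1 / y\<close> is
  replaced by a sum of the functions \<open>\<eta> * exp (- \<eta> * y)\<close> over a geometric sequence of \<open>\<eta>\<close>. Components
  of bounded weight, where such a sum degenerates, are rare enough to be counted by all their vertices.
\<close>

lemma excess_small_components:
  assumes f1: "24 * f \<le> c * exp (f / 2)" and f2: "exp (f / 2) \<le> x"
  shows "G U (\<lambda>E. of_bool (excess_in_component 2 (\<lambda>t. t \<le> x\<^sup>2 * exp (- f)) E)) \<le>
    1024 * exp 1 * (S + 2 * N) / c * exp (- f) + 1024 * exp 1 * (2 + N) / (c\<^sup>2 * x ^ 3)"
proof -
  \<comment> \<open>The lowest scale, fitted to the weight cutoff: \<open>\<eta> 0\<close> times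
    \<open>x\<^sup>2 * exp (- f)\<close> is \<open>c / 8\<close>. It must also dominate
    \<open>8 * \<epsilon> / c\<close>, which is the assumption \<open>f1\<close>, and be at most 1,
    which is \<open>f2\<close>.\<close>
  define \<theta>0 where "\<theta>0 = exp (f / 2) / x"
  define \<theta> where "\<theta> j = 2 ^ j * \<theta>0" for j :: nat
  define \<eta> where "\<eta> j = c * (\<theta> j)\<^sup>2 / 8" for j
  have \<theta>0: "0 < \<theta>0" "\<theta>0 \<le> 1" using f2 x_pos by (auto simp: \<theta>0_def)
  have eps0: "8 * \<epsilon> \<le> c * \<theta>0"
    using f1 x_pos by (simp add: \<epsilon>_def \<theta>0_def divide_right_mono)
  \<comment> \<open>The index of the last dyadic scale that is at most 1.\<close>
  obtain m where m: "2 ^ m * \<theta>0 \<le> 1" "1 < 2 ^ Suc m * \<theta>0"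
  proof -
    obtain k where k: "1 / \<theta>0 < 2 ^ k" using real_arch_pow[of 2 "1 / \<theta>0"] by auto
    define M where "M = (LEAST k. 1 < 2 ^ k * \<theta>0)"
    have "1 < 2 ^ k * \<theta>0" using k \<theta>0 by (simp add: field_simps)
    then have M: "1 < 2 ^ M * \<theta>0" unfolding M_def by (rule LeastI)
    then have "M \<noteq> 0" using \<theta>0 by (metis mult_1 not_less power_0)
    then obtain m where "M = Suc m" by (cases M) auto
    moreover have "\<not> 1 < 2 ^ m * \<theta>0" using not_less_Least[of m "\<lambda>k. 1 < 2 ^ k * \<theta>0"] \<open>M = Suc m\<close>
      unfolding M_def by simp
    ultimately show thesis using M that[of m] by simp
  qed
  have \<theta>: "0 < \<theta> j" "\<theta> j \<le> 1" "8 * \<epsilon> \<le> c * \<theta> j" if "j \<le> m" for j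
  proof -
    show "0 < \<theta> j" using \<theta>0 by (simp add: \<theta>_def)
    have "(2 :: real) ^ j \<le> 2 ^ m" using that by (intro power_increasing) auto
    then have "\<theta> j \<le> 2 ^ m * \<theta>0" unfolding \<theta>_def using \<theta>0 by (intro mult_right_mono) auto
    with m show "\<theta> j \<le> 1" by linarith
    have "1 * \<theta>0 \<le> \<theta> j" unfolding \<theta>_def using \<theta>0 by (intro mult_right_mono one_le_power) auto
    then have "c * \<theta>0 \<le> c * \<theta> j" using c_pos by simp
    with eps0 show "8 * \<epsilon> \<le> c * \<theta> j" by linarith
  qed
  have \<eta>_eq: "\<eta> j = 4 ^ j * \<eta> 0" for j
  proof -
    have "((2 :: real) ^ j)\<^sup>2 = 4 ^ j" using power_mult[of "2 :: real" 2 j] by (simp add: power_mult[symmetric] mult.commute)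
    then show ?thesis by (simp add: \<eta>_def \<theta>_def power_mult_distrib)
  qed
  have \<eta>_pos: "0 < \<eta> j" for j using \<theta>0 c_pos by (simp add: \<eta>_def \<theta>_def)
  let ?X = "\<lambda>E i. real_of_int (surplus E {i}) * (real_of_int (surplus E {i}) - 1)"
  let ?e = "\<lambda>\<eta> E i. exp (- (\<eta> * sum w (reach E {i})))"
  let ?R = "\<lambda>E. (\<Sum>j\<le>m. 2 * exp 1 * (\<eta> j * (\<Sum>i\<in>U. w i * (?X E i * ?e (\<eta> j) E i)))) +
      exp 1 / 2 * (\<Sum>i\<in>U. ?X E i * ?e (c / 8) E i)"
  have "G U (\<lambda>E. of_bool (excess_in_component 2 (\<lambda>t. t \<le> x\<^sup>2 * exp (- f)) E)) \<le> G U ?R"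
  proof (rule graph_mean_mono)
    fix E assume E: "E \<subseteq> pairs U"
    have X0: "0 \<le> ?X E i" if "i \<in> U" for i
      by (rule surplus_reach_real_nonneg(2)[OF subset_refl E]) (use that in auto)
    have t1: "0 \<le> w i * (?X E i * ?e (\<eta> j) E i)" if "i \<in> U" for i j
      using X0[OF that] w_pos[OF that] by simp
    have t2: "0 \<le> ?X E i * ?e (c / 8) E i" if "i \<in> U" for i
      using X0[OF that] by simp
    have R1: "0 \<le> (\<Sum>j\<le>m. 2 * exp 1 * (\<eta> j * (\<Sum>i\<in>U. w i * (?X E i * ?e (\<eta> j) E i))))"
    proof (rule sum_nonneg)
      fix j
      have "0 \<le> (\<Sum>i\<in>U. w i * (?X E i * ?e (\<eta> j) E i))" by (rule sum_nonneg[OF t1])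
      with \<eta>_pos[of j] show "0 \<le> 2 * exp 1 * (\<eta> j * (\<Sum>i\<in>U. w i * (?X E i * ?e (\<eta> j) E i)))" by simp
    qed
    have R2: "0 \<le> exp 1 / 2 * (\<Sum>i\<in>U. ?X E i * ?e (c / 8) E i)"
    proof (rule mult_nonneg_nonneg)
      show "0 \<le> (\<Sum>i\<in>U. ?X E i * ?e (c / 8) E i)" by (rule sum_nonneg[OF t2])
    qed simp
    show "of_bool (excess_in_component 2 (\<lambda>t. t \<le> x\<^sup>2 * exp (- f)) E) \<le> ?R E"
    proof (cases "excess_in_component 2 (\<lambda>t. t \<le> x\<^sup>2 * exp (- f)) E")
      case False
      then show ?thesis using R1 R2 by simp
    next
      case True
      obtain C where C: "C \<subseteq> U" "C \<noteq> {}" "sum w C \<le> x\<^sup>2 * exp (- f)" "\<And>i. i \<in> C \<Longrightarrow> reach E {i} = C"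
        "\<And>i. i \<in> C \<Longrightarrow> 2 \<le> real_of_int (surplus E {i})"
        by (rule excess_in_componentE[OF E True]) blast
      define y where "y = sum w C"
      have finC: "finite C" using C(1) finite_U finite_subset by auto
      have y: "0 < y" unfolding y_def using C w_pos finC by (intro sum_pos) auto
      have X2: "2 \<le> ?X E i" if "i \<in> C" for i
        using mult_mono[of 2 "real_of_int (surplus E {i})" 1 "real_of_int (surplus E {i}) - 1"] C(5)[OF that] by simp
      have y0: "\<eta> 0 * y \<le> 1"
      proof -
        have "\<eta> 0 * y \<le> \<eta> 0 * (x\<^sup>2 * exp (- f))"
          using C(3) \<eta>_pos[of 0] by (intro mult_left_mono) (auto simp: y_def)
        also have "\<dots> = c / 8 * (exp (f / 2) * exp (f / 2) * exp (- f))"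
          using x_pos by (simp add: \<eta>_def \<theta>_def \<theta>0_def power2_eq_square)
        also have "exp (f / 2) * exp (f / 2) * exp (- f) = 1" by (simp add: exp_add[symmetric])
        finally show ?thesis using c_le_1 by simp
      qed
      have scale: "2 * (y * exp (- (\<eta> j * y))) \<le> (\<Sum>i\<in>U. w i * (?X E i * ?e (\<eta> j) E i))" for j
      proof -
        have "2 * (y * exp (- (\<eta> j * y))) = (\<Sum>i\<in>C. w i * (2 * exp (- (\<eta> j * y))))"
          by (simp add: y_def sum_distrib_left sum_distrib_right mult_ac)
        also have "\<dots> \<le> (\<Sum>i\<in>C. w i * (?X E i * ?e (\<eta> j) E i))"
          using X2 C w_pos by (intro sum_mono mult_left_mono) (auto simp: y_def less_imp_le subset_iff)
        also have "\<dots> \<le> (\<Sum>i\<in>U. w i * (?X E i * ?e (\<eta> j) E i))"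
          by (rule sum_mono2) (use C finite_U t1 in auto)
        finally show ?thesis .
      qed
      from dyadic_scales_cover[of "\<eta> 0 * y" m] y0 y \<eta>_pos[of 0]
      consider "1 \<le> (\<Sum>j\<le>m. 4 * exp 1 * (4 ^ j * (\<eta> 0 * y)) * exp (- (4 ^ j * (\<eta> 0 * y))))"
        | "4 ^ m * (\<eta> 0 * y) < 1 / 4" by fastforce
      then have "1 \<le> ?R E"
      proof cases
        case 1
        also have "(\<Sum>j\<le>m. 4 * exp 1 * (4 ^ j * (\<eta> 0 * y)) * exp (- (4 ^ j * (\<eta> 0 * y)))) =
            (\<Sum>j\<le>m. 2 * exp 1 * (\<eta> j * (2 * (y * exp (- (\<eta> j * y))))))"
        proof (rule sum.cong[OF refl])
          fix j
          have e: "4 ^ j * (\<eta> 0 * y) = \<eta> j * y" by (simp add: \<eta>_eq[of j])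
          show "4 * exp 1 * (4 ^ j * (\<eta> 0 * y)) * exp (- (4 ^ j * (\<eta> 0 * y))) =
              2 * exp 1 * (\<eta> j * (2 * (y * exp (- (\<eta> j * y)))))"
            unfolding e by simp
        qed
        also have "\<dots> \<le> (\<Sum>j\<le>m. 2 * exp 1 * (\<eta> j * (\<Sum>i\<in>U. w i * (?X E i * ?e (\<eta> j) E i))))"
          using scale \<eta>_pos by (intro sum_mono mult_left_mono) (auto simp: less_imp_le)
        finally show ?thesis using R2 by linarith
      next
        case 2
        \<comment> \<open>All scales were too small for \<open>y\<close>, while
          \<open>\<eta> m\<close> is at least \<open>c / 32\<close>, so \<open>y\<close> is below
          \<open>8 / c\<close>. A single vertex in the sum at rate \<open>c / 8\<close> then
          suffices.\<close>
        have "1 < 2 * \<theta> m" using m(2) by (simp add: \<theta>_def)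
        then have "1 * 1 \<le> (2 * \<theta> m) * (2 * \<theta> m)" by (intro mult_mono) auto
        then have "c / 32 * 1 \<le> c / 32 * (4 * (\<theta> m)\<^sup>2)"
          using c_pos by (intro mult_left_mono) (auto simp: power2_eq_square)
        then have "c / 32 \<le> \<eta> m" by (simp add: \<eta>_def)
        then have "c / 32 * y \<le> \<eta> m * y" using y by (intro mult_right_mono) auto
        also have "\<dots> < 1 / 4" using 2 by (simp add: \<eta>_eq[of m] mult.assoc)
        finally have cy: "c / 8 * y \<le> 1" by simp
        obtain i where i: "i \<in> C" using C by auto
        have "1 = exp 1 / 2 * (2 * exp (- 1 :: real))" by (simp add: exp_minus)
        also have "\<dots> \<le> exp 1 / 2 * (?X E i * ?e (c / 8) E i)"
          using cy X2[OF i] C(4)[OF i] by (intro mult_left_mono mult_mono) (auto simp: y_def)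
        also have "\<dots> \<le> exp 1 / 2 * (\<Sum>i\<in>U. ?X E i * ?e (c / 8) E i)"
          using t2 C i finite_U by (intro mult_left_mono member_le_sum) auto
        finally show ?thesis using R1 by linarith
      qed
      then show ?thesis using True by simp
    qed
  qed simp
  also have "\<dots> = (\<Sum>j\<le>m. 2 * exp 1 * (\<eta> j * (\<Sum>i\<in>U. w i * laplace_second_moment (\<eta> j) i))) +
      exp 1 / 2 * (\<Sum>i\<in>U. laplace_second_moment (c / 8) i)"
    unfolding graph_mean_def subset_mean_add subset_mean_cmult subset_mean_sum ..
  also have "\<dots> \<le> (\<Sum>j\<le>m. 2 * exp 1 * (256 * (S + 2 * N) / (c * (\<theta> j * x) ^ 3))) +
      exp 1 / 2 * (2048 * (2 + N) / (c\<^sup>2 * x ^ 3))"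
  proof (intro add_mono sum_mono mult_left_mono)
    fix j assume "j \<in> {..m}"
    then show "\<eta> j * (\<Sum>i\<in>U. w i * laplace_second_moment (\<eta> j) i) \<le> 256 * (S + 2 * N) / (c * (\<theta> j * x) ^ 3)"
      unfolding \<eta>_def using \<theta> by (intro weighted_laplace_second_moment_le) auto
  next
    have "c * \<theta>0 \<le> c * 1" using \<theta>0 c_pos by (intro mult_left_mono) auto
    with eps0 show "(\<Sum>i\<in>U. laplace_second_moment (c / 8) i) \<le> 2048 * (2 + N) / (c\<^sup>2 * x ^ 3)"
      by (intro unweighted_laplace_second_moment_le) simp
  qed auto
  also have "(\<Sum>j\<le>m. 2 * exp 1 * (256 * (S + 2 * N) / (c * (\<theta> j * x) ^ 3))) \<le> 1024 * exp 1 * (S + 2 * N) / c * exp (- f)"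
  proof -
    let ?K = "512 * exp 1 * (S + 2 * N) / c * exp (- f)"
    have K: "0 \<le> ?K" using S_pos N_ge c_pos by simp
    have "(\<Sum>j\<le>m. 2 * exp 1 * (256 * (S + 2 * N) / (c * (\<theta> j * x) ^ 3))) \<le> (\<Sum>j\<le>m. ?K * (1 / 2) ^ j)"
    proof (rule sum_mono)
      fix j
      \<comment> \<open>The cube of \<open>\<theta> j * x\<close> is
        \<open>exp (3 * f / 2) * 8 ^ j\<close>; a weaker bound is enough for the rate
        \<open>exp (- f)\<close> and a geometric sum.\<close>
      have "exp f * 2 ^ j \<le> (exp (f / 2)) ^ 3 * (2 ^ j) ^ 3"
      proof (rule mult_mono)
        have "exp f \<le> exp (3 * (f / 2))" using f_ge_1 by simp
        then show "exp f \<le> exp (f / 2) ^ 3" by (simp add: exp_of_nat_mult[symmetric])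
        show "(2 :: real) ^ j \<le> (2 ^ j) ^ 3" by (rule self_le_power) auto
      qed auto
      also have "\<dots> = (\<theta> j * x) ^ 3" using x_pos by (simp add: \<theta>_def \<theta>0_def power_mult_distrib mult.commute)
      finally have le: "exp f * 2 ^ j \<le> (\<theta> j * x) ^ 3" .
      have "2 * exp 1 * (256 * (S + 2 * N) / (c * (\<theta> j * x) ^ 3)) = 512 * exp 1 * (S + 2 * N) / c * (1 / (\<theta> j * x) ^ 3)"
        by simp
      also have "\<dots> \<le> 512 * exp 1 * (S + 2 * N) / c * (1 / (exp f * 2 ^ j))"
      proof (intro mult_left_mono divide_left_mono le)
        have "0 < exp f * 2 ^ j" by simp
        with le have "0 < (\<theta> j * x) ^ 3" by linarith
        then show "0 < (\<theta> j * x) ^ 3 * (exp f * 2 ^ j)" by simp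
      qed (use S_pos N_ge c_pos in auto)
      also have "\<dots> = ?K * (1 / 2) ^ j" by (simp add: exp_minus power_one_over field_simps)
      finally show "2 * exp 1 * (256 * (S + 2 * N) / (c * (\<theta> j * x) ^ 3)) \<le> ?K * (1 / 2) ^ j" .
    qed
    also have "\<dots> = ?K * (\<Sum>j<Suc m. (1 / 2) ^ j)" by (simp add: sum_distrib_left lessThan_Suc_atMost)
    also have "\<dots> \<le> ?K * 2"
      by (rule mult_left_mono[OF _ K]) (simp add: geometric_sum)
    finally show ?thesis by simp
  qed
  also have "exp 1 / 2 * (2048 * (2 + N) / (c\<^sup>2 * x ^ 3)) = 1024 * exp 1 * (2 + N) / (c\<^sup>2 * x ^ 3)"
  proof -
    have "exp 1 / 2 * (2048 * a / b) = 1024 * exp 1 * a / b" for a b :: real by simp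
    then show ?thesis .
  qed
  finally show ?thesis by simp
qed

section \<open>Combined tail bound for the excess of all components\<close>

definition tail_const :: "real \<Rightarrow> real" where
  "tail_const K = 2 * exp 1 + 4 * exp 4 + 1024 * exp 1 * (S + 2 * N) / c + 1024 * exp 1 * (2 + N) / c\<^sup>2 * K"

lemma excess_tail:
  assumes K: "0 \<le> K" "real (card U) \<le> K * x ^ 3" and U: "U \<noteq> {}"
    and f1: "24 * f \<le> c * exp (f / 2)"
    and f2: "exp (f\<^sup>2) < real (card U) \<Longrightarrow> exp (f / 2) \<le> x"
  shows "G U (\<lambda>E. of_bool (excess_in_component (surplus_const * f ^ 3) (\<lambda>_. True) E)) \<le> tail_const K * exp (- f)"
proof -
  let ?m = "surplus_const * f ^ 3"
  have ff: "f \<le> f\<^sup>2" using f_ge_1 self_le_power[of f 2] by simp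
  let ?c1 = "2 * exp 1 :: real" and ?c2 = "4 * exp 4 :: real" and ?c3 = "1024 * exp 1 * (S + 2 * N) / c"
    and ?c4 = "1024 * exp 1 * (2 + N) / c\<^sup>2"
  have c: "0 \<le> ?c3" "0 \<le> ?c4" using S_pos N_ge c_pos by auto
  have ty: "tail_const K * exp (- f) = ?c1 * exp (- f) + ?c2 * exp (- f) + ?c3 * exp (- f) + ?c4 * (K * exp (- f))"
    by (simp add: tail_const_def algebra_simps)
  have pos: "0 \<le> ?c1 * exp (- f)" "0 \<le> ?c2 * exp (- f)" "0 \<le> ?c3 * exp (- f)" "0 \<le> ?c4 * (K * exp (- f))"
    using c K by (simp_all del: times_divide_eq_left times_divide_eq_right)
  show ?thesis
  proof (cases "real (card U) \<le> exp (f\<^sup>2)")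
    case True
    have "real (card U) * (2 * exp (1 - 4 * f\<^sup>2)) \<le> exp (f\<^sup>2) * (2 * exp (1 - 4 * f\<^sup>2))"
      using True by (intro mult_right_mono) auto
    also have "\<dots> = 2 * exp (1 - 3 * f\<^sup>2)" by (simp add: exp_add[symmetric])
    also have "\<dots> \<le> 2 * exp (1 - f)" using ff f_ge_1 by simp
    also have "\<dots> = ?c1 * exp (- f)" by (simp add: exp_diff exp_minus divide_simps)
    finally show ?thesis using excess_union_bound pos unfolding ty by linarith
  next
    case False
    \<comment> \<open>Light components are tested only for excess at least 2, so the threshold must
      be at least that.\<close>
    have m2: "2 \<le> ?m"
    proof -
      have "1 * 1 \<le> B * (3 * B + 2 * S * B + 4)" using B_ge S_pos by (intro mult_mono) auto
      then have "4 \<le> surplus_const" by (simp add: surplus_const_def)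
      moreover have "1 \<le> f ^ 3" using f_ge_1 by (intro one_le_power) auto
      ultimately have "4 * 1 \<le> ?m" by (intro mult_mono) auto
      then show ?thesis by simp
    qed
    have "G U (\<lambda>E. of_bool (excess_in_component ?m (\<lambda>_. True) E)) \<le>
        G U (\<lambda>E. of_bool (excess_in_component ?m (\<lambda>t. x\<^sup>2 * exp (- f) \<le> t) E) +
          of_bool (excess_in_component 2 (\<lambda>t. t \<le> x\<^sup>2 * exp (- f)) E))"
    proof (rule graph_mean_mono)
      fix E
      have "excess_in_component ?m (\<lambda>t. x\<^sup>2 * exp (- f) \<le> t) E \<or> excess_in_component 2 (\<lambda>t. t \<le> x\<^sup>2 * exp (- f)) E"
        if "excess_in_component ?m (\<lambda>_. True) E"
        using that m2 unfolding excess_in_component_def by (meson linear order_trans)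
      then show "of_bool (excess_in_component ?m (\<lambda>_. True) E) \<le>
          (of_bool (excess_in_component ?m (\<lambda>t. x\<^sup>2 * exp (- f) \<le> t) E) +
          of_bool (excess_in_component 2 (\<lambda>t. t \<le> x\<^sup>2 * exp (- f)) E) :: real)" by auto
    qed simp
    also have "\<dots> = G U (\<lambda>E. of_bool (excess_in_component ?m (\<lambda>t. x\<^sup>2 * exp (- f) \<le> t) E)) +
        G U (\<lambda>E. of_bool (excess_in_component 2 (\<lambda>t. t \<le> x\<^sup>2 * exp (- f)) E))"
      unfolding graph_mean_def subset_mean_add ..
    also have "\<dots> \<le> 4 * exp (4 + f - 4 * f\<^sup>2) + (?c3 * exp (- f) + 1024 * exp 1 * (2 + N) / (c\<^sup>2 * x ^ 3))"
      by (intro add_mono excess_large_components excess_small_components f1 f2) (use False in auto)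
    also have "\<dots> \<le> ?c2 * exp (- f) + (?c3 * exp (- f) + ?c4 * (K * exp (- f)))"
    proof (intro add_mono order_refl)
      have "4 + f - 4 * f\<^sup>2 \<le> 4 + (- f)" using ff f_ge_1 by linarith
      then have "exp (4 + f - 4 * f\<^sup>2) \<le> exp (4 + (- f))" by simp
      then show "4 * exp (4 + f - 4 * f\<^sup>2) \<le> ?c2 * exp (- f)" unfolding exp_add by simp
      have card: "0 < real (card U)" using U finite_U by (simp add: card_gt_0_iff)
      \<comment> \<open>Components of bounded weight contribute order 1 / n; in this case n exceeds
        \<open>exp (f\<^sup>2)\<close>, hence \<open>exp f\<close>.\<close>
      have "1 / x ^ 3 \<le> K / real (card U)" using K(2) card x_pos by (simp add: field_simps)
      also have "\<dots> \<le> K / exp f"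
      proof (rule divide_left_mono)
        have "exp f \<le> exp (f\<^sup>2)" using ff by simp
        then show "exp f \<le> real (card U)" using False by linarith
      qed (use K card in auto)
      also have "\<dots> = K * exp (- f)" by (simp add: exp_minus divide_inverse)
      finally have "?c4 * (1 / x ^ 3) \<le> ?c4 * (K * exp (- f))" using c by (intro mult_left_mono) auto
      then show "1024 * exp 1 * (2 + N) / (c\<^sup>2 * x ^ 3) \<le> ?c4 * (K * exp (- f))" by simp
    qed
    finally show ?thesis using pos unfolding ty by linarith
  qed
qed

end

section \<open>Asymptotics of the weights\<close>

lemma vertex_pairs_eq: "vertex_pairs n = pairs {1..n}"
  by (simp add: vertex_pairs_def pairs_def)

lemma random_graph_prob:
  assumes "weighted_vertices {1..n} w p"
  shows "measure_pmf.prob (random_graph n w p) Q = graph_mean w p {1..n} (indicator Q)"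
  unfolding random_graph_def vertex_pairs_eq graph_mean_def
  by (intro prob_random_subset weighted_vertices.edge_prob_bounds[OF assms] finite_pairs) auto

lemma random_graph_excess_tail:
  assumes nc: "near_critical {1..n} w p x f S c" and n: "1 \<le> n"
    and K: "0 \<le> K" "real n \<le> K * x ^ 3"
    and f1: "24 * f \<le> c * exp (f / 2)"
    and f2: "exp (f\<^sup>2) < real n \<Longrightarrow> exp (f / 2) \<le> x"
    and A: "1 \<le> A" "near_critical.surplus_const S c \<le> A" "near_critical.tail_const S c K \<le> A"
  shows "measure_pmf.prob (random_graph n w p) {E. A * f ^ 3 \<le> real (largest_component_excess n E)}
    \<le> A * exp (- f / A)"
proof -
  interpret near_critical "{1..n}" w p x f S c by fact
  have "weighted_vertices {1..n} w p" by unfold_locales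
  then have "measure_pmf.prob (random_graph n w p) {E. A * f ^ 3 \<le> real (largest_component_excess n E)} =
      G {1..n} (indicator {E. A * f ^ 3 \<le> real (largest_component_excess n E)})"
    by (rule random_graph_prob)
  also have "\<dots> \<le> G {1..n} (\<lambda>E. of_bool (excess_in_component (surplus_const * f ^ 3) (\<lambda>_. True) E))"
  proof (rule graph_mean_mono)
    fix E
    have "surplus_const * f ^ 3 \<le> A * f ^ 3" using A f_ge_1 by (intro mult_right_mono) auto
    then have "excess_in_component (surplus_const * f ^ 3) (\<lambda>_. True) E"
      if "A * f ^ 3 \<le> real (largest_component_excess n E)"
      using largest_component_excess_ge[OF n that] unfolding excess_in_component_def by (meson order_trans)
    then show "indicator {E. A * f ^ 3 \<le> real (largest_component_excess n E)} E \<le>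
        (of_bool (excess_in_component (surplus_const * f ^ 3) (\<lambda>_. True) E) :: real)"
      by (auto simp: indicator_def)
  qed simp
  also have "\<dots> \<le> tail_const K * exp (- f)"
    by (rule excess_tail) (use K n f1 f2 in auto)
  also have "\<dots> \<le> A * exp (- f / A)"
  proof (rule mult_mono)
    have "f / A \<le> f / 1" using A f_ge_1 by (intro divide_left_mono) auto
    then show "exp (- f) \<le> exp (- f / A)" by simp
  qed (use A in auto)
  finally show ?thesis .
qed

lemma weak_conv_uniform_average:
  fixes w :: "nat \<Rightarrow> nat \<Rightarrow> real" and g :: "real \<Rightarrow> real"
  assumes \<mu>: "real_distribution \<mu>" and wc: "weak_conv_m (\<lambda>n. distr (uniform_count_measure {1..n}) borel (w n)) \<mu>"
    and g: "\<And>x. isCont g x" "\<And>x. norm (g x) \<le> b"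
  shows "(\<lambda>n. (\<Sum>i=1..n. g (w n i)) / real n) \<longlonglongrightarrow> (\<integral>x. g x \<partial>\<mu>)"
\<comment> \<open>The index is shifted because for \<open>n = 0\<close> the uniform measure lives on
  the empty set and is not a probability measure.\<close>
proof (rule LIMSEQ_imp_Suc)
  let ?M = "\<lambda>n. distr (uniform_count_measure {1..n}) borel (w n)"
  have meas: "w n \<in> borel_measurable (uniform_count_measure {1..n})" for n
    by (simp add: measurable_def)
  have rd: "real_distribution (?M (Suc n))" for n
  proof -
    interpret prob_space "uniform_count_measure {1..Suc n}"
      by (rule prob_space_uniform_count_measure) auto
    show ?thesis by (rule real_distribution_distr) (rule meas)
  qed
  have "weak_conv_m (\<lambda>n. ?M (Suc n)) \<mu>"
    unfolding weak_conv_m_def weak_conv_def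
  proof (intro allI impI)
    fix x assume "isCont (cdf \<mu>) x"
    then have "(\<lambda>n. cdf (?M n) x) \<longlonglongrightarrow> cdf \<mu> x" using wc by (simp add: weak_conv_m_def weak_conv_def)
    then show "(\<lambda>n. cdf (?M (Suc n)) x) \<longlonglongrightarrow> cdf \<mu> x" by (rule LIMSEQ_Suc)
  qed
  from weak_conv_imp_integral_bdd_continuous_conv[OF rd \<mu> this g]
  have "(\<lambda>n. \<integral>x. g x \<partial>?M (Suc n)) \<longlonglongrightarrow> (\<integral>x. g x \<partial>\<mu>)" .
  moreover have "g \<in> borel_measurable borel"
    using g(1) by (intro borel_measurable_continuous_onI continuous_at_imp_continuous_on) auto
  then have "(\<integral>x. g x \<partial>?M (Suc n)) = (\<Sum>i=1..Suc n. g (w (Suc n) i)) / real (Suc n)" for n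
    by (subst integral_distr[OF meas]) (auto simp: integral_uniform_count_measure)
  ultimately show "(\<lambda>n. (\<Sum>i=1..Suc n. g (w (Suc n) i)) / real (Suc n)) \<longlonglongrightarrow> (\<integral>x. g x \<partial>\<mu>)"
    by simp
qed

text \<open>A bounded continuous test function below \<open>t\<^sup>2 * min t 1\<close> for positive
  \<open>t\<close>, so that weak convergence alone yields the lower bound \<open>sum_min\<close>.
  The truncation at 0 makes it bounded on the whole line.\<close>

definition truncated_cube :: "real \<Rightarrow> real" where
  "truncated_cube t = (min (max t 0) 1) ^ 3"

lemma truncated_cube:
  shows "isCont truncated_cube t" "norm (truncated_cube t) \<le> 1" "0 \<le> truncated_cube t"
    "0 < t \<Longrightarrow> 0 < truncated_cube t" "0 < t \<Longrightarrow> truncated_cube t \<le> t\<^sup>2 * min t 1"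
proof -
  show "isCont truncated_cube t" unfolding truncated_cube_def by (intro continuous_intros)
  show "norm (truncated_cube t) \<le> 1" "0 \<le> truncated_cube t"
    unfolding truncated_cube_def by (auto simp: power_le_one_iff intro!: power_le_one)
  show "0 < t \<Longrightarrow> 0 < truncated_cube t" by (simp add: truncated_cube_def)
  assume t: "0 < t"
  have "(min t 1) ^ 3 = (min t 1)\<^sup>2 * min t 1" by (simp add: power2_eq_square power3_eq_cube)
  also have "\<dots> \<le> t\<^sup>2 * min t 1" using t by (intro mult_right_mono power_mono) auto
  finally show "truncated_cube t \<le> t\<^sup>2 * min t 1" using t by (simp add: truncated_cube_def)
qed

text \<open>Almost sure positivity of W makes these integrals positive; the truncated one is what
  makes the depletion constant positive.\<close>

lemma limit_weight_moments_pos: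
  assumes "real_distribution \<mu>" "AE x in \<mu>. 0 < x" "integrable \<mu> (\<lambda>x. x ^ 3)"
  shows "0 < (\<integral>x. x \<partial>\<mu>)" "0 \<le> (\<integral>x. x ^ 3 \<partial>\<mu>)" "0 < (\<integral>x. truncated_cube x \<partial>\<mu>)"
proof -
  interpret real_distribution \<mu> by fact
  have pos: "0 < (\<integral>x. h x \<partial>\<mu>)"
    if "integrable \<mu> h" "AE x in \<mu>. 0 < h x" for h :: "real \<Rightarrow> real"
  proof -
    have "AE x in \<mu>. 0 \<le> h x" using that(2) by eventually_elim simp
    moreover have "\<not> (AE x in \<mu>. h x = 0)"
    proof
      assume "AE x in \<mu>. h x = 0"
      with that(2) have "AE x in \<mu>. False" by eventually_elim simp
      then show False by simp
    qed
    ultimately show ?thesis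
      using integral_nonneg_eq_0_iff_AE[OF that(1)] integral_nonneg_AE[where M = \<mu> and f = h] by force
  qed
  have "integrable \<mu> (\<lambda>x. 1 + \<bar>x ^ 3\<bar>)" using assms(3) by (intro Bochner_Integration.integrable_add integrable_abs) auto
  then have "integrable \<mu> (\<lambda>x. x)"
  proof (rule Bochner_Integration.integrable_bound)
    have "\<bar>x\<bar> \<le> 1 + \<bar>x ^ 3\<bar>" for x :: real
      using self_le_power[of "\<bar>x\<bar>" 3] zero_le_power[of "\<bar>x\<bar>" 3]
      by (cases "\<bar>x\<bar> \<le> 1") (auto simp: power_abs intro: add_increasing2)
    then show "AE x in \<mu>. norm x \<le> norm (1 + \<bar>x ^ 3\<bar>)" by simp
  qed simp
  then show "0 < (\<integral>x. x \<partial>\<mu>)" using assms(2) by (rule pos)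
  show "0 \<le> (\<integral>x. x ^ 3 \<partial>\<mu>)" by (rule integral_nonneg_AE) (use assms(2) in \<open>eventually_elim, simp\<close>)
  have "truncated_cube \<in> borel_measurable borel"
    using truncated_cube(1) by (intro borel_measurable_continuous_onI continuous_at_imp_continuous_on) auto
  then have "integrable \<mu> truncated_cube"
    by (intro integrable_const_bound[where B = 1]) (auto intro: truncated_cube(2)[simplified])
  then show "0 < (\<integral>x. truncated_cube x \<partial>\<mu>)"
    by (rule pos) (use assms(2) in \<open>eventually_elim, simp add: truncated_cube(4)\<close>)
qed

theorem theorem2:
  fixes \<mu> :: "real measure"
  shows "\<exists>F>0. \<exists>A>0. \<forall>w. weight_array w \<and> weight_conditions \<mu> w \<longrightarrow>
    (\<forall>f :: nat \<Rightarrow> real. f \<in> o(\<lambda>n. real n powr (1/3)) \<and> (\<forall>n\<ge>1. F \<le> f n) \<longrightarrow>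
      (\<forall>\<^sub>F n in sequentially.
        measure_pmf.prob (random_graph n (w n) (edge_parameter w f n))
          {E. A * f n ^ 3 \<le> real (largest_component_excess n E)}
        \<le> A * exp (- f n / A)))"
proof -
  define m1 where "m1 = (\<integral>x. x \<partial>\<mu>)"
  define m3 where "m3 = (\<integral>x. x ^ 3 \<partial>\<mu>)"
  define \<gamma> where "\<gamma> = (\<integral>x. truncated_cube x \<partial>\<mu>)"
  \<comment> \<open>For large n the total weight lies between \<open>m1 * n / 2\<close> and
    \<open>2 * m1 * n\<close>. The lower bound gives \<open>K\<close>, and with it \<open>S\<close>;
    the upper bound turns \<open>\<gamma> * n / 2\<close> into \<open>\<gamma> / (4 * m1)\<close>
    times the total weight.\<close>
  define S where "S = 2 * (m3 + 1) / m1"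
  define c where "c = min 1 (\<gamma> / (4 * m1))"
  define K where "K = 2 / m1"
  \<comment> \<open>Since \<open>exp y\<close> is at least \<open>y ^ 2 / 2\<close>,
    \<open>192 / c\<close> ensures \<open>24 * f \<le> c * exp (f / 2)\<close>; the value 4 ensures
    that \<open>f / 2\<close> is at most \<open>f ^ 2 / 8\<close>.\<close>
  define F where "F = max 4 (192 / c)"
  \<comment> \<open>The locale constants, taken as functions of their parameters, depend only on
    \<open>S\<close>, \<open>c\<close> and \<open>K\<close>, hence only on \<open>\<mu>\<close>;
    this allows \<open>A\<close> to be fixed before \<open>w\<close> and \<open>f\<close>.\<close>
  define A where "A = max 1 (max (near_critical.surplus_const S c) (near_critical.tail_const S c K))"
  have main: "\<forall>\<^sub>F n in sequentially.
      measure_pmf.prob (random_graph n (w n) (edge_parameter w f n))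
        {E. A * f n ^ 3 \<le> real (largest_component_excess n E)}
      \<le> A * exp (- f n / A)"
    if wa: "weight_array w" and wc: "weight_conditions \<mu> w"
      and fo: "f \<in> o(\<lambda>n. real n powr (1/3))" and fF: "\<forall>n\<ge>1. F \<le> f n"
    for w :: "nat \<Rightarrow> nat \<Rightarrow> real" and f :: "nat \<Rightarrow> real"
  proof -
    have rd: "real_distribution \<mu>" and AE: "AE x in \<mu>. 0 < x" and int3: "integrable \<mu> (\<lambda>x. x ^ 3)"
      and weak: "weak_conv_m (\<lambda>n. distr (uniform_count_measure {1..n}) borel (w n)) \<mu>"
      and m2: "(\<integral>x. x ^ 2 \<partial>\<mu>) = m1"
      and o1: "(\<lambda>n. total_weight w n - m1 * real n) \<in> o(\<lambda>n. real n powr (2/3))"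
      and o2: "(\<lambda>n. (\<Sum>k=1..n. w n k ^ 2) - (\<integral>x. x ^ 2 \<partial>\<mu>) * real n) \<in> o(\<lambda>n. real n powr (2/3))"
      and o3: "(\<lambda>n. (\<Sum>k=1..n. w n k ^ 3) - m3 * real n) \<in> o(\<lambda>n. 1)"
      and o4: "(\<lambda>n. Max (w n ` {1..n})) \<in> o(\<lambda>n. real n powr (1/3))"
      using wc by (auto simp: weight_conditions_def m1_def m3_def)
    note limit_weight_moments_pos[OF rd AE int3]
    then have m1: "0 < m1" and m3: "0 \<le> m3" and \<gamma>: "0 < \<gamma>" by (auto simp: m1_def m3_def \<gamma>_def)
    have S: "0 < S" and c: "0 < c" "c \<le> 1" and K: "0 < K"
      using m1 m3 \<gamma> by (auto simp: S_def c_def K_def)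
    \<comment> \<open>Eventually \<open>d * real n powr (1/3)\<close> is a lower bound for
      \<open>x\<close>, so each little-o condition is used with a threshold expressed in
      \<open>d\<close>.\<close>
    define d where "d = (m1 / 2) powr (1/3)"
    have d: "0 < d" using m1 by (simp add: d_def)
    define L where "L = 2 * ((16 + 8 * S) / c)"
    have L: "0 < L" using S c by (simp add: L_def)
    have wpos: "0 < w n i" if "1 \<le> n" "i \<in> {1..n}" for n i using wa that by (auto simp: weight_array_def)
    have ev1: "\<forall>\<^sub>F n in sequentially. \<bar>total_weight w n - m1 * real n\<bar> \<le> m1 / 2 * real n powr (2/3)"
      using landau_o.smallD[OF o1, of "m1 / 2"] m1 by simp
    \<comment> \<open>Half of the error \<open>x\<^sup>2\<close> in the second moment comes from
      here, half from \<open>ev3\<close>. Criticality, in the form of \<open>m2\<close>, makes the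
      linear terms of the first and second moments cancel.\<close>
    have ev2: "\<forall>\<^sub>F n in sequentially. \<bar>total_weight w n - m1 * real n\<bar> \<le> d\<^sup>2 / 2 * real n powr (2/3)"
      using landau_o.smallD[OF o1, of "d\<^sup>2 / 2"] d by simp
    have ev3: "\<forall>\<^sub>F n in sequentially. \<bar>(\<Sum>k=1..n. (w n k)\<^sup>2) - m1 * real n\<bar> \<le> d\<^sup>2 / 2 * real n powr (2/3)"
      using landau_o.smallD[OF o2, of "d\<^sup>2 / 2"] d by (simp add: m2)
    have ev4: "\<forall>\<^sub>F n in sequentially. \<bar>(\<Sum>k=1..n. w n k ^ 3) - m3 * real n\<bar> \<le> 1"
      using landau_o.smallD[OF o3, of 1] by simp
    have ev5: "\<forall>\<^sub>F n in sequentially. \<bar>Max (w n ` {1..n})\<bar> \<le> d * real n powr (1/3)"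
      using landau_o.smallD[OF o4, of d] d by simp
    have ev6: "\<forall>\<^sub>F n in sequentially. \<bar>f n\<bar> \<le> d / L * real n powr (1/3)"
      using landau_o.smallD[OF fo, of "d / L"] d L by simp
    have ev7: "\<forall>\<^sub>F n in sequentially. \<gamma> / 2 < (\<Sum>i=1..n. truncated_cube (w n i)) / real n"
      using order_tendstoD(1)[OF weak_conv_uniform_average[OF rd weak truncated_cube(1,2)], of "\<gamma> / 2"] \<gamma>
      by (simp add: \<gamma>_def)
    \<comment> \<open>If \<open>exp (f\<^sup>2) < n\<close>, then \<open>exp (f / 2)\<close> is at
      most \<open>exp (f\<^sup>2 / 8)\<close> and hence at most n^(1/8), which is below
      \<open>x\<close>.\<close>
    have ev8: "\<forall>\<^sub>F n in sequentially. real n powr (1/8) \<le> d * real n powr (1/3)"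
      using d by real_asymp
    have ev9: "\<forall>\<^sub>F n in sequentially. 1 \<le> d * real n powr (1/3)"
      using d by real_asymp
    show ?thesis
      using ev1 ev2 ev3 ev4 ev5 ev6 ev7 ev8 ev9 eventually_ge_at_top[of 1]
    proof eventually_elim
      fix n :: nat
      assume e1: "\<bar>total_weight w n - m1 * real n\<bar> \<le> m1 / 2 * real n powr (2/3)"
        and e2: "\<bar>total_weight w n - m1 * real n\<bar> \<le> d\<^sup>2 / 2 * real n powr (2/3)"
        and e3: "\<bar>(\<Sum>k=1..n. (w n k)\<^sup>2) - m1 * real n\<bar> \<le> d\<^sup>2 / 2 * real n powr (2/3)"
        and e4: "\<bar>(\<Sum>k=1..n. w n k ^ 3) - m3 * real n\<bar> \<le> 1"
        and e5: "\<bar>Max (w n ` {1..n})\<bar> \<le> d * real n powr (1/3)"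
        and e6: "\<bar>f n\<bar> \<le> d / L * real n powr (1/3)"
        and e7: "\<gamma> / 2 < (\<Sum>i=1..n. truncated_cube (w n i)) / real n"
        and e8: "real n powr (1/8) \<le> d * real n powr (1/3)"
        and e9: "1 \<le> d * real n powr (1/3)"
        and n: "1 \<le> n"
      define l where "l = total_weight w n"
      define x where "x = l powr (1/3)"
      have "real n powr (2/3) \<le> real n powr 1" using n by (intro powr_mono) auto
      then have "m1 / 2 * real n powr (2/3) \<le> m1 / 2 * real n" using m1 n by simp
      with e1 have "\<bar>l - m1 * real n\<bar> \<le> m1 * real n / 2" by (simp add: l_def)
      moreover have "0 < m1 * real n" using m1 n by simp
      ultimately have l: "m1 / 2 * real n \<le> l" "l \<le> 2 * m1 * real n" "0 < l" by linarith+
      have x0: "0 < x" using l by (simp add: x_def)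
      have x2: "x ^ 2 = l powr (2/3)" and x3: "x ^ 3 = l" and x4: "x ^ 4 = l powr (4/3)"
        using l by (simp_all add: x_def powr_power)
      have dx: "d * real n powr (1/3) \<le> x"
      proof -
        have "d * real n powr (1/3) = (m1 / 2 * real n) powr (1/3)" 
          unfolding d_def by (rule powr_mult[symmetric])
        also have "\<dots> \<le> x" unfolding x_def using l m1 by (intro powr_mono2) auto
        finally show ?thesis .
      qed
      have d2: "d\<^sup>2 * real n powr (2/3) \<le> x\<^sup>2"
      proof -
        have "d\<^sup>2 * real n powr (2/3) = (d * real n powr (1/3))\<^sup>2"
          using n by (simp add: power_mult_distrib powr_power)
        also have "\<dots> \<le> x\<^sup>2" using dx d by (intro power_mono) auto
        finally show ?thesis .
      qed
      have Kn: "real n \<le> K * x ^ 3" using l(1) m1 by (simp add: x3 K_def field_simps)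
      have f: "4 \<le> f n" "192 / c \<le> f n" using fF n by (auto simp: F_def)
      have Lf: "L * f n \<le> x"
      proof -
        have "L * f n \<le> L * (d / L * real n powr (1/3))" using e6 L by (intro mult_left_mono) auto
        with dx L show ?thesis by simp
      qed
      have nc: "near_critical {1..n} (w n) (edge_parameter w f n) x (f n) S c"
      proof
        show "finite {1..n}" by simp
        show "0 < w n u" if "u \<in> {1..n}" for u using wpos n that by auto
        show p: "edge_parameter w f n = (x + f n) / x ^ 4"
          by (simp add: edge_parameter_def x4) (simp add: x_def l_def)
        show "0 \<le> edge_parameter w f n" unfolding p using f x0 by simp
        show "1 \<le> x" using e9 dx by linarith
        show "1 \<le> f n" using f by simp
        show "2 * ((16 + 8 * S) / c) * f n \<le> x" using Lf by (simp add: L_def)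
        show "sum (w n) {1..n} = x ^ 3" by (simp add: x3 l_def total_weight_def)
        show "(\<Sum>u\<in>{1..n}. (w n u)\<^sup>2) \<le> x ^ 3 + x\<^sup>2"
          using e2 e3 d2 unfolding x3 l_def by linarith
        show "(\<Sum>u\<in>{1..n}. w n u ^ 3) \<le> S * x ^ 3"
        proof -
          have "(\<Sum>u\<in>{1..n}. w n u ^ 3) \<le> (m3 + 1) * real n" using e4 n by (simp add: algebra_simps)
          also have "\<dots> \<le> (m3 + 1) * (K * x ^ 3)" by (rule mult_left_mono[OF Kn]) (use m3 in simp)
          also have "\<dots> = S * x ^ 3" by (simp add: S_def K_def)
          finally show ?thesis .
        qed
        show "w n u \<le> x" if "u \<in> {1..n}" for u
        proof -
          have "w n u \<le> Max (w n ` {1..n})" using that by (intro Max_ge) auto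
          with e5 dx show ?thesis by linarith
        qed
        show "c * x ^ 3 \<le> (\<Sum>u\<in>{1..n}. (w n u)\<^sup>2 * min (w n u) 1)"
        proof -
          have "c * x ^ 3 \<le> \<gamma> / (4 * m1) * (2 * m1 * real n)"
            unfolding x3 using l c m1 \<gamma> by (intro mult_mono) (auto simp: c_def)
          also have "\<dots> = \<gamma> / 2 * real n" using m1 by simp
          also have "\<dots> \<le> (\<Sum>u\<in>{1..n}. truncated_cube (w n u))" using e7 n by (simp add: field_simps)
          also have "\<dots> \<le> (\<Sum>u\<in>{1..n}. (w n u)\<^sup>2 * min (w n u) 1)"
            by (intro sum_mono truncated_cube(5) wpos n)
          finally show ?thesis .
        qed
      qed (use S c in auto)
      show "measure_pmf.prob (random_graph n (w n) (edge_parameter w f n))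
          {E. A * f n ^ 3 \<le> real (largest_component_excess n E)} \<le> A * exp (- f n / A)"
      proof (rule random_graph_excess_tail[OF nc n _ Kn])
        show "24 * f n \<le> c * exp (f n / 2)"
        proof -
          have "192 \<le> c * f n" using f(2) c by (simp add: field_simps)
          then have "192 * f n \<le> c * f n * f n" using f by (intro mult_right_mono) auto
          then have "24 * f n \<le> c * ((f n / 2)\<^sup>2 / 2)" by (simp add: power2_eq_square)
          also have "\<dots> \<le> c * exp (f n / 2)"
            using exp_lower_Taylor_quadratic[of "f n / 2"] f c by (intro mult_left_mono) auto
          finally show ?thesis .
        qed
        show "exp (f n / 2) \<le> x" if "exp ((f n)\<^sup>2) < real n"
        proof -
          have "4 * f n \<le> (f n)\<^sup>2" using f by (simp add: power2_eq_square)
          then have "exp (f n / 2) \<le> exp ((f n)\<^sup>2 * (1/8))" by simp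
          also have "\<dots> = exp ((f n)\<^sup>2) powr (1/8)" by (simp add: powr_def)
          also have "\<dots> \<le> real n powr (1/8)" using that by (intro powr_mono2) auto
          finally show ?thesis using e8 dx by linarith
        qed
      qed (use K in \<open>auto simp: A_def\<close>)
    qed
  qed
  have "0 < F" "0 < A" by (auto simp: F_def A_def)
  with main show ?thesis by blast
qed

end
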